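(* For every integer $n\ge 3$, the positivity of the residues of a rational map of degree $n$ is neither sufficient nor necessary for it to be a rational Ahlfors function. That is, for every $n\geq 3$: (i) there exists a rational map of the form $R(z)=\sum_{j=1}^n \frac{a_j}{z-p_j}$, with $p_1,\dots,p_n\in\mathbb{C}$ distinct and all residues $a_1,\dots,a_n$ real and positive, which is not a rational Ahlfors function; (ii) there exists a rational Ahlfors function $R(z)=\sum_{j=1}^n \frac{a_j}{z-p_j}$ of degree $n$ (with $p_1,\dots,p_n\in\mathbb{C}$ distinct and $a_1,\dots,a_n\in\mathbb{C}\setminus\{0\}$) whose residues $a_1,\dots,a_n$ are not all real and positive.
   Context: $\widehat{\mathbb{C}}$ is the Riemann sphere and $\mathbb{D}=\{z\in\mathbb{C}:|z|<1\}$ is the open unit disk. For a rational map $R$, $R^{-1}(\mathbb{D})=\{z\in\widehat{\mathbb{C}}:|R(z)|<1\}$. Ahlfors function: let $X\subset\widehat{\mathbb{C}}$ be a domain containing $\infty$. For holomorphic $f:X\to\mathbb{C}$, put $f'(\infty):=\lim_{z\to\infty}z(f(z)-f(\infty))$. The Ahlfors function on $X$ is the unique function maximizing $\mathrm{Re}\,f'(\infty)$ among all holomorphic $f:X\to\mathbb{D}$ with $f(\infty)=0$. A rational map $R$ of degree $n$ is called $n$-good if $R(\infty)=0$, $R^{-1}(\mathbb{D})$ is connected, and $R^{-1}(\widehat{\mathbb{C}}\setminus\mathbb{D})$ has exactly $n$ connected components. Every $n$-good rational map has only simple poles, all in $\mathbb{C}$, and so can be written as $R(z)=\sum_{j=1}^n\frac{a_j}{z-p_j}$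 with $a_j\in\mathbb{C}\setminus\{0\}$ and distinct $p_j\in\mathbb{C}$. A rational Ahlfors function (of degree $n$) is an $n$-good rational map $R$ whose restriction to $R^{-1}(\mathbb{D})$ is the Ahlfors function on $R^{-1}(\mathbb{D})$. *)

theory Defs
  imports "HOL-Complex_Analysis.Complex_Analysis"
begin

text \<open>
  The Riemann sphere is the one-point compactification of the complex plane:
  \<open>Some z\<close> is the finite point \<open>z\<close> and \<open>None\<close> is the point at infinity.
\<close>

type_synonym riemann_sphere = "complex option"

abbreviation sphere_top :: "riemann_sphere topology" where
  "sphere_top \<equiv> Alexandroff_compactification (euclidean :: complex topology)"

definition unit_disk :: "riemann_sphere set" where
  "unit_disk = Some ` ball 0 1"

text \<open>The chart \<open>w \<mapsto> 1 / w\<close> around the point at infinity.\<close>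

definition chart_infinity :: "complex \<Rightarrow> riemann_sphere" where
  "chart_infinity w = (if w = 0 then None else Some (1 / w))"

definition sphere_domain :: "riemann_sphere set \<Rightarrow> bool" where
  "sphere_domain X \<longleftrightarrow> X \<noteq> {} \<and> openin sphere_top X \<and> connectedin sphere_top X"

definition sphere_holomorphic_on ::
    "(riemann_sphere \<Rightarrow> complex) \<Rightarrow> riemann_sphere set \<Rightarrow> bool" where
  "sphere_holomorphic_on f X \<longleftrightarrow>
     (\<lambda>z. f (Some z)) holomorphic_on (Some -` X) \<and>
     (\<lambda>w. f (chart_infinity w)) holomorphic_on (chart_infinity -` X)"

definition deriv_infinity :: "(riemann_sphere \<Rightarrow> complex) \<Rightarrow> complex" where
  "deriv_infinity f = Lim at_infinity (\<lambda>z. z * (f (Some z) - f None))"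

definition ahlfors_admissible ::
    "riemann_sphere set \<Rightarrow> (riemann_sphere \<Rightarrow> complex) \<Rightarrow> bool" where
  "ahlfors_admissible X f \<longleftrightarrow>
     sphere_holomorphic_on f X \<and> f ` X \<subseteq> ball 0 1 \<and> f None = 0"

text \<open>
  Functions on \<open>X\<close> are total functions whose values outside \<open>X\<close> are irrelevant,
  so uniqueness of the maximizer means agreement on \<open>X\<close>.
\<close>

definition is_ahlfors_function ::
    "riemann_sphere set \<Rightarrow> (riemann_sphere \<Rightarrow> complex) \<Rightarrow> bool" where
  "is_ahlfors_function X f \<longleftrightarrow>
     sphere_domain X \<and> None \<in> X \<and>
     ahlfors_admissible X f \<and>
     (\<forall>g. ahlfors_admissible X g \<longrightarrow> Re (deriv_infinity g) \<le> Re (deriv_infinity f)) \<and>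
     (\<forall>g. ahlfors_admissible X g \<and> Re (deriv_infinity g) = Re (deriv_infinity f) \<longrightarrow>
          (\<forall>x\<in>X. g x = f x))"

text \<open>
  The self-map of the sphere induced by the quotient \<open>p / q\<close> of coprime polynomials.
  If \<open>degree p \<le> degree q\<close>, then \<open>coeff p (degree q) / lead_coeff q\<close> is the limit of
  \<open>p / q\<close> at infinity (it is \<open>0\<close> when the inequality is strict).
\<close>

fun rational_fun :: "complex poly \<Rightarrow> complex poly \<Rightarrow> riemann_sphere \<Rightarrow> riemann_sphere" where
  "rational_fun p q (Some z) =
     (if poly q z = 0 then None else Some (poly p z / poly q z))"
| "rational_fun p q None =
     (if degree q < degree p then None else Some (coeff p (degree q) / lead_coeff q))"

definition rational_map :: "nat \<Rightarrow> (riemann_sphere \<Rightarrow> riemann_sphere) \<Rightarrow> bool" where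
  "rational_map n R \<longleftrightarrow>
     (\<exists>p q. q \<noteq> 0 \<and> coprime p q \<and> max (degree p) (degree q) = n \<and> R = rational_fun p q)"

definition good :: "nat \<Rightarrow> (riemann_sphere \<Rightarrow> riemann_sphere) \<Rightarrow> bool" where
  "good n R \<longleftrightarrow>
     rational_map n R \<and> R None = Some 0 \<and>
     connectedin sphere_top (R -` unit_disk) \<and>
     finite (connected_components_of (subtopology sphere_top (R -` (- unit_disk)))) \<and>
     card (connected_components_of (subtopology sphere_top (R -` (- unit_disk)))) = n"

text \<open>
  On \<open>R -` unit_disk\<close> the map \<open>R\<close> takes only finite values, so \<open>\<lambda>x. the (R x)\<close> is \<open>R\<close>
  regarded there as a complex-valued function.  The degree is an explicit parameter
  (it is determined by \<open>R\<close>).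
\<close>

definition rational_ahlfors_function ::
    "nat \<Rightarrow> (riemann_sphere \<Rightarrow> riemann_sphere) \<Rightarrow> bool" where
  "rational_ahlfors_function n R \<longleftrightarrow>
     good n R \<and> is_ahlfors_function (R -` unit_disk) (\<lambda>x. the (R x))"

text \<open>
  \<open>R(z) = (\<Sum>j=1..n. a j / (z - p j))\<close> with distinct \<open>p j\<close> and nonzero \<open>a j\<close>.  The poles
  are excluded from the identity because division by zero yields zero; the values of a
  rational map at its poles and at infinity are forced by the remaining ones.
\<close>

definition has_partial_fractions ::
    "nat \<Rightarrow> (riemann_sphere \<Rightarrow> riemann_sphere) \<Rightarrow> (nat \<Rightarrow> complex) \<Rightarrow> (nat \<Rightarrow> complex) \<Rightarrow> bool" where
  "has_partial_fractions n R a p \<longleftrightarrow>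
     inj_on p {1..n} \<and> (\<forall>j\<in>{1..n}. a j \<noteq> 0) \<and>
     (\<forall>z. z \<notin> p ` {1..n} \<longrightarrow> R (Some z) = Some (\<Sum>j=1..n. a j / (z - p j)))"

end

theory Submission
  imports Defs "HOL-Computational_Algebra.Fundamental_Theorem_Algebra" "HOL-Probability.Discrete_Topology"
begin

text \<open>
  (i) Let all residues be \<open>1\<close> and the poles be the \<open>n\<close>-th roots of unity. On the unit circle
  \<open>Re (z / (z - p j)) = 1 / 2\<close>, hence \<open>cmod (R z) \<ge> n / 2 > 1\<close>, so the circle separates the zeros \<open>0\<close> and
  \<open>\<infinity>\<close> of \<open>R\<close>.

  (ii) For well separated poles, the complement of the domain consists of \<open>n\<close> holes, the images of the closed unit
  disc under branches \<open>Z j\<close> of the inverse of \<open>1 / R\<close>. If \<open>S\<close> is holomorphic off the holes, \<open>S \<infinity> = 1\<close>, and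
  \<open>R S\<^sup>2 dz / \<i>\<close> pulls back to a positive measure on each boundary circle, then
  \<open>f' \<infinity> = (1 / (2 * \<pi> * \<i>)) \<Sum>\<^sub>j \<integral> f S\<^sup>2 dz\<close> shows that \<open>R\<close> is extremal. Such an \<open>S\<close> is obtained from
  densities \<open>F j\<close>, the fixed point of an antilinear contraction, provided that every \<open>A j * (F j 0)\<^sup>2\<close> is
  positive. Take one residue \<open>1\<close> at \<open>0\<close>, tiny residues \<open>\<epsilon> * cis (\<plusminus> \<phi>)\<close> at the close conjugate
  poles \<open>20 \<plusminus> \<i> * \<eta>\<close>, and even smaller positive ones elsewhere on the real axis. By symmetry only the pole
  \<open>20 + \<i> * \<eta>\<close> has to be considered. The interaction of the pair tilts \<open>F 2 0\<close> off the real axis, and the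
  intermediate value theorem gives \<open>\<phi>\<close> strictly between \<open>0\<close> and \<open>\<pi> / 2\<close> compensating the tilt.
\<close>

section \<open>Integrals over circles\<close>

text \<open>\<open>S\<close> is sought as 1 minus a Cauchy transform of the conjugate densities. Its
  boundary value is then real up to a fixed phase, except for a constant coming from
  \<open>F j 0\<close>. This leaves one real condition per hole, and symmetry reduces them to one
  equation for \<phi>. Branches and densities are analytic across the unit circle, so statements on
  the boundary are limits of identities on circles of radius \<open>r > 1\<close>. The difficulty is
  to see the tilt of the pair against all error terms. A constant density does not act on another
  hole at all, so two tiny poles alone would not tilt each other to leading order. The residue 1 at
  0 bends the branches near 20: the density there is nearly \<open>1 / (1 - u / 20)\<close>, and the
  tilt comes from the first Fourier coefficient 20 / 399 of its squared modulus. The scales obey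
  \<open>ex_eps < ex_eta^2 < 1\<close> by wide margins, so that a tilt of order
  \<open>ex_eps / ex_eta\<close> dominates errors of order \<open>ex_eps\<close> while the holes of
  the pair stay tiny compared to their distance.\<close>

definition cint :: "real \<Rightarrow> (complex \<Rightarrow> complex) \<Rightarrow> complex" where
  "cint r h = integral {0..1} (\<lambda>t. h (r * cis (2 * pi * t)) * (r * cis (2 * pi * t)))"

lemma circlepath_0_eq: "circlepath 0 r t = r * cis (2 * pi * t)"
  by (simp add: circlepath cis_conv_exp algebra_simps)

text \<open>The normalization by \<open>2 * pi * \<i>\<close> keeps constants out of Cauchy's
  formula. The explicit integral over [0, 1] in the definition is what norm bounds and parameter
  dependence work with.\<close>

lemma cint_eq_contour_integral:
  "cint r h = contour_integral (circlepath 0 r) h / (2 * pi * \<i>)"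
proof -
  have "contour_integral (circlepath 0 r) h
      = integral {0..1} (\<lambda>t. (2 * pi * \<i>) * (h (r * cis (2 * pi * t)) * (r * cis (2 * pi * t))))"
    unfolding contour_integral_integral
    by (rule integral_cong) (simp add: circlepath_0_eq vector_derivative_circlepath cis_conv_exp mult_ac)
  also have "\<dots> = (2 * pi * \<i>) * cint r h"
    unfolding cint_def by (rule integral_mult_right)
  finally show ?thesis by simp
qed

lemma has_contour_integral_imp_cint:
  "(h has_contour_integral (2 * pi * \<i>) * c) (circlepath 0 r) \<Longrightarrow> cint r h = c"
  by (simp add: cint_eq_contour_integral contour_integral_unique)

lemma continuous_on_circle_param:
  assumes "continuous_on (sphere 0 r) h" "r \<ge> 0"
  shows "continuous_on S (\<lambda>t::real. h (r * cis (2 * pi * t)) * (r * cis (2 * pi * t)))"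
proof -
  have cis: "continuous_on S (\<lambda>t::real. cis (2 * pi * t))"
    by (intro continuous_intros)
  then have "continuous_on S (\<lambda>t::real. r * cis (2 * pi * t))"
    by (intro continuous_intros)
  moreover have "(\<lambda>t::real. r * cis (2 * pi * t)) ` S \<subseteq> sphere 0 r"
    using assms(2) by (auto simp: norm_mult)
  ultimately show ?thesis
    by (intro continuous_on_mult continuous_on_compose2[OF assms(1)] cis continuous_on_const) auto
qed

lemma cint_integrable:
  assumes "continuous_on (sphere 0 r) h" "r \<ge> 0"
  shows "(\<lambda>t. h (r * cis (2 * pi * t)) * (r * cis (2 * pi * t))) integrable_on {0..1}"
  by (rule integrable_continuous_interval[OF continuous_on_circle_param[OF assms]])

lemma cint_cong:
  assumes "\<And>u. norm u = r \<Longrightarrow> h u = k u" "r \<ge> 0"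
  shows "cint r h = cint r k"
  unfolding cint_def by (rule integral_cong) (use assms in \<open>simp add: norm_mult\<close>)

lemma cint_add:
  assumes "continuous_on (sphere 0 r) h" "continuous_on (sphere 0 r) k" "r \<ge> 0"
  shows "cint r (\<lambda>u. h u + k u) = cint r h + cint r k"
  using integral_add[OF cint_integrable[OF assms(1,3)] cint_integrable[OF assms(2,3)]]
  unfolding cint_def by (simp add: distrib_right)

lemma cint_cmult: "cint r (\<lambda>u. c * h u) = c * cint r h"
  unfolding cint_def by (simp add: mult.assoc)

lemma cint_diff:
  assumes "continuous_on (sphere 0 r) h" "continuous_on (sphere 0 r) k" "r \<ge> 0"
  shows "cint r (\<lambda>u. h u - k u) = cint r h - cint r k"
  using cint_add[OF assms(1) _ assms(3), of "\<lambda>u. (-1) * k u"] cint_cmult[of r "-1" k] assms(2)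
  by (auto simp: continuous_on_minus)

lemma norm_cint_le:
  assumes "continuous_on (sphere 0 r) h" "r \<ge> 0" "\<And>u. norm u = r \<Longrightarrow> norm (h u) \<le> B"
  shows "norm (cint r h) \<le> r * B"
proof -
  have "norm (cint r h) \<le> r * B * (1 - 0)"
    unfolding cint_def
  proof (rule integral_bound)
    show "continuous_on {0..1} (\<lambda>t. h (r * cis (2 * pi * t)) * (r * cis (2 * pi * t)))"
      by (rule continuous_on_circle_param[OF assms(1,2)])
  next
    fix t :: real
    have "norm (h (r * cis (2 * pi * t))) * r \<le> B * r"
      by (rule mult_right_mono[OF assms(3) assms(2)]) (use assms(2) in \<open>simp add: norm_mult\<close>)
    then show "norm (h (r * cis (2 * pi * t)) * (r * cis (2 * pi * t))) \<le> r * B"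
      using assms(2) by (simp add: norm_mult mult_ac)
  qed auto
  then show ?thesis by simp
qed

lemma cint_holomorphic:
  assumes "h holomorphic_on ball 0 R" "0 < r" "r < R"
  shows "cint r h = 0"
proof -
  have "(h has_contour_integral 0) (circlepath 0 r)"
    by (rule Cauchy_theorem_convex_simple[OF assms(1)]) (use assms in auto)
  then show ?thesis
    by (simp add: cint_eq_contour_integral contour_integral_unique)
qed

lemma cint_Cauchy:
  assumes "h holomorphic_on ball 0 R" "0 < r" "r < R" "norm w < r"
  shows "cint r (\<lambda>u. h u / (u - w)) = h w"
proof (rule has_contour_integral_imp_cint)
  have "h holomorphic_on cball 0 r"
    by (rule holomorphic_on_subset[OF assms(1)]) (use assms in auto)
  from Cauchy_integral_circlepath_simple[OF this, of w] assms
  show "((\<lambda>u. h u / (u - w)) has_contour_integral (2 * pi * \<i>) * h w) (circlepath 0 r)"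
    by (simp add: mult_ac)
qed

text \<open>On the unit circle the conjugate of \<open>u\<close> is \<open>1 / u\<close>, so
  conjugating the factor \<open>u\<close> that stands for the differential costs a division by
  \<open>u^2\<close>.\<close>

lemma cnj_cint_unit: "cnj (cint 1 h) = cint 1 (\<lambda>u. cnj (h u) / u\<^sup>2)"
proof -
  have "cnj (cint 1 h) = integral {0..1} (\<lambda>t. cnj (h (cis (2 * pi * t)) * cis (2 * pi * t)))"
    unfolding cint_def by (simp add: integral_cnj)
  also have "\<dots> = cint 1 (\<lambda>u. cnj (h u) / u\<^sup>2)"
    unfolding cint_def
    by (rule integral_cong) (simp add: cis_cnj power2_eq_square divide_inverse cis_mult mult_ac)
  finally show ?thesis .
qed

text \<open>Conjugation reverses the orientation of the circle and also changes the sign of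
  \<open>2 * pi * \<i>\<close>; the two signs cancel.\<close>

lemma cint_cnj_symmetric: "cint r (\<lambda>u. cnj (h (cnj u))) = cnj (cint r h)"
proof -
  have rev: "cnj \<circ> circlepath 0 r = reversepath (circlepath 0 r)"
  proof
    fix t :: real
    have "cis (2 * pi * (1 - t)) = cis (2 * pi) * cis (- (2 * pi * t))"
      unfolding cis_mult by (simp add: algebra_simps)
    then show "(cnj \<circ> circlepath 0 r) t = reversepath (circlepath 0 r) t"
      by (simp add: reversepath_def circlepath_0_eq cis_cnj)
  qed
  have "contour_integral (reversepath (circlepath 0 r)) h
      = cnj (contour_integral (circlepath 0 r) (cnj \<circ> h \<circ> cnj))"
    unfolding rev[symmetric] by (rule contour_integral_cnj) auto
  then have "contour_integral (circlepath 0 r) (cnj \<circ> h \<circ> cnj)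
      = - cnj (contour_integral (circlepath 0 r) h)"
    by (metis complex_cnj_cnj complex_cnj_minus contour_integral_reversepath valid_path_circlepath)
  then show ?thesis
    by (simp add: cint_eq_contour_integral o_def)
qed

text \<open>For \<open>norm u = 1\<close>, \<open>cnj (F u)\<close> is the boundary value of a function holomorphic outside the disc.\<close>
lemma cint_cnj_Cauchy_outside:
  assumes F: "F holomorphic_on ball 0 R" "1 < R" and w: "1 < norm w"
  shows "cint 1 (\<lambda>u. cnj (F u) / (u - w)) = cnj (F 0) - cnj (F (1 / cnj w))"
proof -
  have w0: "w \<noteq> 0" using w by auto
  have cF: "continuous_on (sphere 0 1) F"
    by (rule continuous_on_subset[OF holomorphic_on_imp_continuous_on[OF F(1)]]) (use F(2) in auto)
  have nw: "norm (1 / cnj w) < 1" using w by (simp add: norm_divide divide_less_eq)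
  have "cnj (cint 1 (\<lambda>u. cnj (F u) / (u - w))) = cint 1 (\<lambda>u. F u / cnj (u - w) / u\<^sup>2)"
    by (simp add: cnj_cint_unit)
  \<comment> \<open>With \<open>cnj u = 1 / u\<close> the integrand is
    \<open>F u / (u * (1 - u * cnj w))\<close>; its partial fractions have their poles at 0 and at
    the reflection of \<open>w\<close>, both inside the circle.\<close>
  also have "\<dots> = cint 1 (\<lambda>u. F u / (u - 0) - F u / (u - 1 / cnj w))"
  proof (rule cint_cong)
    fix u :: complex assume u: "norm u = 1"
    then have "u * cnj u = 1" by (simp add: complex_norm_square[symmetric])
    moreover from u have u0: "u \<noteq> 0" by auto
    ultimately have cu: "cnj u = 1 / u" by (simp add: field_simps)
    have ne: "u * cnj w \<noteq> 1"
    proof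
      assume "u * cnj w = 1"
      then have "norm u * norm w = 1" by (metis complex_mod_cnj norm_mult norm_one)
      then show False using u w by simp
    qed
    show "F u / cnj (u - w) / u\<^sup>2 = F u / (u - 0) - F u / (u - 1 / cnj w)"
      using u0 w0 ne by (simp add: cu divide_simps power2_eq_square) (simp add: algebra_simps)
  qed simp
  also have "\<dots> = cint 1 (\<lambda>u. F u / (u - 0)) - cint 1 (\<lambda>u. F u / (u - 1 / cnj w))"
    by (rule cint_diff) (use nw in \<open>auto intro!: continuous_intros cF\<close>)
  also have "\<dots> = F 0 - F (1 / cnj w)"
    using cint_Cauchy[OF F(1), of 1 0] cint_Cauchy[OF F(1), of 1 "1 / cnj w"] F(2) nw by simp
  finally show ?thesis by (metis complex_cnj_cnj complex_cnj_diff)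
qed

section \<open>Dependence of integrals on a parameter\<close>

lemma continuous_on_integral_param:
  fixes F :: "'a::topological_space \<Rightarrow> real \<Rightarrow> complex"
  assumes "continuous_on (U \<times> {0..1}) (\<lambda>(w, t). F w t)"
  shows "continuous_on U (\<lambda>w. integral {0..1} (F w))"
  using integral_continuous_on_param[of U 0 "1::real" F] assms by (simp add: cbox_interval)

text \<open>Morera's theorem: integration over a triangle commutes with the parameter integral, and
  for each fixed \<open>t\<close> Cauchy's theorem makes the triangle integral vanish. Reading the
  interval as the segment from 0 to 1, with \<open>H\<close> depending only on \<open>Re z\<close>,
  turns the interchange into one of two contour integrals.\<close>

lemma holomorphic_integral_param:
  fixes F :: "complex \<Rightarrow> real \<Rightarrow> complex"
  assumes U: "open U" and cont: "continuous_on (U \<times> {0..1}) (\<lambda>(w, t). F w t)"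
    and hol: "\<And>t. t \<in> {0..1} \<Longrightarrow> (\<lambda>w. F w t) holomorphic_on U"
  shows "(\<lambda>w. integral {0..1} (F w)) holomorphic_on U"
proof -
  define G where "G w = integral {0..1} (F w)" for w
  define H where "H w z = F w (Re z)" for w and z :: complex
  have GH: "G w = contour_integral (linepath 0 1) (H w)" for w
    unfolding contour_integral_integral G_def H_def
    by (simp add: linepath_def scaleR_conv_of_real)
  have Re01: "Re z \<in> {0..1}" if "z \<in> closed_segment 0 1" for z
    using that by (auto simp: closed_segment_def)
  have swap: "contour_integral (linepath a b) G
      = contour_integral (linepath 0 1) (\<lambda>z. contour_integral (linepath a b) (\<lambda>w. H w z))"
    if "closed_segment a b \<subseteq> U" for a b
    unfolding GH
  proof (rule contour_integral_swap)
    have "continuous_on (closed_segment a b \<times> closed_segment 0 1) ((\<lambda>(w,t). F w t) \<circ> (\<lambda>(w,z). (w, Re z)))"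
      by (intro continuous_on_compose continuous_on_subset[OF cont])
         (use that Re01 in \<open>auto intro!: continuous_intros simp: case_prod_unfold\<close>)
    then show "continuous_on (path_image (linepath a b) \<times> path_image (linepath 0 1)) (\<lambda>(y1, y2). H y1 y2)"
      by (simp add: H_def o_def case_prod_unfold)
  qed auto
  have "G analytic_on U"
  proof (rule Morera_triangle[OF _ U], goal_cases)
    case 1
    show ?case unfolding G_def by (rule continuous_on_integral_param[OF cont])
  next
    case (2 a b c)
    show ?case
    proof
      assume sub: "convex hull {a,b,c} \<subseteq> U"
      have seg: "closed_segment a b \<subseteq> U" "closed_segment b c \<subseteq> U" "closed_segment c a \<subseteq> U"
        by (rule order_trans[OF closed_segment_subset[OF _ _ convex_convex_hull] sub]; simp add: hull_inc)+
      let ?I = "\<lambda>a b z. contour_integral (linepath a b) (\<lambda>w. H w z)"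
      have cH: "continuous_on (closed_segment 0 1) (?I a b)" if s: "closed_segment a b \<subseteq> U" for a b
      proof -
        have "?I a b z = integral {0..1} (\<lambda>x. H (linepath a b x) z * (b - a))" for z
          by (simp add: contour_integral_integral)
        moreover have "continuous_on (closed_segment 0 1) (\<lambda>z. integral {0..1} (\<lambda>x. H (linepath a b x) z * (b - a)))"
        proof (rule continuous_on_integral_param)
          have lin: "linepath a b x \<in> U" if "x \<in> {0..1}" for x
            using s that by (auto simp: linepath_in_path)
          have "continuous_on (closed_segment 0 1 \<times> {0..1})
              ((\<lambda>(w,t). F w t) \<circ> (\<lambda>(z,x). (linepath a b x, Re z)))"
            by (intro continuous_on_compose continuous_on_subset[OF cont])
               (use lin Re01 in \<open>auto intro!: continuous_intros simp: case_prod_unfold linepath_def\<close>)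
          then show "continuous_on (closed_segment 0 1 \<times> {0..1})
             (\<lambda>(z, x). H (linepath a b x) z * (b - a))"
            by (auto simp: H_def o_def case_prod_unfold intro!: continuous_intros)
        qed
        ultimately show ?thesis by simp
      qed
      have int: "?I a b contour_integrable_on linepath 0 1" if s: "closed_segment a b \<subseteq> U" for a b
        by (rule contour_integrable_continuous_linepath[OF cH[OF s]])
      have zero: "?I a b z + ?I b c z + ?I c a z = 0" if z: "z \<in> closed_segment 0 1" for z
      proof -
        have "(\<lambda>w. H w z) holomorphic_on convex hull {a,b,c}"
          unfolding H_def by (rule holomorphic_on_subset[OF hol[OF Re01[OF z]] sub])
        from Cauchy_theorem_triangle[OF this] have T: "((\<lambda>w. H w z) has_contour_integral 0)
            (linepath a b +++ linepath b c +++ linepath c a)" .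
        have cz: "continuous_on U (\<lambda>w. H w z)"
          unfolding H_def by (rule holomorphic_on_imp_continuous_on[OF hol[OF Re01[OF z]]])
        have i: "(\<lambda>w. H w z) contour_integrable_on linepath p q" if "closed_segment p q \<subseteq> U" for p q
          by (rule contour_integrable_continuous_linepath[OF continuous_on_subset[OF cz that]])
        have "contour_integral (linepath a b +++ linepath b c +++ linepath c a) (\<lambda>w. H w z)
            = ?I a b z + (?I b c z + ?I c a z)"
          using i[OF seg(1)] i[OF seg(2)] i[OF seg(3)] by (simp add: contour_integrable_joinI)
        then show ?thesis using contour_integral_unique[OF T] by (simp add: add.assoc)
      qed
      have "contour_integral (linepath a b) G + contour_integral (linepath b c) G
          + contour_integral (linepath c a) G
        = contour_integral (linepath 0 1) (\<lambda>z. ?I a b z + ?I b c z + ?I c a z)"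
        using swap[OF seg(1)] swap[OF seg(2)] swap[OF seg(3)] int[OF seg(1)] int[OF seg(2)] int[OF seg(3)]
        by (simp add: contour_integral_add contour_integrable_add)
      also have "\<dots> = contour_integral (linepath 0 1) (\<lambda>z. 0)"
        by (rule contour_integral_cong) (auto simp: zero)
      finally show "contour_integral (linepath a b) G + contour_integral (linepath b c) G
          + contour_integral (linepath c a) G = 0" by simp
    qed
  qed
  then show ?thesis
    unfolding G_def by (rule analytic_imp_holomorphic)
qed

lemma continuous_on_cint_param:
  assumes "continuous_on (U \<times> sphere 0 r) (\<lambda>(w, u). f w u)" "r \<ge> 0"
  shows "continuous_on U (\<lambda>w. cint r (f w))"
  unfolding cint_def
proof (rule continuous_on_integral_param)
  have "continuous_on (U \<times> {0..1}) ((\<lambda>(w,u). f w u) \<circ> (\<lambda>(w,t). (w, r * cis (2 * pi * t))))"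
    by (intro continuous_on_compose continuous_on_subset[OF assms(1)])
       (use assms(2) in \<open>auto intro!: continuous_intros simp: case_prod_unfold norm_mult\<close>)
  then show "continuous_on (U \<times> {0..1})
      (\<lambda>(w, t). f w (r * cis (2 * pi * t)) * (r * cis (2 * pi * t)))"
    by (auto simp: o_def case_prod_unfold intro!: continuous_intros)
qed

lemma holomorphic_cint_param:
  assumes "open U" "continuous_on (U \<times> sphere 0 r) (\<lambda>(w, u). f w u)" "r \<ge> 0"
    and "\<And>u. norm u = r \<Longrightarrow> (\<lambda>w. f w u) holomorphic_on U"
  shows "(\<lambda>w. cint r (f w)) holomorphic_on U"
  unfolding cint_def
proof (rule holomorphic_integral_param[OF assms(1)])
  have "continuous_on (U \<times> {0..1}) ((\<lambda>(w,u). f w u) \<circ> (\<lambda>(w,t). (w, r * cis (2 * pi * t))))"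
    by (intro continuous_on_compose continuous_on_subset[OF assms(2)])
       (use assms(3) in \<open>auto intro!: continuous_intros simp: case_prod_unfold norm_mult\<close>)
  then show "continuous_on (U \<times> {0..1})
      (\<lambda>(w, t). f w (r * cis (2 * pi * t)) * (r * cis (2 * pi * t)))"
    by (auto simp: o_def case_prod_unfold intro!: continuous_intros)
next
  fix t :: real
  show "(\<lambda>w. f w (r * cis (2 * pi * t)) * (r * cis (2 * pi * t))) holomorphic_on U"
    by (intro holomorphic_intros assms(4)) (use assms(3) in \<open>simp add: norm_mult\<close>)
qed

section \<open>Rational maps from partial fractions\<close>

definition pf_den :: "nat \<Rightarrow> (nat \<Rightarrow> complex) \<Rightarrow> complex poly" where
  "pf_den n p = (\<Prod>j=1..n. [:- p j, 1:])"

definition pf_num :: "nat \<Rightarrow> (nat \<Rightarrow> complex) \<Rightarrow> (nat \<Rightarrow> complex) \<Rightarrow> complex poly" where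
  "pf_num n a p = (\<Sum>j=1..n. smult (a j) (\<Prod>k\<in>{1..n} - {j}. [:- p k, 1:]))"

definition pf_map :: "nat \<Rightarrow> (nat \<Rightarrow> complex) \<Rightarrow> (nat \<Rightarrow> complex) \<Rightarrow> riemann_sphere \<Rightarrow> riemann_sphere" where
  "pf_map n a p = rational_fun (pf_num n a p) (pf_den n p)"

lemma poly_pf_den: "poly (pf_den n p) z = (\<Prod>j=1..n. z - p j)"
  by (simp add: pf_den_def poly_prod)

lemma degree_prod_linear:
  fixes p :: "'i \<Rightarrow> complex"
  shows "finite S \<Longrightarrow> degree (\<Prod>k\<in>S. [:- p k, 1:]) = card S"
  by (subst degree_prod_sum_eq) auto

lemma pf_den_nonzero [simp]: "pf_den n p \<noteq> 0"
  by (simp add: pf_den_def)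

lemma degree_pf_den: "degree (pf_den n p) = n"
  by (simp add: pf_den_def degree_prod_linear)

lemma degree_pf_num:
  assumes "n > 0"
  shows "degree (pf_num n a p) < n"
proof -
  have "degree (pf_num n a p) \<le> n - 1"
    unfolding pf_num_def
  proof (rule degree_sum_le)
    fix j assume "j \<in> {1..n}"
    have "degree (smult (a j) (\<Prod>k\<in>{1..n} - {j}. [:- p k, 1:]))
        \<le> degree (\<Prod>k\<in>{1..n} - {j}. [:- p k, 1:])"
      by (rule degree_smult_le)
    also have "\<dots> = n - 1"
      using \<open>j \<in> {1..n}\<close> by (simp add: degree_prod_linear)
    finally show "degree (smult (a j) (\<Prod>k\<in>{1..n} - {j}. [:- p k, 1:])) \<le> n - 1" .
  qed auto
  then show ?thesis using assms by linarith
qed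

lemma poly_pf_num_pole:
  assumes "i \<in> {1..n}"
  shows "poly (pf_num n a p) (p i) = a i * (\<Prod>k\<in>{1..n} - {i}. p i - p k)"
proof -
  have "poly (pf_num n a p) (p i) = (\<Sum>j=1..n. a j * (\<Prod>k\<in>{1..n} - {j}. p i - p k))"
    by (simp add: pf_num_def poly_sum poly_prod)
  also have "\<dots> = (\<Sum>j\<in>{i}. a j * (\<Prod>k\<in>{1..n} - {j}. p i - p k))"
    by (rule sum.mono_neutral_right) (use assms in auto)
  finally show ?thesis by simp
qed

lemma poly_pf_num_eq:
  assumes "z \<notin> p ` {1..n}"
  shows "poly (pf_num n a p) z = (\<Sum>j=1..n. a j / (z - p j)) * poly (pf_den n p) z"
proof -
  have "poly (pf_num n a p) z = (\<Sum>j=1..n. a j * (\<Prod>k\<in>{1..n} - {j}. z - p k))"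
    by (simp add: pf_num_def poly_sum poly_prod)
  also have "\<dots> = (\<Sum>j=1..n. a j / (z - p j) * (\<Prod>k=1..n. z - p k))"
  proof (rule sum.cong)
    fix j assume j: "j \<in> {1..n}"
    then have "z - p j \<noteq> 0" using assms by auto
    moreover have "(\<Prod>k=1..n. z - p k) = (z - p j) * (\<Prod>k\<in>{1..n} - {j}. z - p k)"
      using j by (simp add: prod.remove)
    ultimately show "a j * (\<Prod>k\<in>{1..n} - {j}. z - p k) = a j / (z - p j) * (\<Prod>k=1..n. z - p k)"
      by simp
  qed auto
  finally show ?thesis by (simp add: poly_pf_den sum_distrib_right)
qed

lemma pf_map_Some:
  assumes "z \<notin> p ` {1..n}"
  shows "pf_map n a p (Some z) = Some (\<Sum>j=1..n. a j / (z - p j))"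
proof -
  have "poly (pf_den n p) z \<noteq> 0"
    using assms by (auto simp: poly_pf_den)
  then show ?thesis
    using poly_pf_num_eq[OF assms, of a] by (simp add: pf_map_def)
qed

lemma pf_map_pole:
  assumes "z \<in> p ` {1..n}"
  shows "pf_map n a p (Some z) = None"
  using assms by (auto simp: pf_map_def poly_pf_den)

lemma pf_map_None:
  assumes "n > 0"
  shows "pf_map n a p None = Some 0"
  using degree_pf_num[OF assms, of a p] by (simp add: pf_map_def degree_pf_den coeff_eq_0)

text \<open>A nonconstant common divisor would have a root, necessarily some \<open>p i\<close>; but
  there only one summand of the numerator survives, and it is nonzero.\<close>

lemma rational_map_pf_map:
  assumes "n > 0" "inj_on p {1..n}" "\<And>j. j \<in> {1..n} \<Longrightarrow> a j \<noteq> 0"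
  shows "rational_map n (pf_map n a p)"
proof -
  have "coprime (pf_num n a p) (pf_den n p)"
  proof (rule coprimeI)
    fix d assume d: "d dvd pf_num n a p" "d dvd pf_den n p"
    show "is_unit d"
    proof (rule ccontr)
      assume "\<not> is_unit d"
      moreover have "d \<noteq> 0" using d(2) by auto
      ultimately have "degree d \<noteq> 0" by (simp add: is_unit_iff_degree)
      then have "\<not> constant (poly d)" by (simp add: constant_degree)
      then obtain z where z: "poly d z = 0"
        using fundamental_theorem_of_algebra by blast
      then have "poly (pf_num n a p) z = 0" "poly (pf_den n p) z = 0"
        using d z by (meson dvd_trans poly_eq_0_iff_dvd)+
      then obtain i where i: "i \<in> {1..n}" "z = p i" by (auto simp: poly_pf_den)
      have "(\<Prod>k\<in>{1..n} - {i}. p i - p k) \<noteq> 0"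
        using i(1) inj_onD[OF assms(2)] by (subst prod_zero_iff) force+
      with \<open>poly (pf_num n a p) z = 0\<close> show False
        using poly_pf_num_pole[OF i(1), of a p] assms(3)[OF i(1)] i(2) by simp
    qed
  qed
  moreover have "max (degree (pf_num n a p)) (degree (pf_den n p)) = n"
    using degree_pf_num[OF assms(1), of a p] by (simp add: degree_pf_den)
  ultimately show ?thesis
    unfolding rational_map_def pf_map_def by (intro exI conjI) (rule pf_den_nonzero, auto)
qed

lemma has_partial_fractions_pf_map:
  assumes "inj_on p {1..n}" "\<And>j. j \<in> {1..n} \<Longrightarrow> a j \<noteq> 0"
  shows "has_partial_fractions n (pf_map n a p) a p"
  using assms by (auto simp: has_partial_fractions_def pf_map_Some)

text \<open>For \<open>v \<noteq> 0\<close> the numerator minus \<open>v\<close> times the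
  denominator still has degree \<open>n\<close>, so \<open>n\<close> known preimages of
  \<open>v\<close> are all of them.\<close>

lemma pf_map_eq_at_most:
  assumes "n > 0" "v \<noteq> 0" "finite Z" "card Z = n"
    and "\<And>z. z \<in> Z \<Longrightarrow> pf_map n a p (Some z) = Some v" "pf_map n a p (Some x) = Some v"
  shows "x \<in> Z"
proof -
  let ?q = "pf_num n a p - smult v (pf_den n p)"
  have root: "poly ?q z = 0" if "pf_map n a p (Some z) = Some v" for z
    using that by (auto simp: pf_map_def field_simps split: if_splits)
  have dnum: "degree (pf_num n a p) < n" by (rule degree_pf_num[OF assms(1)])
  have "coeff ?q n \<noteq> 0"
    using assms(2) dnum leading_coeff_0_iff[of "pf_den n p"] by (simp add: coeff_eq_0 degree_pf_den)
  then have q0: "?q \<noteq> 0" by force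
  have deg: "degree ?q \<le> n"
    by (rule degree_diff_le) (use dnum degree_smult_le[of v "pf_den n p"] in \<open>simp_all add: degree_pf_den\<close>)
  have "finite {z. poly ?q z = 0}" "card {z. poly ?q z = 0} \<le> n"
    using q0 deg card_poly_roots_bound[OF q0] poly_roots_finite[OF q0] by auto
  moreover have "insert x Z \<subseteq> {z. poly ?q z = 0}" using root assms(5,6) by auto
  ultimately have "card (insert x Z) \<le> n" by (meson card_mono le_trans)
  then show ?thesis using assms(3,4) by (metis Suc_n_not_le_n card_insert_disjoint)
qed

text \<open>A circle missing \<open>X\<close> would split \<open>X\<close> into the part in the open
  disc and the part in the exterior with infinity, both relatively open.\<close>

lemma sphere_separated_by_circle:
  assumes "connectedin sphere_top X" "Some c \<in> X" "None \<in> X" "r > 0"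
  shows "\<exists>z. dist c z = r \<and> Some z \<in> X"
proof (rule ccontr)
  assume no: "\<nexists>z. dist c z = r \<and> Some z \<in> X"
  let ?U = "Some ` ball c r" and ?V = "insert None (Some ` (UNIV - cball c r))"
  have o1: "openin sphere_top ?U" by simp
  have o2: "openin sphere_top ?V"
    unfolding openin_Alexandroff_compactification by (rule disjI2) (rule exI[of _ "cball c r"], simp)
  have cov: "X \<subseteq> ?U \<union> ?V"
  proof
    fix x assume x: "x \<in> X"
    show "x \<in> ?U \<union> ?V"
    proof (cases x)
      case (Some z)
      with no x have "dist c z \<noteq> r" by blast
      then have "dist c z < r \<or> \<not> dist c z \<le> r" by linarith
      then show ?thesis using Some by auto
    qed simp
  qed
  have d: "?U \<inter> ?V \<inter> X = {}" by auto
  have "Some c \<in> ?U \<inter> X" using assms(2,4) by auto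
  moreover have "None \<in> ?V \<inter> X" using assms(3) by simp
  ultimately have ne: "?U \<inter> X \<noteq> {}" "?V \<inter> X \<noteq> {}" by blast+
  show False
    by (rule connectedinD[OF assms(1) o1 o2 cov d ne])
qed

lemma exists_positive_residues_not_good:
  assumes "n \<ge> 3"
  shows "\<exists>a p. rational_map n (pf_map n a p) \<and> has_partial_fractions n (pf_map n a p) a p \<and>
            (\<forall>j\<in>{1..n}. a j \<in> \<real> \<and> Re (a j) > 0) \<and> \<not> good n (pf_map n a p)"
proof -
  define p where "p j = cis (2 * pi * real j / real n)" for j
  define a where "a j = (1::complex)" for j :: nat
  let ?R = "pf_map n a p"
  have n0: "n > 0" using assms by simp
  have bij: "bij_betw p {..<n} {z. z ^ n = 1}"
    unfolding p_def using Complex.bij_betw_roots_unity[OF n0] by simp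
  have pn: "p n = p 0" using n0 by (simp add: p_def)
  \<comment> \<open>The indices run from 1 to \<open>n\<close> instead of 0 to \<open>n - 1\<close>;
    since \<open>p n = p 0\<close>, the same roots of unity are enumerated.\<close>
  have sumeq: "(\<Sum>j=1..n. f (p j)) = (\<Sum>z\<in>{z. z ^ n = 1}. f z)" for f :: "complex \<Rightarrow> complex"
  proof -
    have "(\<Sum>j=1..n. f (p j)) = (\<Sum>j<n. f (p (Suc j)))"
      by (simp add: sum.atLeast1_atMost_eq)
    also have "\<dots> = (\<Sum>j<n. f (p j))"
      using sum.lessThan_Suc_shift[of "\<lambda>j. f (p j)" n] pn by (simp add: add.commute)
    also have "\<dots> = (\<Sum>z\<in>{z. z ^ n = 1}. f z)"
      by (rule sum.reindex_bij_betw[OF bij])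
    finally show ?thesis .
  qed
  have inj: "inj_on p {1..n}"
  proof -
    have img: "p ` {1..n} = p ` {..<n}"
    proof -
      have "{..<n} = insert 0 {1..<n}" "{1..n} = insert n {1..<n}" using n0 by auto
      then show ?thesis using pn by simp
    qed
    have "card (p ` {1..n}) = n"
      unfolding img using bij bij_betw_same_card[OF bij] by (simp add: bij_betw_def)
    then show ?thesis by (simp add: eq_card_imp_inj_on)
  qed
  have nrm: "norm (p j) = 1" for j by (simp add: p_def)
  have half: "Re (z / (z - w)) = 1 / 2" if "norm z = 1" "norm w = 1" "z \<noteq> w" for z w
  proof -
    have "norm z ^ 2 = 1" "norm w ^ 2 = 1" using that by auto
    then have zw: "(Re z)\<^sup>2 + (Im z)\<^sup>2 = 1" "(Re w)\<^sup>2 + (Im w)\<^sup>2 = 1"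
      by (auto simp: cmod_power2)
    have "z - w \<noteq> 0" using that by simp
    then have "(Re (z - w))\<^sup>2 + (Im (z - w))\<^sup>2 \<noteq> 0"
      by (metis cmod_power2 norm_eq_zero power_eq_0_iff)
    moreover have "Re z * Re (z - w) + Im z * Im (z - w) = ((Re (z - w))\<^sup>2 + (Im (z - w))\<^sup>2) / 2"
      using zw by (simp add: power2_eq_square algebra_simps)
    ultimately show ?thesis
      by (simp add: Re_divide)
  qed
  have notconn: "\<not> connectedin sphere_top (?R -` unit_disk)"
  proof
    assume c: "connectedin sphere_top (?R -` unit_disk)"
    have "0 \<notin> p ` {1..n}" using nrm by (metis imageE norm_zero zero_neq_one)
    then have "?R (Some 0) = Some (\<Sum>j=1..n. a j / (0 - p j))" by (rule pf_map_Some)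
    \<comment> \<open>The inverse of a root of unity is its conjugate, so the value at 0 is minus
      the conjugate of the sum of all roots.\<close>
    moreover have "(\<Sum>j=1..n. a j / (0 - p j)) = - cnj (\<Sum>j=1..n. p j)"
    proof -
      have "a j / (0 - p j) = - cnj (p j)" for j
        by (simp add: a_def p_def cis_cnj flip: cis_inverse) (simp add: divide_inverse)
      then show ?thesis by (simp add: sum_negf)
    qed
    moreover have "(\<Sum>j=1..n. p j) = 0"
      using sumeq[of "\<lambda>z. z"] sum_roots_unity[of n] assms by simp
    ultimately have "?R (Some 0) = Some 0" by (simp del: cnj_sum)
    then have z: "Some 0 \<in> ?R -` unit_disk"
      by (simp add: unit_disk_def)
    have inf: "None \<in> ?R -` unit_disk"
      by (simp add: pf_map_None[OF n0] unit_disk_def)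
    obtain z where z1: "norm z = 1" and zX: "Some z \<in> ?R -` unit_disk"
      using sphere_separated_by_circle[OF c z inf, of 1] by auto
    have zp: "z \<notin> p ` {1..n}"
    proof
      assume "z \<in> p ` {1..n}"
      from pf_map_pole[OF this] zX show False by (auto simp: unit_disk_def)
    qed
    have lt: "norm (\<Sum>j=1..n. a j / (z - p j)) < 1"
      using zX by (auto simp: pf_map_Some[OF zp] unit_disk_def)
    have "Re (z * (\<Sum>j=1..n. a j / (z - p j))) = (\<Sum>j=1..n. Re (z / (z - p j)))"
      by (simp add: sum_distrib_left a_def)
    also have "\<dots> = (\<Sum>j=1..n. 1 / 2)"
    proof (rule sum.cong)
      fix j assume "j \<in> {1..n}"
      then have "z \<noteq> p j" using zp by blast
      then show "Re (z / (z - p j)) = 1 / 2" by (rule half[OF z1 nrm])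
    qed simp
    finally have "real n / 2 \<le> norm (z * (\<Sum>j=1..n. a j / (z - p j)))"
      using complex_Re_le_cmod[of "z * (\<Sum>j=1..n. a j / (z - p j))"] by simp
    then show False using lt z1 assms by (simp add: norm_mult)
  qed
  have "rational_map n ?R" "has_partial_fractions n ?R a p"
    by (auto intro!: rational_map_pf_map has_partial_fractions_pf_map inj n0 simp: a_def)
  then show ?thesis
    using notconn by (intro exI[of _ a] exI[of _ p]) (auto simp: good_def a_def)
qed

section \<open>Cauchy's theorem for cycles\<close>

text \<open>All cycles are joined into one closed path through a base point \<open>b\<close> whose
  integrals are the sums of the given ones; then the homology version of Cauchy's theorem for a
  single path applies.\<close>

lemma Cauchy_theorem_cycle:
  fixes \<gamma> :: "'i \<Rightarrow> real \<Rightarrow> complex"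
  assumes S: "open S" "connected S" and I: "finite I" and hol: "f holomorphic_on S"
    and \<gamma>: "\<And>i. i \<in> I \<Longrightarrow> valid_path (\<gamma> i)" "\<And>i. i \<in> I \<Longrightarrow> pathfinish (\<gamma> i) = pathstart (\<gamma> i)"
      "\<And>i. i \<in> I \<Longrightarrow> path_image (\<gamma> i) \<subseteq> S"
    and zero: "\<And>z. z \<notin> S \<Longrightarrow> (\<Sum>i\<in>I. winding_number (\<gamma> i) z) = 0"
  shows "(\<Sum>i\<in>I. contour_integral (\<gamma> i) f) = 0"
proof (cases "S = {}")
  case True
  have "path_image (\<gamma> i) \<noteq> {}" for i by (rule path_image_nonempty)
  then have "I = {}" using \<gamma>(3) True by blast
  then show ?thesis by simp
next
  case False
  then obtain b where b: "b \<in> S" by auto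
  have "\<exists>g. valid_path g \<and> pathstart g = b \<and> pathfinish g = b \<and> path_image g \<subseteq> S \<and>
      (\<forall>h. h holomorphic_on S \<longrightarrow> contour_integral g h = (\<Sum>i\<in>I. contour_integral (\<gamma> i) h))"
    using I \<gamma>
  proof (induction I rule: finite_induct)
    case empty
    show ?case
    proof (intro exI conjI allI impI)
      show "valid_path (linepath b b)" by (rule valid_path_linepath)
      show "path_image (linepath b b) \<subseteq> S" using b by simp
      show "contour_integral (linepath b b) h = (\<Sum>i\<in>{}. contour_integral (\<gamma> i) h)" for h
        by (metis contour_integral_trivial sum.empty)
    qed (rule pathstart_linepath, rule pathfinish_linepath)
  next
    case (insert j J)
    then obtain g where g: "valid_path g" "pathstart g = b" "pathfinish g = b" "path_image g \<subseteq> S"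
      "\<And>h. h holomorphic_on S \<Longrightarrow> contour_integral g h = (\<Sum>i\<in>J. contour_integral (\<gamma> i) h)"
      by auto
    have j: "valid_path (\<gamma> j)" "pathfinish (\<gamma> j) = pathstart (\<gamma> j)" "path_image (\<gamma> j) \<subseteq> S"
      using insert.prems by auto
    then have "pathstart (\<gamma> j) \<in> S" by auto
    from connected_open_polynomial_connected[OF S b this]
    obtain l where l: "polynomial_function l" "path_image l \<subseteq> S" "pathstart l = b"
      "pathfinish l = pathstart (\<gamma> j)" by auto
    have vl: "valid_path l" using l(1) by (rule valid_path_polynomial_function)
    \<comment> \<open>The connecting path \<open>l\<close> is run there and back, so its two
      contributions cancel.\<close>
    let ?g = "g +++ (l +++ (\<gamma> j +++ reversepath l))"
    have int: "h contour_integrable_on p" if "h holomorphic_on S" "valid_path p" "path_image p \<subseteq> S" for h p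
      using contour_integrable_holomorphic_simple that S(1) by blast
    have "contour_integral ?g h = (\<Sum>i\<in>insert j J. contour_integral (\<gamma> i) h)"
      if h: "h holomorphic_on S" for h
    proof -
      have "contour_integral ?g h = contour_integral g h + (contour_integral l h +
          (contour_integral (\<gamma> j) h + contour_integral (reversepath l) h))"
        using int[OF h] g j l vl
        by (simp add: contour_integrable_joinI contour_integrable_reversepath)
      also have "\<dots> = contour_integral g h + contour_integral (\<gamma> j) h"
        by (simp add: contour_integral_reversepath[OF vl])
      finally show ?thesis using g(5)[OF h] insert.hyps by simp
    qed
    moreover have "valid_path ?g" "pathstart ?g = b" "pathfinish ?g = b" "path_image ?g \<subseteq> S"
      using g j l vl by (auto simp: path_image_join valid_path_join)
    ultimately show ?case by blast
  qed
  then obtain g where g: "valid_path g" "pathstart g = b" "pathfinish g = b" "path_image g \<subseteq> S"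
      "\<And>h. h holomorphic_on S \<Longrightarrow> contour_integral g h = (\<Sum>i\<in>I. contour_integral (\<gamma> i) h)"
    by auto
  have "winding_number g z = 0" if z: "z \<notin> S" for z
  proof -
    have hol: "(\<lambda>w. 1 / (w - z)) holomorphic_on S"
      by (intro holomorphic_intros) (use z in auto)
    have "winding_number g z = 1 / (2 * pi * \<i>) * (\<Sum>i\<in>I. contour_integral (\<gamma> i) (\<lambda>w. 1 / (w - z)))"
      using winding_number_valid_path[OF g(1), of z] g(4) z g(5)[OF hol] by auto
    also have "\<dots> = (\<Sum>i\<in>I. winding_number (\<gamma> i) z)"
      unfolding sum_distrib_left
    proof (rule sum.cong)
      fix i assume i: "i \<in> I"
      have "z \<notin> path_image (\<gamma> i)" using \<gamma>(3)[OF i] z by blast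
      then show "1 / (2 * pi * \<i>) * contour_integral (\<gamma> i) (\<lambda>w. 1 / (w - z)) = winding_number (\<gamma> i) z"
        using winding_number_valid_path[OF \<gamma>(1)[OF i]] by simp
    qed simp
    finally show ?thesis using zero[OF z] by simp
  qed
  then have "(f has_contour_integral 0) g"
    using Cauchy_theorem_global[OF S(1) hol g(1)] g by simp
  then show ?thesis using g(5)[OF hol] contour_integral_unique by metis
qed

lemma contour_integral_circlepath_at_infinity:
  assumes "continuous_on {z. norm z \<ge> B} G" "((\<lambda>z. z * G z) \<longlongrightarrow> c) at_infinity" "e > 0"
  shows "\<exists>r>B. r > 0 \<and> norm (contour_integral (circlepath 0 r) G - 2 * pi * \<i> * c) < e"
proof -
  \<comment> \<open>The integrand differs from \<open>c / z\<close> by at most \<open>d / r\<close>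
    on a circle of length \<open>2 * pi * r\<close>; this choice makes the error at most
    \<open>e / 2\<close>.\<close>
  define d where "d = e / (4 * pi)"
  have d: "d > 0" using assms(3) by (simp add: d_def)
  from tendstoD[OF assms(2) d] obtain b where b: "\<And>z. norm z \<ge> b \<Longrightarrow> dist (z * G z) c < d"
    unfolding eventually_at_infinity by blast
  define r where "r = max (max B b) 0 + 1"
  have r: "r > B" "r > b" "r > 0" by (auto simp: r_def)
  have cG: "continuous_on (sphere 0 r) G"
    by (rule continuous_on_subset[OF assms(1)]) (use r in auto)
  have intG: "G contour_integrable_on circlepath 0 r"
    by (rule contour_integrable_continuous_circlepath) (use cG r in auto)
  have c0: "((\<lambda>z. c / (z - 0)) has_contour_integral (2 * pi * \<i> * c)) (circlepath 0 r)"
    using Cauchy_integral_circlepath_simple[of "\<lambda>_. c" 0 r 0] r by simp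
  have diff: "((\<lambda>z. G z - c / (z - 0)) has_contour_integral
      (contour_integral (circlepath 0 r) G - 2 * pi * \<i> * c)) (circlepath 0 r)"
    by (rule has_contour_integral_diff[OF has_contour_integral_integral[OF intG] c0])
  have "norm (contour_integral (circlepath 0 r) G - 2 * pi * \<i> * c) \<le> (d / r) * (2 * pi * r)"
  proof (rule has_contour_integral_bound_circlepath[OF diff])
    fix z :: complex assume z: "norm (z - 0) = r"
    then have "norm (z * G z - c) \<le> d" using b[of z] r by (simp add: dist_norm)
    moreover have "z * (G z - c / (z - 0)) = z * G z - c" using z r by (auto simp: field_simps)
    ultimately have "norm z * norm (G z - c / (z - 0)) \<le> d" by (simp flip: norm_mult)
    then show "norm (G z - c / (z - 0)) \<le> d / r" using z r by (simp add: field_simps)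
  qed (use d r in auto)
  also have "\<dots> = e / 2" using r by (simp add: d_def)
  finally show ?thesis using r assms(3) by (intro exI[of _ r]) auto
qed

text \<open>Janiszewski's theorem, adding one set at a time: the new set meets the union of the
  earlier ones in the empty set, which is connected.\<close>

lemma connected_complement_disjoint_union:
  fixes K :: "'i \<Rightarrow> complex set"
  assumes "finite I" "\<And>i. i \<in> I \<Longrightarrow> compact (K i)" "\<And>i. i \<in> I \<Longrightarrow> connected (- K i)"
    and "\<And>i j. i \<in> I \<Longrightarrow> j \<in> I \<Longrightarrow> i \<noteq> j \<Longrightarrow> K i \<inter> K j = {}"
  shows "connected (- (\<Union>i\<in>I. K i))"
  using assms
proof (induction I rule: finite_induct)
  case empty
  then show ?case by (simp add: connected_UNIV)
next
  case (insert j J)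
  have "connected (- (K j \<union> (\<Union>i\<in>J. K i)))"
  proof (rule Janiszewski_connected)
    show "closed (\<Union>i\<in>J. K i)" using insert by (auto intro!: closed_UN compact_imp_closed)
    have "K j \<inter> (\<Union>i\<in>J. K i) = {}" using insert by fastforce
    then show "connected (K j \<inter> (\<Union>i\<in>J. K i))" by simp
  qed (use insert in auto)
  then show ?case by simp
qed

section \<open>Uniqueness of maximizers\<close>

lemma sphere_open_neighbourhood_infinity:
  assumes "openin sphere_top X" "None \<in> X"
  obtains r where "r > 0" "ball 0 r \<subseteq> chart_infinity -` X" "open (Some -` X)" "open (chart_infinity -` X)"
proof -
  obtain C where C: "compact C" and X: "X = insert None (Some ` (UNIV - C))"
    using assms unfolding openin_Alexandroff_compactification by auto
  have vim: "Some -` X = - C" using X by auto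
  then have op: "open (Some -` X)" using C by (simp add: compact_imp_closed open_Compl)
  obtain B where B: "B > 0" "\<And>z. z \<in> C \<Longrightarrow> norm z \<le> B"
    using compact_imp_bounded[OF C] bounded_pos by metis
  have sub: "ball 0 (1 / B) \<subseteq> chart_infinity -` X"
  proof
    fix w :: complex assume w: "w \<in> ball 0 (1 / B)"
    have "1 / w \<notin> C" if "w \<noteq> 0"
    proof
      assume "1 / w \<in> C"
      then have "1 / norm w \<le> B" using B(2)[of "1 / w"] by (simp add: norm_divide)
      then show False using w that B(1) by (simp add: field_simps)
    qed
    then show "w \<in> chart_infinity -` X"
      using assms(2) vim by (auto simp: chart_infinity_def)
  qed
  have eq: "chart_infinity -` X = ball 0 (1 / B) \<union> ((\<lambda>w. 1 / w) -` (Some -` X) \<inter> (- {0}))"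
    using sub assms(2) B(1) by (auto simp: chart_infinity_def split: if_splits)
  have "open ((\<lambda>w. 1 / w) -` (Some -` X) \<inter> (- {0::complex}))"
  proof -
    have "continuous_on (- {0}) (\<lambda>w::complex. 1 / w)" by (auto intro!: continuous_intros)
    from continuous_open_preimage[OF this _ op] show ?thesis by (simp add: Int_commute open_Compl)
  qed
  then have "open (chart_infinity -` X)" unfolding eq by (intro open_Un) auto
  with B(1) sub op that[of "1 / B"] show thesis by simp
qed

text \<open>The substitution \<open>z = 1 / w\<close> turns the expression into a difference
  quotient at 0 in the chart around infinity.\<close>

lemma tendsto_deriv_infinity:
  assumes "openin sphere_top X" "None \<in> X" "sphere_holomorphic_on f X"
  shows "((\<lambda>z. z * (f (Some z) - f None)) \<longlongrightarrow> deriv (\<lambda>w. f (chart_infinity w)) 0) at_infinity"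
proof -
  obtain r where r: "r > 0" "ball 0 r \<subseteq> chart_infinity -` X"
    using sphere_open_neighbourhood_infinity[OF assms(1,2)] by metis
  let ?h = "\<lambda>w. f (chart_infinity w)"
  have "?h holomorphic_on ball 0 r"
    using assms(3) r(2) unfolding sphere_holomorphic_on_def by (meson holomorphic_on_subset)
  then have "(?h has_field_derivative deriv ?h 0) (at 0)"
    by (rule holomorphic_derivI) (use r(1) in auto)
  then have lim: "((\<lambda>w. (?h w - ?h 0) / (w - 0)) \<longlongrightarrow> deriv ?h 0) (at 0)"
    by (simp add: has_field_derivative_iff)
  show ?thesis
  proof (rule lim_zero_infinity, rule Lim_transform_eventually[OF lim])
    show "\<forall>\<^sub>F w in at 0. (?h w - ?h 0) / (w - 0) = 1 / w * (f (Some (1 / w)) - f None)"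
      by (auto simp: eventually_at chart_infinity_def intro: exI[of _ 1])
  qed
qed

lemma deriv_infinity_eq:
  assumes "openin sphere_top X" "None \<in> X" "sphere_holomorphic_on f X"
  shows "deriv_infinity f = deriv (\<lambda>w. f (chart_infinity w)) 0"
  unfolding deriv_infinity_def
  by (rule tendsto_Lim[OF _ tendsto_deriv_infinity[OF assms]]) (rule trivial_limit_at_infinity)

text \<open>
  Two maximizers \<open>f\<close>, \<open>g\<close> have an average \<open>h\<close> with \<open>cmod h \<le> 1 - (cmod d)\<^sup>2 / 2\<close>, where
  \<open>d = (g - f) / 2\<close>.  If \<open>d\<close> has a zero of order \<open>m\<close> at infinity, this leaves room for
  \<open>h + c * d\<^sup>2 * z ^ (2 * m - 1)\<close>, which has a larger derivative at infinity.
\<close>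
lemma maximizer_unique:
  assumes X: "openin sphere_top X" "None \<in> X" "connected (Some -` X)"
    and f: "ahlfors_admissible X f"
    and max: "\<And>g. ahlfors_admissible X g \<Longrightarrow> Re (deriv_infinity g) \<le> Re (deriv_infinity f)"
    and g: "ahlfors_admissible X g" "Re (deriv_infinity g) = Re (deriv_infinity f)"
    and x: "x \<in> X"
  shows "g x = f x"
proof -
  define W where "W = chart_infinity -` X"
  obtain r0 where r0: "r0 > 0" "ball 0 r0 \<subseteq> W" and opS: "open (Some -` X)" and opW: "open W"
    using sphere_open_neighbourhood_infinity[OF X(1,2)] unfolding W_def by metis
  have hf: "(\<lambda>z. f (Some z)) holomorphic_on (Some -` X)" "(\<lambda>w. f (chart_infinity w)) holomorphic_on W"
    and hg: "(\<lambda>z. g (Some z)) holomorphic_on (Some -` X)" "(\<lambda>w. g (chart_infinity w)) holomorphic_on W"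
    and f0: "f None = 0" and g0: "g None = 0"
    and fb: "\<And>y. y \<in> X \<Longrightarrow> norm (f y) < 1" and gb: "\<And>y. y \<in> X \<Longrightarrow> norm (g y) < 1"
    using f g(1) by (auto simp: ahlfors_admissible_def sphere_holomorphic_on_def W_def)
  define d where "d y = (g y - f y) / 2" for y
  define h where "h y = (g y + f y) / 2" for y
  define D where "D w = d (chart_infinity w)" for w
  have holD: "D holomorphic_on W" unfolding D_def d_def by (intro holomorphic_intros hf hg) auto
  have D0: "D 0 = 0" by (simp add: D_def chart_infinity_def d_def f0 g0)
  \<comment> \<open>Parallelogram law: the squared norms of \<open>h\<close> and \<open>d\<close>
    add up to the mean of those of \<open>f\<close> and \<open>g\<close>, which is below 1.\<close>
  have hd: "norm (h y) \<le> 1 - (norm (d y))\<^sup>2 / 2" "norm (h y) < 1" if y: "y \<in> X" for y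
  proof -
    have hh: "(norm (h y))\<^sup>2 = ((Re (g y) + Re (f y)) / 2)\<^sup>2 + ((Im (g y) + Im (f y)) / 2)\<^sup>2"
      and dd: "(norm (d y))\<^sup>2 = ((Re (g y) - Re (f y)) / 2)\<^sup>2 + ((Im (g y) - Im (f y)) / 2)\<^sup>2"
      unfolding h_def d_def cmod_power2 by simp_all
    have "(norm (h y))\<^sup>2 + (norm (d y))\<^sup>2 = ((norm (f y))\<^sup>2 + (norm (g y))\<^sup>2) / 2"
      unfolding hh dd unfolding cmod_power2 by (simp add: power2_eq_square field_simps)
    moreover have "(norm (f y))\<^sup>2 < 1" "(norm (g y))\<^sup>2 < 1"
      using fb[OF y] gb[OF y] by (simp_all add: power_less_one_iff)
    ultimately have lt: "(norm (h y))\<^sup>2 + (norm (d y))\<^sup>2 < 1" by simp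
    then have "(norm (d y))\<^sup>2 \<le> 1" by (smt (verit) zero_le_power2)
    have "(norm (h y))\<^sup>2 \<le> (1 - (norm (d y))\<^sup>2 / 2)\<^sup>2"
    proof -
      have "(1 - (norm (d y))\<^sup>2 / 2)\<^sup>2 = 1 - (norm (d y))\<^sup>2 + ((norm (d y))\<^sup>2 / 2)\<^sup>2"
        by (simp add: power2_diff)
      then show ?thesis using lt zero_le_power2[of "(norm (d y))\<^sup>2 / 2"] by linarith
    qed
    then show "norm (h y) \<le> 1 - (norm (d y))\<^sup>2 / 2"
      by (rule power2_le_imp_le) (use \<open>(norm (d y))\<^sup>2 \<le> 1\<close> in simp)
    have "(norm (h y))\<^sup>2 < 1\<^sup>2" using lt by (smt (verit) one_power2 zero_le_power2)
    then show "norm (h y) < 1" by (rule power2_less_imp_less) simp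
  qed
  \<comment> \<open>It suffices that \<open>d\<close> vanishes near infinity; the identity theorem
    then spreads this over the connected domain.\<close>
  have "D constant_on ball 0 r0"
  proof (rule ccontr)
    assume nc: "\<not> D constant_on ball 0 r0"
    have "\<exists>k r m. 0 < m \<and> 0 < r \<and> ball (0::complex) r \<subseteq> ball 0 r0 \<and> k holomorphic_on ball 0 r \<and>
        (\<forall>w\<in>ball 0 r. D w = w ^ m * k w \<and> k w \<noteq> 0)"
    proof (rule holomorphic_factor_zero_nonconstant[OF holomorphic_on_subset[OF holD r0(2)] open_ball
          connected_ball _ D0 nc])
      show "0 \<in> ball 0 r0" using r0(1) by simp
    next
      fix k :: "complex \<Rightarrow> complex" and r :: real and m :: nat
      assume *: "0 < m" "0 < r" "ball (0::complex) r \<subseteq> ball 0 r0" "k holomorphic_on ball 0 r"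
        "\<And>w. w \<in> ball 0 r \<Longrightarrow> D w = (w - 0) ^ m * k w" "\<And>w. w \<in> ball 0 r \<Longrightarrow> k w \<noteq> 0"
      show ?thesis
        by (rule exI[of _ k], rule exI[of _ r], rule exI[of _ m]) (use *(1-4) in \<open>intro conjI ballI; (assumption | simp add: *(5,6))\<close>)
    qed
    then obtain k r m where m: "0 < m" and r: "0 < r" "ball (0::complex) r \<subseteq> ball 0 r0"
      and holk: "k holomorphic_on ball 0 r"
      and Dk: "\<And>w. w \<in> ball 0 r \<Longrightarrow> D w = w ^ m * k w"
      and k0: "\<And>w. w \<in> ball 0 r \<Longrightarrow> k w \<noteq> 0"
      by blast
    define N where "N = 2 * m - 1"
    have N: "2 * m = Suc N" using m by (simp add: N_def)
    define \<rho> where "\<rho> = r / 2"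
    have \<rho>: "\<rho> > 0" "\<rho> < r" using r by (auto simp: \<rho>_def)
    \<comment> \<open>For \<open>norm z \<le> 1 / \<rho>\<close> this bounds the added term by a
      quarter of \<open>(norm (d y))^2\<close>, half of the room that is available.\<close>
    define \<delta> where "\<delta> = \<rho> ^ N / 4"
    have \<delta>: "\<delta> > 0" using \<rho> by (simp add: \<delta>_def)
    \<comment> \<open>Multiplication by the unimodular \<open>c1\<close> rotates
      \<open>(k 0)^2\<close> to the positive real axis, so that the new derivative has a larger real
      part.\<close>
    define c where "c = cnj ((k 0)\<^sup>2)"
    define c1 where "c1 = c / norm c"
    have c0: "c \<noteq> 0" using k0[of 0] r by (simp add: c_def)
    have nc1: "norm c1 = 1" using c0 by (simp add: c1_def norm_divide)
    define \<phi> where "\<phi> y = (case y of None \<Rightarrow> 0 | Some z \<Rightarrow> h y + \<delta> * c1 * (d y)\<^sup>2 * z ^ N)" for y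
    \<comment> \<open>The zero of \<open>d^2\<close> of order \<open>2 * m = N + 1\<close> absorbs
      the pole of \<open>z ^ N\<close> at infinity and leaves a simple zero.\<close>
    have \<phi>_ball: "\<phi> (chart_infinity w) = h (chart_infinity w) + \<delta> * c1 * w * (k w)\<^sup>2"
      if w: "w \<in> ball 0 r" for w
    proof (cases "w = 0")
      case True
      then show ?thesis by (simp add: \<phi>_def chart_infinity_def h_def f0 g0)
    next
      case False
      have "(D w)\<^sup>2 = w ^ Suc N * (k w)\<^sup>2"
        using Dk[OF w] by (simp add: power_mult_distrib N[symmetric] power_mult[symmetric] mult.commute)
      then have "(D w)\<^sup>2 * (1 / w) ^ N = w * (k w)\<^sup>2"
        using False by (simp add: power_divide)
      then show ?thesis using False
        by (simp add: \<phi>_def chart_infinity_def D_def mult.assoc)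
    qed
    have hol1: "(\<lambda>z. \<phi> (Some z)) holomorphic_on (Some -` X)"
      unfolding \<phi>_def h_def d_def by simp (intro holomorphic_intros hf hg; simp)
    have hol2a: "(\<lambda>w. \<phi> (chart_infinity w)) holomorphic_on ball 0 r"
    proof -
      have "(\<lambda>w. h (chart_infinity w) + \<delta> * c1 * w * (k w)\<^sup>2) holomorphic_on ball 0 r"
        unfolding h_def using r r0(2)
        by (intro holomorphic_intros holk holomorphic_on_subset[OF hf(2)] holomorphic_on_subset[OF hg(2)]) auto
      then show ?thesis by (rule holomorphic_transform) (simp add: \<phi>_ball)
    qed
    have hol2b: "(\<lambda>w. \<phi> (chart_infinity w)) holomorphic_on (W - {0})"
    proof -
      have "(\<lambda>w. h (chart_infinity w) + \<delta> * c1 * (d (chart_infinity w))\<^sup>2 * (1 / w) ^ N)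
          holomorphic_on (W - {0})"
        unfolding h_def d_def
        by (intro holomorphic_intros holomorphic_on_subset[OF hf(2)] holomorphic_on_subset[OF hg(2)]) auto
      then show ?thesis by (rule holomorphic_transform) (auto simp: \<phi>_def chart_infinity_def)
    qed
    have hol2: "(\<lambda>w. \<phi> (chart_infinity w)) holomorphic_on W"
    proof -
      have "W = ball 0 r \<union> (W - {0})" using r r0(2) by auto
      then show ?thesis
        using holomorphic_on_Un[OF hol2a hol2b] opW by (metis open_ball open_delete)
    qed
    have big: "norm (\<phi> y) < 1" if y: "y \<in> X" "y = Some z" "norm z \<le> 1 / \<rho>" for y z
    proof -
      have "norm (\<phi> y) \<le> norm (h y) + norm (\<delta> * c1 * (d y)\<^sup>2 * z ^ N)"
        unfolding \<phi>_def y(2) by simp (rule norm_triangle_ineq)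
      also have "norm (\<delta> * c1 * (d y)\<^sup>2 * z ^ N) = (\<delta> * norm z ^ N) * (norm (d y))\<^sup>2"
        using \<delta> by (simp add: norm_mult norm_power nc1)
      also have "\<dots> \<le> 1 / 4 * (norm (d y))\<^sup>2"
      proof (rule mult_right_mono)
        have "norm z ^ N \<le> (1 / \<rho>) ^ N" by (rule power_mono[OF y(3)]) simp
        then have "\<delta> * norm z ^ N \<le> \<delta> * (1 / \<rho>) ^ N" using \<delta> by simp
        also have "\<dots> = 1 / 4" using \<rho> by (simp add: \<delta>_def power_divide)
        finally show "\<delta> * norm z ^ N \<le> 1 / 4" .
      qed simp
      finally have le: "norm (\<phi> y) \<le> norm (h y) + 1 / 4 * (norm (d y))\<^sup>2" by simp
      show ?thesis
      proof (cases "d y = 0")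
        case True
        then show ?thesis using le hd(2)[OF y(1)] by simp
      next
        case False
        then have "(norm (d y))\<^sup>2 > 0" by simp
        then show ?thesis using le hd(1)[OF y(1)] by linarith
      qed
    qed
    \<comment> \<open>Near infinity \<open>z ^ N\<close> is unbounded, so the bound is carried
      inwards from the circle \<open>norm w = \<rho>\<close> by the maximum principle.\<close>
    have small: "norm (\<phi> (chart_infinity w)) < 1" if w: "norm w \<le> \<rho>" for w
    proof -
      let ?\<Phi> = "\<lambda>w. norm (\<phi> (chart_infinity w))"
      have cont: "continuous_on (cball 0 \<rho>) (\<lambda>w. \<phi> (chart_infinity w))"
        by (rule continuous_on_subset[OF holomorphic_on_imp_continuous_on[OF hol2a]]) (use \<rho> in auto)
      have "sphere (0::complex) \<rho> \<noteq> {}" using \<rho> by simp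
      then obtain w0 where w0: "norm w0 = \<rho>" "\<And>w. norm w = \<rho> \<Longrightarrow> ?\<Phi> w \<le> ?\<Phi> w0"
        using continuous_attains_sup[of "sphere 0 \<rho>" ?\<Phi>] continuous_on_subset[OF cont]
        by (force intro!: continuous_on_norm)
      have "norm (\<phi> (chart_infinity w)) \<le> ?\<Phi> w0"
        by (rule maximum_modulus_frontier[where S = "cball 0 \<rho>" and f = "\<lambda>w. \<phi> (chart_infinity w)"
              and B = "norm (\<phi> (chart_infinity w0))"])
           (use \<rho> w w0 cont in \<open>auto intro!: holomorphic_on_subset[OF hol2a]\<close>)
      also have "\<dots> < 1"
      proof (rule big)
        have "w0 \<noteq> 0" using w0 \<rho> by auto
        then show "chart_infinity w0 = Some (1 / w0)" by (simp add: chart_infinity_def)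
        show "norm (1 / w0) \<le> 1 / \<rho>" using w0 by (simp add: norm_divide)
        have "w0 \<in> W" using w0 \<rho> r r0(2) by auto
        then show "chart_infinity w0 \<in> X" by (simp add: W_def)
      qed
      finally show ?thesis .
    qed
    have bound: "norm (\<phi> y) < 1" if y: "y \<in> X" for y
    proof (cases y)
      case None
      then show ?thesis by (simp add: \<phi>_def)
    next
      case (Some z)
      show ?thesis
      proof (cases "norm z \<le> 1 / \<rho>")
        case True
        then show ?thesis using big[OF y Some] by simp
      next
        case False
        then have "z \<noteq> 0" using \<rho> by auto
        moreover have "norm (1 / z) \<le> \<rho>" using False \<rho> \<open>z \<noteq> 0\<close> by (simp add: norm_divide field_simps)
        ultimately show ?thesis using small[of "1 / z"] Some by (simp add: chart_infinity_def)
      qed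
    qed
    have adm: "ahlfors_admissible X \<phi>"
      using hol1 hol2 bound unfolding ahlfors_admissible_def sphere_holomorphic_on_def W_def
      by (auto simp: \<phi>_def split: option.splits)
    have der: "deriv_infinity \<phi> = (deriv_infinity g + deriv_infinity f) / 2 + \<delta> * c1 * (k 0)\<^sup>2"
    proof -
      have W0: "0 \<in> W" using r0 by auto
      have df: "((\<lambda>w. f (chart_infinity w)) has_field_derivative deriv_infinity f) (at 0)"
        and dg: "((\<lambda>w. g (chart_infinity w)) has_field_derivative deriv_infinity g) (at 0)"
        using deriv_infinity_eq[OF X(1,2)] f g(1) holomorphic_derivI[OF hf(2) opW W0]
          holomorphic_derivI[OF hg(2) opW W0]
        by (auto simp: ahlfors_admissible_def)
      have dk: "(k has_field_derivative deriv k 0) (at 0)"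
        by (rule holomorphic_derivI[OF holk]) (use r in auto)
      have "((\<lambda>w. (g (chart_infinity w) + f (chart_infinity w)) / 2 + \<delta> * c1 * w * (k w)\<^sup>2)
          has_field_derivative (deriv_infinity g + deriv_infinity f) / 2 + \<delta> * c1 * (k 0)\<^sup>2) (at 0)"
        by (rule derivative_eq_intros df dg dk refl | simp)+
      then have "((\<lambda>w. \<phi> (chart_infinity w))
          has_field_derivative (deriv_infinity g + deriv_infinity f) / 2 + \<delta> * c1 * (k 0)\<^sup>2) (at 0)"
        by (rule has_field_derivative_transform_within_open[where S = "ball 0 r"])
           (use r in \<open>auto simp: \<phi>_ball h_def\<close>)
      then have "deriv (\<lambda>w. \<phi> (chart_infinity w)) 0 = (deriv_infinity g + deriv_infinity f) / 2 + \<delta> * c1 * (k 0)\<^sup>2"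
        by (rule DERIV_imp_deriv)
      then show ?thesis
        using deriv_infinity_eq[OF X(1,2), of \<phi>] adm by (simp add: ahlfors_admissible_def)
    qed
    have "c1 * (k 0)\<^sup>2 = norm c"
    proof -
      have "c1 * (k 0)\<^sup>2 = c * cnj c / norm c" by (simp add: c1_def c_def)
      also have "\<dots> = norm c" using c0 by (simp add: complex_norm_square[symmetric] power2_eq_square)
      finally show ?thesis .
    qed
    then have "Re (deriv_infinity \<phi>) = Re (deriv_infinity f) + \<delta> * norm c"
      using g(2) by (simp add: der mult.assoc)
    moreover have "\<delta> * norm c > 0" using \<delta> c0 by (intro mult_pos_pos) auto
    ultimately show False using max[OF adm] by linarith
  qed
  then have Dz: "D w = 0" if "w \<in> ball 0 r0" for w
    using that D0 r0(1) unfolding constant_on_def by (metis centre_in_ball)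
  have "d (Some z) = 0" if z: "Some z \<in> X" for z
  proof (rule analytic_continuation[where S = "Some -` X" and U = "{z. norm z > 1 / r0}"
        and \<xi> = "of_real (1 / r0 + 1)" and f = "\<lambda>z. d (Some z)"])
    show "(\<lambda>z. d (Some z)) holomorphic_on Some -` X"
      unfolding d_def by (intro holomorphic_intros hf hg) auto
    have inW: "1 / z \<in> ball 0 r0" if "norm z > 1 / r0" for z :: complex
    proof -
      have "norm z > 0" using that r0(1) by (smt (verit) divide_pos_pos)
      then show ?thesis using that r0(1) by (simp add: norm_divide field_simps)
    qed
    have ne: "z \<noteq> 0" if "norm z > 1 / r0" for z :: complex using that r0(1) by auto
    show sub: "{z. norm z > 1 / r0} \<subseteq> Some -` X"
    proof
      fix z :: complex assume "z \<in> {z. norm z > 1 / r0}"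
      then have "1 / z \<in> W" "z \<noteq> 0" using inW[of z] ne[of z] r0(2) by auto
      then show "z \<in> Some -` X" by (simp add: W_def chart_infinity_def)
    qed
    have in_xi: "complex_of_real (1 / r0 + 1) \<in> {z. norm z > 1 / r0}"
      unfolding mem_Collect_eq norm_of_real using r0(1) by simp
    then show "complex_of_real (1 / r0 + 1) \<in> Some -` X" using sub by blast
    have "open {z::complex. norm z > 1 / r0}" by (rule open_Collect_less) (auto intro!: continuous_intros)
    then show "complex_of_real (1 / r0 + 1) islimpt {z. norm z > 1 / r0}"
      using in_xi interior_limit_point[of "complex_of_real (1 / r0 + 1)" "{z. norm z > 1 / r0}"]
      by (simp only: interior_open)
    show "d (Some z) = 0" if "z \<in> {z. norm z > 1 / r0}" for z
      using Dz[OF inW[of z]] ne[of z] that by (simp add: D_def chart_infinity_def)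
  qed (use opS X(3) z in auto)
  then show ?thesis using x f0 g0 by (cases x) (auto simp: d_def)
qed

section \<open>Inverse branches near separated poles\<close>

definition other_poles :: "nat \<Rightarrow> (nat \<Rightarrow> complex) \<Rightarrow> (nat \<Rightarrow> complex) \<Rightarrow> nat \<Rightarrow> complex \<Rightarrow> complex" where
  "other_poles n A p j z = (\<Sum>k\<in>{1..n} - {j}. A k / (z - p k))"

text \<open>Minus the divided difference of \<open>other_poles n A p j\<close>, written as a sum so
  that \<open>z = w\<close> is allowed.\<close>

definition other_slope :: "nat \<Rightarrow> (nat \<Rightarrow> complex) \<Rightarrow> (nat \<Rightarrow> complex) \<Rightarrow> nat \<Rightarrow> complex \<Rightarrow> complex \<Rightarrow> complex" where
  "other_slope n A p j z w = (\<Sum>k\<in>{1..n} - {j}. A k / ((z - p k) * (w - p k)))"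

text \<open>
  The branch near \<open>p j\<close> of the inverse of \<open>1 / R\<close>, where \<open>R\<close> is the sum of all \<open>A k / (z - p k)\<close>.
\<close>
definition branch ::
    "nat \<Rightarrow> (nat \<Rightarrow> complex) \<Rightarrow> (nat \<Rightarrow> complex) \<Rightarrow> (nat \<Rightarrow> real) \<Rightarrow> nat \<Rightarrow> complex \<Rightarrow> complex" where
  "branch n A p \<delta> j u =
     (THE z. z \<in> cball (p j) (\<delta> j) \<and> z = p j + A j * u / (1 - u * other_poles n A p j z))"

text \<open>Solving \<open>A j / (z - p j) + other_poles n A p j z = 1 / u\<close> for the first
  term and clearing \<open>u\<close> gives the equation in \<open>branch\<close>, which also makes
  sense for \<open>u = 0\<close>. This is its denominator, close to 1 for well separated
  poles.\<close>

definition branch_denom ::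
    "nat \<Rightarrow> (nat \<Rightarrow> complex) \<Rightarrow> (nat \<Rightarrow> complex) \<Rightarrow> (nat \<Rightarrow> real) \<Rightarrow> nat \<Rightarrow> complex \<Rightarrow> complex" where
  "branch_denom n A p \<delta> j u = 1 - u * other_poles n A p j (branch n A p \<delta> j u)"

text \<open>
  \<open>branch_quot\<close> is \<open>A j * (u - w) / (Z u - Z w)\<close> for \<open>Z = branch n A p \<delta> j\<close>, extended to \<open>u = w\<close>.
\<close>
definition branch_quot :: "nat \<Rightarrow> (nat \<Rightarrow> complex) \<Rightarrow> (nat \<Rightarrow> complex) \<Rightarrow> (nat \<Rightarrow> real) \<Rightarrow> nat
    \<Rightarrow> complex \<Rightarrow> complex \<Rightarrow> complex" where
  "branch_quot n A p \<delta> j u w = branch_denom n A p \<delta> j u * branch_denom n A p \<delta> j w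
     + A j * u * w * other_slope n A p j (branch n A p \<delta> j u) (branch n A p \<delta> j w)"

text \<open>A holomorphic square root of \<open>deriv (branch n A p \<delta> j) / A j\<close>.\<close>
definition branch_root ::
    "nat \<Rightarrow> (nat \<Rightarrow> complex) \<Rightarrow> (nat \<Rightarrow> complex) \<Rightarrow> (nat \<Rightarrow> real) \<Rightarrow> nat \<Rightarrow> complex \<Rightarrow> complex" where
  "branch_root n A p \<delta> j u = 1 / (branch_denom n A p \<delta> j u *
     csqrt (1 + A j * u\<^sup>2 * other_slope n A p j (branch n A p \<delta> j u) (branch n A p \<delta> j u)
               / (branch_denom n A p \<delta> j u)\<^sup>2))"

text \<open>The principal root has nonnegative real part, so the factor \<open>csqrt z + 1\<close>
  of \<open>z - 1\<close> has norm at least 1.\<close>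

lemma norm_csqrt_minus_one_le: "norm (csqrt z - 1) \<le> norm (z - 1)"
proof -
  have "Re (csqrt z) \<ge> 0" using csqrt_principal[of z] by linarith
  then have "1 \<le> Re (csqrt z + 1)" by simp
  also have "\<dots> \<le> norm (csqrt z + 1)" by (rule complex_Re_le_cmod)
  finally have "norm (csqrt z - 1) * 1 \<le> norm (csqrt z - 1) * norm (csqrt z + 1)"
    by (intro mult_left_mono) auto
  also have "\<dots> = norm ((csqrt z)\<^sup>2 - 1)"
    by (simp add: norm_mult[symmetric] power2_eq_square algebra_simps)
  finally show ?thesis by simp
qed

lemma other_poles_diff:
  assumes "\<And>k. k \<in> {1..n} - {j} \<Longrightarrow> z \<noteq> p k" "\<And>k. k \<in> {1..n} - {j} \<Longrightarrow> w \<noteq> p k"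
  shows "other_poles n A p j z - other_poles n A p j w = - (z - w) * other_slope n A p j z w"
  unfolding other_poles_def other_slope_def sum_subtractf[symmetric] sum_distrib_left
proof (rule sum.cong)
  fix k assume k: "k \<in> {1..n} - {j}"
  have "z - p k \<noteq> 0" "w - p k \<noteq> 0" using assms k by auto
  then show "A k / (z - p k) - A k / (w - p k) = - (z - w) * (A k / ((z - p k) * (w - p k)))"
    by (simp add: field_simps)
qed simp

text \<open>For \<open>norm u \<le> 2\<close> the bound 1 / 8 keeps the denominators of the fixed
  point equation at least 3 / 4. Then \<open>size\<close>, with 8 / 3 = 2 / (3 / 4), makes each disc
  invariant, and \<open>slope\<close> with 1 / 32 gives the contraction constant 4 / 32 / (3 / 4)^2
  = 2 / 9. The radius 2 leaves an annulus outside the holes for contours; \<open>t\<close> is a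
  separate parameter because later error terms are multiples of it.\<close>

locale separated_poles =
  fixes n :: nat and A p :: "nat \<Rightarrow> complex" and \<delta> t :: "nat \<Rightarrow> real"
  assumes n_pos: "n > 0"
    and A_nz: "\<And>j. j \<in> {1..n} \<Longrightarrow> A j \<noteq> 0"
    and disjoint: "\<And>i j. i \<in> {1..n} \<Longrightarrow> j \<in> {1..n} \<Longrightarrow> i \<noteq> j \<Longrightarrow> cball (p i) (\<delta> i) \<inter> cball (p j) (\<delta> j) = {}"
    and rest_bound: "\<And>j z. j \<in> {1..n} \<Longrightarrow> z \<in> cball (p j) (\<delta> j) \<Longrightarrow> norm (other_poles n A p j z) \<le> 1 / 8"
    and size: "\<And>j. j \<in> {1..n} \<Longrightarrow> norm (A j) * (8 / 3) \<le> \<delta> j"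
    and slope: "\<And>j z w. j \<in> {1..n} \<Longrightarrow> z \<in> cball (p j) (\<delta> j) \<Longrightarrow> w \<in> cball (p j) (\<delta> j) \<Longrightarrow>
        norm (A j * other_slope n A p j z w) \<le> t j"
    and t_small: "\<And>j. j \<in> {1..n} \<Longrightarrow> t j \<le> 1 / 32"
begin

abbreviation "\<rho> \<equiv> other_poles n A p"
abbreviation "dd \<equiv> other_slope n A p"
abbreviation "Z \<equiv> branch n A p \<delta>"
abbreviation "y \<equiv> branch_denom n A p \<delta>"
abbreviation "q \<equiv> branch_quot n A p \<delta>"
abbreviation "e \<equiv> branch_root n A p \<delta>"

lemma \<delta>_pos: "j \<in> {1..n} \<Longrightarrow> \<delta> j > 0"
  using size[of j] A_nz[of j] by (smt (verit) zero_less_norm_iff mult_pos_pos divide_pos_pos)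

lemma t_nonneg: "j \<in> {1..n} \<Longrightarrow> t j \<ge> 0"
  using slope[of j "p j" "p j"] \<delta>_pos[of j] norm_ge_zero by (smt (verit) centre_in_cball)

lemma pole_notin: "j \<in> {1..n} \<Longrightarrow> k \<in> {1..n} - {j} \<Longrightarrow> z \<in> cball (p j) (\<delta> j) \<Longrightarrow> z \<noteq> p k"
  using disjoint[of j k] \<delta>_pos[of k] by fastforce

lemma inj_p: "inj_on p {1..n}"
proof (rule inj_onI, rule ccontr)
  fix i j assume *: "i \<in> {1..n}" "j \<in> {1..n}" "p i = p j" "i \<noteq> j"
  then show False using pole_notin[of i j "p i"] \<delta>_pos[of i] by auto
qed

lemma denom_lower:
  assumes "j \<in> {1..n}" "norm u \<le> 2" "z \<in> cball (p j) (\<delta> j)"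
  shows "norm (u * \<rho> j z) \<le> 1 / 4" "3 / 4 \<le> norm (1 - u * \<rho> j z)" "norm (1 - u * \<rho> j z) \<le> 5 / 4"
proof -
  have "norm u * norm (\<rho> j z) \<le> 2 * (1 / 8)"
    by (rule mult_mono[OF assms(2) rest_bound[OF assms(1,3)]]) auto
  then show *: "norm (u * \<rho> j z) \<le> 1 / 4" by (simp add: norm_mult)
  show "3 / 4 \<le> norm (1 - u * \<rho> j z)"
    using norm_triangle_ineq2[of 1 "u * \<rho> j z"] * by simp
  show "norm (1 - u * \<rho> j z) \<le> 5 / 4"
    using norm_triangle_ineq4[of 1 "u * \<rho> j z"] * by simp
qed

lemma branch_contraction:
  assumes j: "j \<in> {1..n}" and u: "norm u \<le> 2"
    and z: "z \<in> cball (p j) (\<delta> j)" and w: "w \<in> cball (p j) (\<delta> j)"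
  shows "norm ((p j + A j * u / (1 - u * \<rho> j z)) - (p j + A j * u / (1 - u * \<rho> j w))) \<le> 2 / 9 * norm (z - w)"
proof -
  let ?a = "1 - u * \<rho> j z" and ?b = "1 - u * \<rho> j w"
  have a: "3 / 4 \<le> norm ?a" and b: "3 / 4 \<le> norm ?b"
    using denom_lower[OF j u] z w by auto
  then have nz: "?a \<noteq> 0" "?b \<noteq> 0" by auto
  have "(p j + A j * u / ?a) - (p j + A j * u / ?b) = A j * u * (?b - ?a) / (?a * ?b)"
    using nz by (simp add: field_simps)
  also have "?b - ?a = u * (\<rho> j z - \<rho> j w)" by (simp add: algebra_simps)
  also have "\<rho> j z - \<rho> j w = - (z - w) * dd j z w"
    by (rule other_poles_diff) (use pole_notin[OF j] z w in auto)
  finally have "norm ((p j + A j * u / ?a) - (p j + A j * u / ?b))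
      = (norm u)\<^sup>2 * norm (A j * dd j z w) * norm (z - w) / (norm ?a * norm ?b)"
    by (simp add: norm_mult norm_divide power2_eq_square norm_minus_commute mult_ac)
  also have "\<dots> \<le> 4 * (1 / 32) * norm (z - w) / (3 / 4 * (3 / 4))"
  proof (rule frac_le)
    have "(norm u)\<^sup>2 \<le> 2\<^sup>2" by (rule power_mono[OF u]) simp
    moreover have "norm (A j * dd j z w) \<le> 1 / 32"
      using slope[OF j z w] t_small[OF j] by linarith
    ultimately show "(norm u)\<^sup>2 * norm (A j * dd j z w) * norm (z - w) \<le> 4 * (1 / 32) * norm (z - w)"
      by (intro mult_right_mono mult_mono) auto
    show "3 / 4 * (3 / 4) \<le> norm ?a * norm ?b" by (rule mult_mono[OF a b]) auto
  qed auto
  finally show ?thesis by simp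
qed

lemma branch_exists:
  assumes j: "j \<in> {1..n}" and u: "norm u \<le> 2"
  shows "\<exists>!z. z \<in> cball (p j) (\<delta> j) \<and> z = p j + A j * u / (1 - u * \<rho> j z)"
proof -
  define \<Phi> where "\<Phi> z = p j + A j * u / (1 - u * \<rho> j z)" for z
  have "\<exists>!z\<in>cball (p j) (\<delta> j). \<Phi> z = z"
  proof (rule Banach_fix)
    show "complete (cball (p j) (\<delta> j))" by (simp add: compact_imp_complete)
    show "cball (p j) (\<delta> j) \<noteq> {}" using \<delta>_pos[OF j] by auto
    show "(0::real) \<le> 2 / 9" "(2 / 9 :: real) < 1" by auto
    show "\<Phi> ` cball (p j) (\<delta> j) \<subseteq> cball (p j) (\<delta> j)"
    proof clarify
      fix z assume z: "z \<in> cball (p j) (\<delta> j)"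
      have "norm (A j * u / (1 - u * \<rho> j z)) = norm (A j) * norm u / norm (1 - u * \<rho> j z)"
        by (simp add: norm_divide norm_mult)
      also have "\<dots> \<le> norm (A j) * 2 / (3 / 4)"
        by (rule frac_le) (use u denom_lower[OF j u z] in \<open>auto intro: mult_left_mono\<close>)
      also have "\<dots> \<le> \<delta> j" using size[OF j] by simp
      finally show "\<Phi> z \<in> cball (p j) (\<delta> j)" by (simp add: \<Phi>_def dist_norm)
    qed
    show "dist (\<Phi> z) (\<Phi> w) \<le> 2 / 9 * dist z w"
      if z: "z \<in> cball (p j) (\<delta> j)" and w: "w \<in> cball (p j) (\<delta> j)" for z w
      unfolding \<Phi>_def dist_norm by (rule branch_contraction[OF j u z w])
  qed
  then show ?thesis unfolding \<Phi>_def by metis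
qed

lemma branch_props:
  assumes j: "j \<in> {1..n}" and u: "norm u \<le> 2"
  shows branch_in: "Z j u \<in> cball (p j) (\<delta> j)"
    and branch_eq: "Z j u = p j + A j * u / y j u"
    and denom_ge: "3 / 4 \<le> norm (y j u)" and denom_le: "norm (y j u) \<le> 5 / 4" and denom_nz: "y j u \<noteq> 0"
    and denom_near: "norm (y j u - 1) \<le> 1 / 4"
proof -
  have *: "Z j u \<in> cball (p j) (\<delta> j) \<and> Z j u = p j + A j * u / (1 - u * \<rho> j (Z j u))"
    unfolding branch_def by (rule theI'[OF branch_exists[OF assms]])
  then show "Z j u \<in> cball (p j) (\<delta> j)" "Z j u = p j + A j * u / y j u"
    by (auto simp: branch_denom_def)
  show "3 / 4 \<le> norm (y j u)" "norm (y j u) \<le> 5 / 4"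
    using denom_lower[OF j u, of "Z j u"] * by (auto simp: branch_denom_def)
  then show "y j u \<noteq> 0" by auto
  show "norm (y j u - 1) \<le> 1 / 4"
    using denom_lower(1)[OF j u, of "Z j u"] * by (simp add: branch_denom_def)
qed

lemma branch_unique:
  assumes "j \<in> {1..n}" "norm u \<le> 2" "z \<in> cball (p j) (\<delta> j)"
    and "z = p j + A j * u / (1 - u * \<rho> j z)"
  shows "Z j u = z"
  unfolding branch_def by (rule the1_equality[OF branch_exists[OF assms(1,2)]]) (use assms in auto)

text \<open>The a posteriori estimate for a contraction with constant 2 / 9, whence 9 / 7 = 1 / (1 -
  2 / 9). It later yields continuity of the branches in the residues.\<close>

lemma branch_dist:
  assumes j: "j \<in> {1..n}" and u: "norm u \<le> 2" and z: "z \<in> cball (p j) (\<delta> j)"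
  shows "norm (Z j u - z) \<le> 9 / 7 * norm (p j + A j * u / (1 - u * \<rho> j z) - z)"
proof -
  have "norm (Z j u - (p j + A j * u / (1 - u * \<rho> j z))) \<le> 2 / 9 * norm (Z j u - z)"
    using branch_contraction[OF j u branch_in[OF j u] z]
    unfolding branch_eq[OF j u, unfolded branch_denom_def, symmetric] .
  moreover have "norm (Z j u - z) \<le> norm (Z j u - (p j + A j * u / (1 - u * \<rho> j z)))
      + norm (p j + A j * u / (1 - u * \<rho> j z) - z)"
    using dist_triangle[of "Z j u" z "p j + A j * u / (1 - u * \<rho> j z)"] by (simp only: dist_norm)
  ultimately show ?thesis by linarith
qed

lemma branch_0: "j \<in> {1..n} \<Longrightarrow> Z j 0 = p j" and denom_0: "y j 0 = 1"
  using branch_eq[of j 0] by (auto simp: branch_denom_def)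

lemma slope_bound:
  assumes "j \<in> {1..n}" "norm u \<le> 2" "norm w \<le> 2"
  shows "norm (A j * u * w * dd j (Z j u) (Z j w)) \<le> 4 * t j"
proof -
  have "norm (A j * u * w * dd j (Z j u) (Z j w)) = (norm u * norm w) * norm (A j * dd j (Z j u) (Z j w))"
    by (simp add: norm_mult mult_ac)
  also have "\<dots> \<le> (2 * 2) * t j"
    by (intro mult_mono slope branch_in assms) (use assms in auto)
  finally show ?thesis by simp
qed

text \<open>Clearing denominators in the two fixed point equations leaves a difference of values of
  \<open>other_poles\<close>, itself a multiple of \<open>Z j u - Z j w\<close>. Injectivity, the
  Lipschitz bound and the derivative of the branch are read off from this identity.\<close>

lemma branch_diff:
  assumes j: "j \<in> {1..n}" and u: "norm u \<le> 2" and w: "norm w \<le> 2"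
  shows "(Z j u - Z j w) * q j u w = A j * (u - w)"
proof -
  have 1: "(Z j u - p j) * y j u = A j * u" "(Z j w - p j) * y j w = A j * w"
    using branch_eq[OF j u] branch_eq[OF j w] denom_nz[OF j u] denom_nz[OF j w]
    by (simp_all add: field_simps)
  have rd: "\<rho> j (Z j u) - \<rho> j (Z j w) = - (Z j u - Z j w) * dd j (Z j u) (Z j w)"
    by (rule other_poles_diff) (use pole_notin[OF j] branch_in[OF j u] branch_in[OF j w] in auto)
  have "(Z j u - Z j w) * (y j u * y j w)
      = ((Z j u - p j) * y j u) * y j w - ((Z j w - p j) * y j w) * y j u" by (simp add: algebra_simps)
  also have "\<dots> = A j * u * y j w - A j * w * y j u" unfolding 1 ..
  also have "\<dots> = A j * (u - w + u * w * (\<rho> j (Z j u) - \<rho> j (Z j w)))"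
    by (simp add: branch_denom_def algebra_simps)
  finally have "(Z j u - Z j w) * (y j u * y j w) = A j * (u - w + u * w * (\<rho> j (Z j u) - \<rho> j (Z j w)))" .
  then show ?thesis
    unfolding branch_quot_def distrib_left rd by (simp add: algebra_simps)
qed

lemma quot_ge:
  assumes j: "j \<in> {1..n}" and u: "norm u \<le> 2" and w: "norm w \<le> 2"
  shows "7 / 16 \<le> norm (q j u w)" "q j u w \<noteq> 0"
proof -
  have "3 / 4 * (3 / 4) \<le> norm (y j u) * norm (y j w)"
    by (rule mult_mono[OF denom_ge[OF j u] denom_ge[OF j w]]) auto
  moreover have "norm (A j * u * w * dd j (Z j u) (Z j w)) \<le> 1 / 8"
    using slope_bound[OF assms] t_small[OF j] by linarith
  ultimately show "7 / 16 \<le> norm (q j u w)"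
    using norm_triangle_ineq2[of "y j u * y j w" "- (A j * u * w * dd j (Z j u) (Z j w))"]
    by (simp add: branch_quot_def norm_mult)
  then show "q j u w \<noteq> 0" by auto
qed

lemma branch_inj:
  assumes "j \<in> {1..n}" shows "inj_on (Z j) (cball 0 2)"
proof (rule inj_onI)
  fix u w assume "u \<in> cball 0 2" "w \<in> cball 0 2" "Z j u = Z j w"
  then show "u = w" using branch_diff[OF assms, of u w] A_nz[OF assms] by auto
qed

lemma branch_lipschitz:
  assumes "j \<in> {1..n}" "norm u \<le> 2" "norm w \<le> 2"
  shows "norm (Z j u - Z j w) \<le> norm (A j) * 16 / 7 * norm (u - w)"
proof -
  have "norm (Z j u - Z j w) * (7 / 16) \<le> norm (Z j u - Z j w) * norm (q j u w)"
    by (rule mult_left_mono[OF quot_ge(1)[OF assms]]) simp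
  also have "\<dots> = norm (A j) * norm (u - w)"
    using branch_diff[OF assms] by (metis norm_mult)
  finally show ?thesis by simp
qed

lemma continuous_branch:
  assumes "j \<in> {1..n}" shows "continuous_on (cball 0 2) (Z j)"
proof (rule lipschitz_on_continuous_on, rule lipschitz_onI)
  show "dist (Z j u) (Z j w) \<le> norm (A j) * 16 / 7 * dist u w"
    if "u \<in> cball 0 2" "w \<in> cball 0 2" for u w
    unfolding dist_norm by (rule branch_lipschitz[OF assms]) (use that in auto)
qed simp

lemma continuous_other_poles:
  assumes "j \<in> {1..n}" shows "continuous_on (cball (p j) (\<delta> j)) (\<rho> j)"
  unfolding other_poles_def by (intro continuous_intros) (use pole_notin[OF assms] in auto)

lemma continuous_other_slope:
  assumes "j \<in> {1..n}"
  shows "continuous_on (cball (p j) (\<delta> j) \<times> cball (p j) (\<delta> j)) (\<lambda>(z, w). dd j z w)"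
  unfolding other_slope_def case_prod_unfold
  by (intro continuous_intros) (use pole_notin[OF assms] in auto)

lemma continuous_denom: assumes j: "j \<in> {1..n}" shows "continuous_on (cball 0 2) (y j)"
  unfolding branch_denom_def
  by (intro continuous_intros continuous_on_compose2[OF continuous_other_poles[OF j] continuous_branch[OF j]])
     (use branch_in[OF j] in auto)

lemma continuous_quot:
  assumes j: "j \<in> {1..n}" shows "continuous_on (cball 0 2 \<times> cball 0 2) (\<lambda>(u, w). q j u w)"
proof -
  have 1: "continuous_on (cball 0 2 \<times> cball 0 2) (\<lambda>x. f (fst x))"
    "continuous_on (cball 0 2 \<times> cball 0 2) (\<lambda>x. f (snd x))"
    if "continuous_on (cball 0 2) f" for f :: "complex \<Rightarrow> complex"
    by (rule continuous_on_compose2[OF that]; auto intro!: continuous_intros)+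
  note c = 1[OF continuous_denom[OF j]] 1[OF continuous_branch[OF j]]
  have "continuous_on (cball 0 2 \<times> cball 0 2) (\<lambda>x. dd j (Z j (fst x)) (Z j (snd x)))"
    using continuous_on_compose2[OF continuous_other_slope[OF j] continuous_on_Pair[OF c(3,4)]]
      branch_in[OF j] by (auto simp: image_subset_iff)
  then show ?thesis
    unfolding branch_quot_def case_prod_unfold
    by (intro continuous_intros c)
qed

lemma branch_has_derivative:
  assumes j: "j \<in> {1..n}" and w: "norm w < 2"
  shows "(Z j has_field_derivative A j / q j w w) (at w)"
proof -
  have w2: "norm w \<le> 2" using w by simp
  have "continuous_on (cball 0 2) (\<lambda>u. (\<lambda>(u, w). q j u w) (u, w))"
    by (rule continuous_on_compose2[OF continuous_quot[OF j]]) (use w2 in \<open>auto intro!: continuous_intros\<close>)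
  then have "continuous_on (cball 0 2) (\<lambda>u. q j u w)" by simp
  then have "continuous_on (ball 0 2) (\<lambda>u. q j u w)" by (rule continuous_on_subset) auto
  then have "isCont (\<lambda>u. q j u w) w" using w by (simp add: continuous_on_eq_continuous_at)
  then have "((\<lambda>u. A j / q j u w) \<longlongrightarrow> A j / q j w w) (at w)"
    by (intro tendsto_intros) (use quot_ge(2)[OF j w2 w2] in \<open>auto simp: isCont_def\<close>)
  moreover have "\<forall>\<^sub>F u in at w. A j / q j u w = (Z j u - Z j w) / (u - w)"
  proof -
    have "\<forall>\<^sub>F u in at w. u \<in> ball 0 2 - {w}"
      by (rule eventually_at_in_open) (use w in auto)
    then show ?thesis
    proof eventually_elim
      case (elim u)
      then have "norm u \<le> 2" "u \<noteq> w" by auto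
      then show ?case
        using branch_diff[OF j _ w2, of u] quot_ge(2)[OF j _ w2, of u] by (simp add: field_simps)
    qed
  qed
  ultimately show ?thesis
    unfolding has_field_derivative_iff by (rule Lim_transform_eventually)
qed

lemma holomorphic_branch: assumes "j \<in> {1..n}" shows "Z j holomorphic_on ball 0 2"
  by (rule holomorphic_onI) (use branch_has_derivative[OF assms] in
    \<open>auto simp: field_differentiable_def intro: has_field_derivative_at_within\<close>)

lemma holomorphic_denom: assumes j: "j \<in> {1..n}" shows "y j holomorphic_on ball 0 2"
  unfolding branch_denom_def other_poles_def
  by (intro holomorphic_intros holomorphic_branch[OF j]) (use pole_notin[OF j] branch_in[OF j] in fastforce)

section \<open>The square root of the normalized derivative\<close>

lemma root_arg_bound:
  assumes j: "j \<in> {1..n}" and u: "norm u \<le> 2"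
  shows "norm (A j * u\<^sup>2 * dd j (Z j u) (Z j u) / (y j u)\<^sup>2) \<le> 8 * t j"
proof -
  have "(3 / 4)\<^sup>2 \<le> (norm (y j u))\<^sup>2" by (rule power_mono[OF denom_ge[OF assms]]) simp
  then have "norm (A j * u\<^sup>2 * dd j (Z j u) (Z j u)) / (norm (y j u))\<^sup>2 \<le> 4 * t j / (3 / 4)\<^sup>2"
    by (intro frac_le) (use slope_bound[OF j u u] t_nonneg[OF j] in \<open>auto simp: power2_eq_square mult_ac\<close>)
  also have "\<dots> \<le> 8 * t j" using t_nonneg[OF j] by (simp add: power2_eq_square)
  finally show ?thesis by (simp add: norm_divide norm_power)
qed

lemma root_arg_pos:
  assumes j: "j \<in> {1..n}" and u: "norm u \<le> 2"
  shows "Re (1 + A j * u\<^sup>2 * dd j (Z j u) (Z j u) / (y j u)\<^sup>2) > 0"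
proof -
  let ?x = "A j * u\<^sup>2 * dd j (Z j u) (Z j u) / (y j u)\<^sup>2"
  have "norm ?x \<le> 1 / 4" using root_arg_bound[OF assms] t_small[OF j] by linarith
  then show ?thesis using abs_Re_le_cmod[of ?x] by (simp add: abs_le_iff)
qed

lemma root_square:
  assumes j: "j \<in> {1..n}" and u: "norm u \<le> 2"
  shows "(e j u)\<^sup>2 * q j u u = 1"
proof -
  let ?x = "A j * u\<^sup>2 * dd j (Z j u) (Z j u) / (y j u)\<^sup>2"
  have "1 + ?x \<noteq> 0" using root_arg_pos[OF assms] by (metis less_irrefl zero_complex.sel(1))
  moreover have "q j u u = (y j u)\<^sup>2 * (1 + ?x)"
    using denom_nz[OF assms] by (simp add: branch_quot_def power2_eq_square field_simps)
  ultimately show ?thesis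
    using denom_nz[OF assms] by (simp add: branch_root_def power_mult_distrib power_divide)
qed

lemma holomorphic_root: assumes j: "j \<in> {1..n}" shows "e j holomorphic_on ball 0 2"
proof -
  have "(\<lambda>u. dd j (Z j u) (Z j u)) holomorphic_on ball 0 2"
    unfolding other_slope_def
    by (intro holomorphic_intros holomorphic_branch[OF j]) (use pole_notin[OF j] branch_in[OF j] in fastforce)
  moreover have "1 + A j * u\<^sup>2 * dd j (Z j u) (Z j u) / (y j u)\<^sup>2 \<notin> \<real>\<^sub>\<le>\<^sub>0" if "u \<in> ball 0 2" for u
    using root_arg_pos[OF j, of u] that complex_nonpos_Reals_iff by fastforce
  moreover have "csqrt (1 + A j * u\<^sup>2 * dd j (Z j u) (Z j u) / (y j u)\<^sup>2) \<noteq> 0" if "u \<in> ball 0 2" for u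
    using root_arg_pos[OF j, of u] that by (metis csqrt_eq_0 dist_0_norm less_eq_real_def less_irrefl mem_ball zero_complex.sel(1))
  ultimately show ?thesis
    unfolding branch_root_def
    by (intro holomorphic_intros holomorphic_denom[OF j]) (use denom_nz[OF j] in auto)
qed

lemma root_0: "e j 0 = 1"
  by (simp add: branch_root_def denom_0)

lemma root_close:
  assumes j: "j \<in> {1..n}" and u: "norm u \<le> 2"
  shows "norm (e j u * y j u - 1) \<le> 11 * t j" and root_le: "norm (e j u) \<le> 9 / 5"
proof -
  let ?x = "A j * u\<^sup>2 * dd j (Z j u) (Z j u) / (y j u)\<^sup>2"
  let ?s = "csqrt (1 + ?x)"
  have x: "norm ?x \<le> 8 * t j" by (rule root_arg_bound[OF assms])
  have s1: "norm (?s - 1) \<le> norm ?x" using norm_csqrt_minus_one_le[of "1 + ?x"] by simp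
  have x4: "norm ?x \<le> 1 / 4" using x t_small[OF j] by linarith
  have s: "3 / 4 \<le> norm ?s"
    using norm_triangle_ineq2[of 1 "1 - ?s"] s1 x4 by (simp add: norm_minus_commute)
  then have s0: "?s \<noteq> 0" by auto
  have ey: "e j u * y j u = 1 / ?s"
    using denom_nz[OF assms] by (simp add: branch_root_def)
  have "e j u * y j u - 1 = (1 - ?s) / ?s" unfolding ey using s0 by (simp add: field_simps)
  then have "norm (e j u * y j u - 1) = norm (?s - 1) / norm ?s"
    by (simp add: norm_divide norm_minus_commute)
  also have "\<dots> \<le> 8 * t j / (3 / 4)" by (rule frac_le) (use s1 x s t_nonneg[OF j] in auto)
  also have "\<dots> \<le> 11 * t j" using t_nonneg[OF j] by simp
  finally show "norm (e j u * y j u - 1) \<le> 11 * t j" .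
  have "norm (e j u) = 1 / (norm (y j u) * norm ?s)"
    by (simp only: branch_root_def norm_divide norm_mult norm_one)
  also have "\<dots> \<le> 1 / (3 / 4 * (3 / 4))"
    by (rule frac_le[OF _ _ _ mult_mono[OF denom_ge[OF assms] s]]) auto
  finally show "norm (e j u) \<le> 9 / 5" by simp
qed

text \<open>The product is exactly 1 for \<open>u = w\<close>. In general it is compared with
  \<open>(e j u * y j u) * (e j w * y j w)\<close>, both factors being within
  \<open>11 * t j\<close> of 1. The difference estimated here is the numerator of the kernel by
  which a hole acts on itself.\<close>

lemma root_quot_close:
  assumes j: "j \<in> {1..n}" and u: "norm u \<le> 2" and w: "norm w \<le> 2"
  shows "norm (e j u * e j w * q j u w - 1) \<le> 64 * t j"
proof -
  let ?a = "e j u * y j u" and ?b = "e j w * y j w"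
  let ?X = "e j u * e j w * (A j * u * w * dd j (Z j u) (Z j w))"
  have t: "t j \<ge> 0" "t j \<le> 1 / 32" using t_nonneg[OF j] t_small[OF j] by auto
  have a: "norm (?a - 1) \<le> 11 * t j" and b: "norm (?b - 1) \<le> 11 * t j"
    using root_close assms by auto
  have X: "norm ?X \<le> 9 / 5 * (9 / 5) * (4 * t j)"
    unfolding norm_mult[of "e j u * e j w"] norm_mult[of "e j u"]
    by (intro mult_mono root_le slope_bound assms) auto
  have eq: "e j u * e j w * q j u w - 1 = (?a - 1) * (?b - 1) + (?a - 1) + (?b - 1) + ?X"
    by (simp add: branch_quot_def algebra_simps)
  have "norm (e j u * e j w * q j u w - 1)
      \<le> norm ((?a - 1) * (?b - 1)) + norm (?a - 1) + norm (?b - 1) + norm ?X"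
    unfolding eq using norm_triangle_ineq[of "(?a - 1) * (?b - 1) + (?a - 1) + (?b - 1)" ?X]
      norm_triangle_ineq[of "(?a - 1) * (?b - 1) + (?a - 1)" "?b - 1"]
      norm_triangle_ineq[of "(?a - 1) * (?b - 1)" "?a - 1"] by linarith
  moreover have "norm ((?a - 1) * (?b - 1)) \<le> (11 * t j) * (11 / 32)"
  proof -
    have b': "norm (?b - 1) \<le> 11 / 32" using b t by linarith
    show ?thesis unfolding norm_mult[of "?a - 1"] by (rule mult_mono[OF a b']) (use t in auto)
  qed
  ultimately show ?thesis using a b X t(1) by linarith
qed

end

section \<open>Goodness and residues\<close>

text \<open>In a finite partition into closed sets each piece is open as well, so a connected set
  meeting a piece lies in it.\<close>

lemma connected_components_of_finite_closed_partition:
  assumes I: "finite I" and cl: "\<And>i. i \<in> I \<Longrightarrow> closedin Y (C i)"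
    and con: "\<And>i. i \<in> I \<Longrightarrow> connectedin Y (C i)" and ne: "\<And>i. i \<in> I \<Longrightarrow> C i \<noteq> {}"
    and dis: "\<And>i j. i \<in> I \<Longrightarrow> j \<in> I \<Longrightarrow> i \<noteq> j \<Longrightarrow> C i \<inter> C j = {}"
    and top: "topspace Y = (\<Union>i\<in>I. C i)"
  shows "connected_components_of Y = C ` I"
proof -
  have op: "openin Y (C i)" if i: "i \<in> I" for i
  proof -
    have "closedin Y (\<Union>j\<in>I - {i}. C j)" using I cl by (intro closedin_Union) auto
    moreover have "C i = topspace Y - (\<Union>j\<in>I - {i}. C j)" using top dis i by fastforce
    ultimately show ?thesis by (metis openin_diff openin_topspace)
  qed
  have comp: "connected_component_of_set Y x = C i" if i: "i \<in> I" and x: "x \<in> C i" for i x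
  proof (rule connected_component_of_unique[OF x con[OF i]])
    fix D assume D: "x \<in> D \<and> connectedin Y D"
    show "D \<subseteq> C i"
    proof (rule ccontr)
      assume "\<not> D \<subseteq> C i"
      moreover have "D \<subseteq> topspace Y" using D by (simp add: connectedin_subset_topspace)
      moreover have "openin Y (topspace Y - C i)" using cl[OF i] by blast
      ultimately show False
        using connectedinD[OF conjunct2[OF D] op[OF i], of "topspace Y - C i"] D x by auto
    qed
  qed
  show ?thesis
  proof
    show "connected_components_of Y \<subseteq> C ` I"
      using comp top by (auto simp: connected_components_of_def)
    show "C ` I \<subseteq> connected_components_of Y"
    proof clarify
      fix i assume i: "i \<in> I"
      then obtain x where "x \<in> C i" using ne by blast
      then show "C i \<in> connected_components_of Y"
        using comp[OF i, of x] i top connected_component_in_connected_components_of[of Y x] by auto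
    qed
  qed
qed

context separated_poles
begin

definition hole :: "nat \<Rightarrow> complex set" where "hole j = Z j ` cball 0 1"
definition holes :: "complex set" where "holes = (\<Union>j\<in>{1..n}. hole j)"

abbreviation "R \<equiv> pf_map n A p"

lemma hole_subset: "j \<in> {1..n} \<Longrightarrow> hole j \<subseteq> cball (p j) (\<delta> j)"
  using branch_in[of j] unfolding hole_def by fastforce

lemma hole_disjoint: "i \<in> {1..n} \<Longrightarrow> j \<in> {1..n} \<Longrightarrow> i \<noteq> j \<Longrightarrow> hole i \<inter> hole j = {}"
  using hole_subset[of i] hole_subset[of j] disjoint[of i j] by blast

lemma branch_distinct:
  assumes "i \<in> {1..n}" "j \<in> {1..n}" "i \<noteq> j" "norm u \<le> 2" "norm w \<le> 2"
  shows "Z i u \<noteq> Z j w"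
  using branch_in[OF assms(1,4)] branch_in[OF assms(2,5)] disjoint[OF assms(1-3)] by auto

lemma compact_hole: "j \<in> {1..n} \<Longrightarrow> compact (hole j)"
  unfolding hole_def
  by (intro compact_continuous_image continuous_on_subset[OF continuous_branch]) auto

lemma connected_hole: "j \<in> {1..n} \<Longrightarrow> connected (hole j)"
  unfolding hole_def
  by (intro connected_continuous_image continuous_on_subset[OF continuous_branch]) auto

text \<open>A continuous injection of the compact disc is a homeomorphism onto the hole, and a
  compact set homeomorphic to a convex one does not separate the plane.\<close>

lemma connected_compl_hole:
  assumes j: "j \<in> {1..n}" shows "connected (- hole j)"
proof (rule connected_complement_homeomorphic_convex_compact)
  have "cball (0::complex) 1 homeomorphic hole j"
    by (rule homeomorphic_compact[of _ "Z j"])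
       (auto simp: hole_def intro!: continuous_on_subset[OF continuous_branch[OF j]]
          inj_on_subset[OF branch_inj[OF j]])
  then show "hole j homeomorphic cball (0::complex) 1" by (rule homeomorphic_sym[THEN iffD1])
qed auto

lemma compact_holes: "compact holes"
  unfolding holes_def by (intro compact_UN compact_hole) auto

lemma connected_compl_holes: "connected (- holes)"
  unfolding holes_def
  by (rule connected_complement_disjoint_union)
     (simp_all add: compact_hole connected_compl_hole hole_disjoint del: One_nat_def atLeastAtMost_iff)

lemma open_compl_holes: "open (- holes)"
  using compact_holes by (simp add: compact_imp_closed open_Compl)

lemma branch_pole_iff:
  assumes j: "j \<in> {1..n}" and u: "norm u \<le> 2"
  shows "Z j u \<in> p ` {1..n} \<longleftrightarrow> u = 0"
proof
  assume "Z j u \<in> p ` {1..n}"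
  then obtain k where k: "k \<in> {1..n}" "Z j u = p k" by auto
  then have "k = j" using pole_notin[OF j, of k "Z j u"] branch_in[OF j u] by auto
  then show "u = 0"
    using branch_eq[OF j u] denom_nz[OF j u] A_nz[OF j] k(2) by auto
qed (use branch_0[OF j] j in auto)

lemma map_branch:
  assumes j: "j \<in> {1..n}" and u: "norm u \<le> 2" and u0: "u \<noteq> 0"
  shows "(\<Sum>k=1..n. A k / (Z j u - p k)) = 1 / u"
proof -
  have "(\<Sum>k=1..n. A k / (Z j u - p k)) = A j / (Z j u - p j) + \<rho> j (Z j u)"
    unfolding other_poles_def using j by (simp add: sum.remove)
  also have "A j / (Z j u - p j) = y j u / u"
  proof -
    have "Z j u - p j = A j * u / y j u" using branch_eq[OF j u] by simp
    then show ?thesis using A_nz[OF j] by simp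
  qed
  also have "y j u / u + \<rho> j (Z j u) = 1 / u"
    using u0 by (simp add: branch_denom_def field_simps)
  finally show ?thesis .
qed

lemma R_branch:
  assumes j: "j \<in> {1..n}" and u: "norm u \<le> 2"
  shows "R (Some (Z j u)) = (if u = 0 then None else Some (1 / u))"
  using pf_map_pole[of "Z j u" p n A] pf_map_Some[of "Z j u" p n A]
    branch_pole_iff[OF assms] map_branch[OF assms] by auto

text \<open>If the value \<open>v\<close> at \<open>z\<close> has norm at least 1, then
  \<open>u = 1 / v\<close> lies in the closed unit disc and the \<open>n\<close> branches at
  \<open>u\<close> are \<open>n\<close> distinct points with value \<open>v\<close>. They exhaust
  the fibre, so \<open>z\<close> is one of them.\<close>

lemma R_vimage_Some: "R (Some z) \<in> unit_disk \<longleftrightarrow> z \<notin> holes"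
proof
  assume R: "R (Some z) \<in> unit_disk"
  show "z \<notin> holes"
  proof
    assume "z \<in> holes"
    then obtain j u where j: "j \<in> {1..n}" and u: "norm u \<le> 1" and z: "z = Z j u"
      by (auto simp: holes_def hole_def)
    have "u \<noteq> 0" and lt: "norm (1 / u) < 1"
      using R R_branch[OF j, of u] u by (auto simp: z unit_disk_def split: if_splits)
    then have "norm u > 1" by (simp add: norm_divide divide_less_eq)
    then show False using u by simp
  qed
next
  assume z: "z \<notin> holes"
  have zp: "z \<notin> p ` {1..n}"
  proof
    assume "z \<in> p ` {1..n}"
    then obtain j where j: "j \<in> {1..n}" "z = Z j 0" using branch_0 by auto
    then show False using z by (force simp: holes_def hole_def)
  qed
  define v where "v = (\<Sum>k=1..n. A k / (z - p k))"
  have Rz: "R (Some z) = Some v" unfolding v_def by (rule pf_map_Some[OF zp])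
  show "R (Some z) \<in> unit_disk"
  proof (rule ccontr)
    assume "R (Some z) \<notin> unit_disk"
    then have v: "norm v \<ge> 1" by (auto simp: Rz unit_disk_def)
    define u where "u = 1 / v"
    have u: "norm u \<le> 1" "u \<noteq> 0" "1 / u = v"
      using v by (auto simp: u_def norm_divide divide_le_eq)
    define W where "W = (\<lambda>j. Z j u) ` {1..n}"
    have "inj_on (\<lambda>j. Z j u) {1..n}"
      by (rule inj_onI, rule ccontr) (use branch_distinct u(1) in force)
    then have W: "finite W" "card W = n" by (auto simp: W_def card_image)
    have "z \<in> W"
    proof (rule pf_map_eq_at_most[OF n_pos _ W _ Rz])
      show "v \<noteq> 0" using v by auto
      show "R (Some w) = Some v" if "w \<in> W" for w
        using that R_branch[of _ u] u by (auto simp: W_def)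
    qed
    then show False using z u(1) by (auto simp: W_def holes_def hole_def)
  qed
qed

lemma R_vimage: "R -` unit_disk = insert None (Some ` (- holes))"
proof (rule set_eqI)
  fix x show "x \<in> R -` unit_disk \<longleftrightarrow> x \<in> insert None (Some ` (- holes))"
    using R_vimage_Some pf_map_None[OF n_pos, of A p] by (cases x) (auto simp: unit_disk_def)
qed

lemma openin_R_vimage: "openin sphere_top (R -` unit_disk)"
  unfolding R_vimage openin_Alexandroff_compactification
  by (rule disjI2) (use compact_holes in \<open>auto simp: Compl_eq_Diff_UNIV compact_imp_closed intro!: exI[of _ holes]\<close>)

text \<open>Infinity is in the closure of the finite part because \<open>holes\<close> is bounded,
  and adding limit points preserves connectedness.\<close>

lemma connectedin_R_vimage: "connectedin sphere_top (R -` unit_disk)"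
proof (rule connectedin_intermediate_closure_of)
  show "connectedin sphere_top (Some ` (- holes))"
    by (rule connectedin_continuous_map_image[OF continuous_map_Some])
       (simp add: connected_compl_holes)
  show "Some ` (- holes) \<subseteq> R -` unit_disk" by (auto simp: R_vimage)
  have "None \<in> sphere_top closure_of (Some ` (- holes))"
    unfolding in_closure_of
  proof (intro conjI allI impI)
    fix V assume V: "None \<in> V \<and> openin sphere_top V"
    then obtain C where C: "compact C" "V = insert None (Some ` (UNIV - C))"
      unfolding openin_Alexandroff_compactification by auto
    have "bounded (C \<union> holes)" using C(1) compact_holes by (simp add: compact_imp_bounded)
    then have "C \<union> holes \<noteq> UNIV" by (metis not_bounded_UNIV)
    then obtain z where "z \<notin> C" "z \<notin> holes" by auto
    then show "\<exists>y. y \<in> Some ` (- holes) \<and> y \<in> V" using C(2) by auto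
  qed simp
  then show "R -` unit_disk \<subseteq> sphere_top closure_of (Some ` (- holes))"
    using closure_of_subset[of "Some ` (- holes)" sphere_top] by (auto simp: R_vimage)
qed

lemma good_R: "good n R"
proof -
  let ?Y = "subtopology sphere_top (R -` (- unit_disk))"
  have vim: "R -` (- unit_disk) = (\<Union>j\<in>{1..n}. Some ` hole j)"
  proof -
    have "R -` (- unit_disk) = - insert None (Some ` (- holes))"
      by (simp only: vimage_Compl R_vimage)
    also have "\<dots> = Some ` holes"
    proof (rule set_eqI)
      show "x \<in> - insert None (Some ` (- holes)) \<longleftrightarrow> x \<in> Some ` holes" for x by (cases x) auto
    qed
    finally show ?thesis by (simp add: holes_def image_UN)
  qed
  have comp: "connected_components_of ?Y = (\<lambda>j. Some ` hole j) ` {1..n}"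
  proof (rule connected_components_of_finite_closed_partition)
    fix j assume j: "j \<in> {1..n}"
    have cl: "closedin sphere_top (Some ` hole j)"
      using compact_hole[OF j] by (simp add: compact_imp_closed)
    then show "closedin ?Y (Some ` hole j)"
      using j vim by (auto simp: closedin_subtopology intro!: exI[of _ "Some ` hole j"])
    have "connectedin sphere_top (Some ` hole j)"
      by (rule connectedin_continuous_map_image[OF continuous_map_Some]) (simp add: connected_hole[OF j])
    then show "connectedin ?Y (Some ` hole j)"
      using j vim by (auto simp: connectedin_subtopology)
    show "Some ` hole j \<noteq> {}" by (auto simp: hole_def)
  next
    fix i j assume "i \<in> {1..n}" "j \<in> {1..n}" "i \<noteq> j"
    then show "Some ` hole i \<inter> Some ` hole j = {}" using hole_disjoint by blast
  next
    show "topspace ?Y = (\<Union>j\<in>{1..n}. Some ` hole j)" by (auto simp: vim)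
  qed simp
  have inj: "inj_on (\<lambda>j. Some ` hole j) {1..n}"
  proof (rule inj_onI, rule ccontr)
    fix i j assume *: "i \<in> {1..n}" "j \<in> {1..n}" "Some ` hole i = Some ` hole j" "i \<noteq> j"
    have "hole i = hole j" using *(3) by (simp add: inj_image_eq_iff)
    moreover have "hole i \<noteq> {}" by (simp add: hole_def)
    ultimately show False using hole_disjoint[OF *(1,2,4)] by simp
  qed
  have "card ((\<lambda>j. Some ` hole j) ` {1..n}) = n"
    using card_image[OF inj] by simp
  then show ?thesis
    unfolding good_def comp
    using rational_map_pf_map[OF n_pos inj_p, of A] A_nz pf_map_None[OF n_pos, of A p] connectedin_R_vimage
    by blast
qed

lemma deriv_branch: "j \<in> {1..n} \<Longrightarrow> norm w < 2 \<Longrightarrow> deriv (Z j) w = A j / q j w w"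
  by (rule DERIV_imp_deriv[OF branch_has_derivative])

lemma branch_in_holes_iff:
  assumes j: "j \<in> {1..n}" and u: "norm u \<le> 2"
  shows "Z j u \<in> holes \<longleftrightarrow> norm u \<le> 1"
proof
  assume "Z j u \<in> holes"
  then obtain i w where i: "i \<in> {1..n}" and w: "norm w \<le> 1" "Z j u = Z i w"
    by (auto simp: holes_def hole_def)
  have "i = j"
    using branch_in[OF j u] branch_in[OF i, of w] w disjoint[OF i j] by (metis disjoint_iff order_trans one_le_numeral)
  then have "u = w" using branch_inj[OF j] u w by (auto simp: inj_on_def)
  then show "norm u \<le> 1" using w by simp
next
  assume "norm u \<le> 1"
  then have "Z j u \<in> hole j" by (auto simp: hole_def)
  then show "Z j u \<in> holes" using j by (auto simp: holes_def)
qed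

lemma contour_integral_branch:
  assumes j: "j \<in> {1..n}" and r: "0 < r" "r < 2"
  shows "contour_integral (Z j \<circ> circlepath 0 r) G = 2 * pi * \<i> * cint r (\<lambda>u. A j / q j u u * G (Z j u))"
proof -
  have "contour_integral (Z j \<circ> circlepath 0 r) G
      = contour_integral (circlepath 0 r) (\<lambda>w. deriv (Z j) w * G (Z j w))"
    by (rule contour_integral_comp_analyticW[where s = "ball 0 2"])
       (use r holomorphic_branch[OF j] in \<open>auto simp: analytic_on_open\<close>)
  also have "\<dots> = contour_integral (circlepath 0 r) (\<lambda>w. A j / q j w w * G (Z j w))"
    by (rule contour_integral_cong) (use r in \<open>auto simp: deriv_branch[OF j]\<close>)
  finally show ?thesis by (simp add: cint_eq_contour_integral)
qed

text \<open>In the branch coordinate the integrand for a point \<open>Z j v\<close> of the own hole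
  is \<open>(q j u v / q j u u) / (u - v)\<close>, with Cauchy integral 1, the value of the quotient
  at \<open>u = v\<close>. For another hole the integrand is holomorphic in the disc. The radius
  \<open>r > 1\<close> puts the curve outside the holes.\<close>

lemma winding_branch:
  assumes j: "j \<in> {1..n}" and r: "1 < r" "r < 2" and z: "z \<in> hole i" "i \<in> {1..n}"
  shows "winding_number (Z j \<circ> circlepath 0 r) z = (if i = j then 1 else 0)"
proof -
  have vp: "valid_path (Z j \<circ> circlepath 0 r)"
    by (rule valid_path_compose_holomorphic[OF _ holomorphic_branch[OF j]]) (use r in auto)
  have notin: "z \<notin> path_image (Z j \<circ> circlepath 0 r)"
  proof
    assume "z \<in> path_image (Z j \<circ> circlepath 0 r)"
    then obtain u where "norm u = r" "z = Z j u" using r by (auto simp: path_image_compose)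
    then show False using branch_in_holes_iff[OF j, of u] z r by (auto simp: holes_def)
  qed
  have "winding_number (Z j \<circ> circlepath 0 r) z = cint r (\<lambda>u. A j / q j u u * (1 / (Z j u - z)))"
    using winding_number_valid_path[OF vp notin] contour_integral_branch[OF j, of r "\<lambda>w. 1 / (w - z)"] r
    by simp
  also have "\<dots> = (if i = j then 1 else 0)"
  proof (cases "i = j")
    case True
    then obtain v where v: "norm v \<le> 1" "z = Z j v" using z by (auto simp: hole_def)
    have qv: "q j u u \<noteq> 0" if "norm u \<le> 2" for u by (rule quot_ge(2)[OF j that that])
    have "cint r (\<lambda>u. A j / q j u u * (1 / (Z j u - z))) = cint r (\<lambda>u. (q j u v / q j u u) / (u - v))"
    proof (rule cint_cong)
      fix u :: complex assume u: "norm u = r"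
      then have "u \<noteq> v" using v r by auto
      moreover have d: "(Z j u - z) * q j u v = A j * (u - v)"
        unfolding v by (rule branch_diff[OF j]) (use u v r in auto)
      moreover have "Z j u - z \<noteq> 0" using d \<open>u \<noteq> v\<close> A_nz[OF j] by auto
      ultimately have "A j / (Z j u - z) = q j u v / (u - v)"
        by (simp add: frac_eq_eq mult.commute)
      then have "1 / q j u u * (A j / (Z j u - z)) = 1 / q j u u * (q j u v / (u - v))" by simp
      then show "A j / q j u u * (1 / (Z j u - z)) = (q j u v / q j u u) / (u - v)" by simp
    qed (use r in simp)
    also have "\<dots> = q j v v / q j v v"
    proof (rule cint_Cauchy[where R = 2])
      have "(\<lambda>u. dd j (Z j u) (Z j v)) holomorphic_on ball 0 2" "(\<lambda>u. dd j (Z j u) (Z j u)) holomorphic_on ball 0 2"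
        unfolding other_slope_def
        by (intro holomorphic_intros holomorphic_branch[OF j];
            use pole_notin[OF j] branch_in[OF j] v in fastforce)+
      then show "(\<lambda>u. q j u v / q j u u) holomorphic_on ball 0 2"
        using qv unfolding branch_quot_def
        by (intro holomorphic_intros holomorphic_denom[OF j]) (auto simp: branch_quot_def)
    qed (use r v in auto)
    finally show ?thesis using True qv[of v] v by simp
  next
    case False
    have "z \<notin> cball (p j) (\<delta> j)" using hole_subset[OF z(2)] z(1) disjoint[OF z(2) j False] by blast
    then have nz: "Z j u - z \<noteq> 0" if "u \<in> ball 0 2" for u using branch_in[OF j, of u] that by auto
    have "cint r (\<lambda>u. A j / q j u u * (1 / (Z j u - z))) = cint r (\<lambda>u. deriv (Z j) u * (1 / (Z j u - z)))"
      by (rule cint_cong) (use r deriv_branch[OF j] in auto)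
    also have "\<dots> = 0"
      by (rule cint_holomorphic[where R = 2])
         (use r nz in \<open>auto intro!: holomorphic_intros holomorphic_branch[OF j] holomorphic_deriv\<close>)
    finally show ?thesis using False by simp
  qed
  finally show ?thesis .
qed

text \<open>The residue theorem on the complement of the holes, with the pole at infinity.\<close>
lemma residue_at_infinity:
  assumes hol: "G holomorphic_on - holes" and lim: "((\<lambda>z. z * G z) \<longlongrightarrow> c) at_infinity"
    and r: "1 < r" "r < 2"
  shows "c = (\<Sum>j=1..n. cint r (\<lambda>u. A j / q j u u * G (Z j u)))"
proof -
  let ?\<Gamma> = "\<lambda>j. Z j \<circ> circlepath 0 r"
  define T where "T = (\<Sum>j=1..n. contour_integral (?\<Gamma> j) G)"
  obtain B0 where B0: "\<And>z. z \<in> holes \<Longrightarrow> norm z \<le> B0"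
    using compact_imp_bounded[OF compact_holes] by (auto simp: bounded_iff)
  define B where "B = max B0 0 + 1"
  have B: "z \<notin> holes" if "norm z \<ge> B" for z using B0[of z] that by (auto simp: B_def)
  have contG: "continuous_on {z. norm z \<ge> B} G"
    by (rule continuous_on_subset[OF holomorphic_on_imp_continuous_on[OF hol]]) (use B in auto)
  have eq: "contour_integral (circlepath 0 s) G = T" if s: "s > B" for s
  proof -
    \<comment> \<open>Index 0 is a large circle, the others are the reversed curves around the
      holes. At a point of a hole exactly one of the latter winds, with number -1, and cancels the
      circle.\<close>
    define \<gamma> where "\<gamma> i = (if i = 0 then circlepath 0 s else reversepath (?\<Gamma> i))" for i :: nat
    have s0: "s > 0" using s by (simp add: B_def)
    have vp: "valid_path (?\<Gamma> j)" if "j \<in> {1..n}" for j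
      by (rule valid_path_compose_holomorphic[OF _ holomorphic_branch[OF that]]) (use r in auto)
    have pim: "path_image (?\<Gamma> j) \<subseteq> - holes" if "j \<in> {1..n}" for j
      using branch_in_holes_iff[OF that] r by (auto simp: path_image_compose)
    have "(\<Sum>i\<in>insert 0 {1..n}. contour_integral (\<gamma> i) G) = 0"
    proof (rule Cauchy_theorem_cycle[OF open_compl_holes connected_compl_holes _ hol])
      show "valid_path (\<gamma> i)" if "i \<in> insert 0 {1..n}" for i
        using that vp by (auto simp: \<gamma>_def)
      show "pathfinish (\<gamma> i) = pathstart (\<gamma> i)" if "i \<in> insert 0 {1..n}" for i
        by (auto simp: \<gamma>_def pathstart_compose pathfinish_compose)
      show "path_image (\<gamma> i) \<subseteq> - holes" if "i \<in> insert 0 {1..n}" for i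
        using that pim[of i] B s s0 by (auto simp: \<gamma>_def)
    next
      fix z assume "z \<notin> - holes"
      then obtain i where z: "z \<in> hole i" "i \<in> {1..n}" by (auto simp: holes_def)
      have "winding_number (circlepath 0 s) z = 1"
        by (rule winding_number_circlepath) (use B0[of z] s \<open>z \<notin> - holes\<close> in \<open>auto simp: B_def\<close>)
      moreover have "(\<Sum>j=1..n. winding_number (\<gamma> j) z) = (\<Sum>j=1..n. - (if i = j then 1 else 0))"
      proof (rule sum.cong)
        fix j assume j: "j \<in> {1..n}"
        have "z \<notin> path_image (?\<Gamma> j)" using pim[OF j] \<open>z \<notin> - holes\<close> by auto
        then show "winding_number (\<gamma> j) z = - (if i = j then 1 else 0)"
          using winding_branch[OF j r z] j vp[OF j]
          by (auto simp: \<gamma>_def winding_number_reversepath valid_path_imp_path)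
      qed simp
      ultimately show "(\<Sum>i\<in>insert 0 {1..n}. winding_number (\<gamma> i) z) = 0"
        using z(2) by (simp add: \<gamma>_def sum_negf)
    qed simp
    moreover have "(\<Sum>j=1..n. contour_integral (\<gamma> j) G) = - T"
      unfolding T_def sum_negf[symmetric]
      by (rule sum.cong) (use vp in \<open>auto simp: \<gamma>_def contour_integral_reversepath\<close>)
    ultimately show ?thesis by (simp add: \<gamma>_def)
  qed
  \<comment> \<open>The integral over large circles does not depend on the radius, so approximation
    to every accuracy is equality.\<close>
  have "norm (T - 2 * pi * \<i> * c) < d" if "d > 0" for d
    using contour_integral_circlepath_at_infinity[OF contG lim that] eq by metis
  then have "T = 2 * pi * \<i> * c"
    by (metis eq_iff_diff_eq_0 less_irrefl zero_less_norm_iff)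
  moreover have "T = (\<Sum>j=1..n. 2 * pi * \<i> * cint r (\<lambda>u. A j / q j u u * G (Z j u)))"
    unfolding T_def by (rule sum.cong) (use contour_integral_branch r in auto)
  ultimately show ?thesis by (simp flip: sum_distrib_left)
qed

end

section \<open>Extremality from a Szego kernel\<close>

lemma square_pos_imp_real:
  fixes z :: complex
  assumes "Im (z\<^sup>2) = 0" "Re (z\<^sup>2) > 0"
  shows "Im z = 0"
proof (rule ccontr)
  assume "Im z \<noteq> 0"
  moreover have "Im (z\<^sup>2) = 2 * Re z * Im z" by (simp add: power2_eq_square)
  ultimately have "Re z = 0" using assms(1) by simp
  then have "Re (z\<^sup>2) = - (Im z)\<^sup>2" by (simp add: power2_eq_square)
  then show False using assms(2) by (smt (verit) zero_le_power2)
qed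

text \<open>\<open>F_eq\<close> makes \<open>e j w * S (Z j w)\<close> an explicit combination of
  \<open>F j\<close> and its reflection: the Cauchy kernels of the other holes enter unchanged,
  while the singular part \<open>1 / (u - w)\<close> of the own one is removed. Removing it leaves a
  constant, and \<open>F_real\<close> ensures that this constant does not spoil reality on the
  circle.\<close>

locale szego_solution = separated_poles +
  fixes F :: "nat \<Rightarrow> complex \<Rightarrow> complex"
  assumes F_hol: "\<And>j. j \<in> {1..n} \<Longrightarrow> F j holomorphic_on ball 0 (3 / 2)"
    and F_eq: "\<And>j w. j \<in> {1..n} \<Longrightarrow> 1 < norm w \<Longrightarrow> norm w < 3 / 2 \<Longrightarrow>
      F j w = e j w
        - (\<Sum>i\<in>{1..n} - {j}. norm (A i) * cint 1 (\<lambda>u. cnj (F i u) * (e i u * e j w / (Z i u - Z j w))))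
        - norm (A j) / A j * cint 1 (\<lambda>u. cnj (F j u) * ((e j u * e j w * q j u w - 1) / (u - w)))"
    and F_real: "\<And>j. j \<in> {1..n} \<Longrightarrow> Im (A j * (F j 0)\<^sup>2) = 0"
      "\<And>j. j \<in> {1..n} \<Longrightarrow> Re (A j * (F j 0)\<^sup>2) > 0"
begin

text \<open>
  \<open>S\<close> is determined by \<open>e j w * S (Z j w) = \<tau> j w\<close> near the unit circle.  On the circle and with
  \<open>b\<^sup>2 = A j\<close>, \<open>b * \<tau> j w\<close> is \<open>2 * Re (b * F j w)\<close> minus the conjugate of \<open>b * F j 0\<close>, so \<open>F_real\<close> says
  exactly that it is real.
\<close>
definition S :: "complex \<Rightarrow> complex" where
  "S z = 1 - (\<Sum>i=1..n. norm (A i) * cint 1 (\<lambda>u. cnj (F i u) * (e i u / (Z i u - z))))"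

definition \<tau> :: "nat \<Rightarrow> complex \<Rightarrow> complex" where
  "\<tau> j w = F j w + norm (A j) / A j * (cnj (F j (1 / cnj w)) - cnj (F j 0))"

lemma continuous_F: "j \<in> {1..n} \<Longrightarrow> X \<subseteq> ball 0 (3 / 2) \<Longrightarrow> continuous_on X (F j)"
  by (rule continuous_on_subset[OF holomorphic_on_imp_continuous_on[OF F_hol]])

lemma continuous_root: "j \<in> {1..n} \<Longrightarrow> X \<subseteq> ball 0 2 \<Longrightarrow> continuous_on X (e j)"
  by (rule continuous_on_subset[OF holomorphic_on_imp_continuous_on[OF holomorphic_root]])

lemma sphere_ball: "sphere (0::complex) 1 \<subseteq> ball 0 (3/2)" "sphere (0::complex) 1 \<subseteq> ball 0 2"
    "sphere (0::complex) 1 \<subseteq> cball 0 2"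
  by auto

lemma unit_branch_in_holes: "j \<in> {1..n} \<Longrightarrow> norm u = 1 \<Longrightarrow> Z j u \<in> holes"
  by (subst branch_in_holes_iff) auto

lemma S_holomorphic: "S holomorphic_on - holes"
  unfolding S_def
proof (intro holomorphic_intros)
  fix i assume i: "i \<in> {1..n}"
  have c: "continuous_on ((- holes) \<times> sphere 0 1) (\<lambda>x. f (snd x))"
    if "continuous_on (sphere 0 1) f" for f :: "complex \<Rightarrow> complex"
    by (rule continuous_on_compose2[OF that]) (auto intro!: continuous_intros)
  show "(\<lambda>z. cint 1 (\<lambda>u. cnj (F i u) * (e i u / (Z i u - z)))) holomorphic_on - holes"
  proof (rule holomorphic_cint_param[OF open_compl_holes])
    show "continuous_on ((- holes) \<times> sphere 0 1) (\<lambda>(w, u). cnj (F i u) * (e i u / (Z i u - w)))"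
      unfolding case_prod_unfold
      by (intro continuous_intros c continuous_F[OF i] continuous_root[OF i]
            continuous_on_subset[OF continuous_branch[OF i]] sphere_ball)
         (use unit_branch_in_holes[OF i] in fastforce)
    show "(\<lambda>w. cnj (F i u) * (e i u / (Z i u - w))) holomorphic_on - holes" if "norm u = 1" for u
      by (intro holomorphic_intros) (use unit_branch_in_holes[OF i that] in auto)
  qed simp
qed

lemma S_at_infinity: "(S \<longlongrightarrow> 1) at_infinity"
proof -
  obtain B where B: "\<And>z. z \<in> holes \<Longrightarrow> norm z \<le> B"
    using compact_imp_bounded[OF compact_holes] by (auto simp: bounded_iff)
  have "((\<lambda>z. cint 1 (\<lambda>u. cnj (F i u) * (e i u / (Z i u - z)))) \<longlongrightarrow> 0) at_infinity"
    if i: "i \<in> {1..n}" for i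
  proof -
    have cont: "continuous_on (sphere 0 1) (\<lambda>u. cnj (F i u) * e i u)"
      by (intro continuous_intros continuous_F[OF i] continuous_root[OF i] sphere_ball)
    have "compact ((\<lambda>u. cnj (F i u) * e i u) ` sphere 0 1)"
      by (rule compact_continuous_image[OF cont]) simp
    then obtain C where C: "\<And>u. norm u = 1 \<Longrightarrow> norm (cnj (F i u) * e i u) \<le> C"
      using compact_imp_bounded by (force simp: bounded_iff)
    have "\<forall>\<^sub>F z in at_infinity. norm (cint 1 (\<lambda>u. cnj (F i u) * (e i u / (Z i u - z)))) \<le> C / (norm z - B)"
    proof -
      have "\<forall>\<^sub>F z::complex in at_infinity. norm z \<ge> B + 1"
        unfolding eventually_at_infinity by blast
      then show ?thesis
      proof eventually_elim
        case (elim z)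
        have "norm (cint 1 (\<lambda>u. cnj (F i u) * (e i u / (Z i u - z)))) \<le> 1 * (C / (norm z - B))"
        proof (rule norm_cint_le)
          have "Z i u - z \<noteq> 0" if "norm u = 1" for u
            using B[OF unit_branch_in_holes[OF i that]] elim by auto
          then show "continuous_on (sphere 0 1) (\<lambda>u. cnj (F i u) * (e i u / (Z i u - z)))"
            by (intro continuous_intros continuous_F[OF i] continuous_root[OF i]
              continuous_on_subset[OF continuous_branch[OF i]] sphere_ball) auto
        next
          fix u :: complex assume u: "norm u = 1"
          have "norm z - B \<le> norm z - norm (Z i u)" using B[OF unit_branch_in_holes[OF i u]] by simp
          also have "\<dots> \<le> norm (Z i u - z)" by (metis norm_minus_commute norm_triangle_ineq2)
          finally have "norm z - B \<le> norm (Z i u - z)" .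
          then have "norm (cnj (F i u) * e i u) / norm (Z i u - z) \<le> C / (norm z - B)"
            by (intro frac_le C[OF u]) (use elim C[OF u] norm_ge_zero[of "cnj (F i u) * e i u"] in linarith)+
          then show "norm (cnj (F i u) * (e i u / (Z i u - z))) \<le> C / (norm z - B)"
            by (simp add: norm_mult norm_divide)
        qed simp
        then show ?case by simp
      qed
    qed
    moreover have "((\<lambda>z::complex. C / (norm z - B)) \<longlongrightarrow> 0) at_infinity"
    proof (rule real_tendsto_divide_at_top[OF tendsto_const])
      show "LIM z at_infinity. norm (z::complex) - B :> at_top"
        using filterlim_tendsto_add_at_top[OF tendsto_const[of "- B"] filterlim_norm_at_top]
        by (simp add: add.commute)
    qed
    ultimately show ?thesis by (rule Lim_null_comparison)
  qed
  then have "((\<lambda>z. 1 - (\<Sum>i=1..n. norm (A i) * cint 1 (\<lambda>u. cnj (F i u) * (e i u / (Z i u - z)))))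
      \<longlongrightarrow> 1 - (\<Sum>i=1..n. of_real (norm (A i)) * (0::complex))) at_infinity"
    by (intro tendsto_intros) auto
  then show ?thesis by (simp add: S_def[abs_def])
qed

text \<open>By \<open>branch_diff\<close> the own kernel is
  \<open>e j u * e j w * q j u w / (A j * (u - w))\<close>. Splitting off
  \<open>1 / (A j * (u - w))\<close> leaves the kernel of \<open>F_eq\<close>; the integral of the
  part split off is given by \<open>cint_cnj_Cauchy_outside\<close> and produces the reflected term
  of \<open>\<tau>\<close>.\<close>

lemma S_branch:
  assumes j: "j \<in> {1..n}" and w: "1 < norm w" "norm w < 3 / 2"
  shows "e j w * S (Z j w) = \<tau> j w"
proof -
  let ?J = "\<lambda>i. cint 1 (\<lambda>u. cnj (F i u) * (e i u * e j w / (Z i u - Z j w)))"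
  let ?K = "cint 1 (\<lambda>u. cnj (F j u) * ((e j u * e j w * q j u w - 1) / (u - w)))"
  have w2: "norm w \<le> 2" using w by simp
  have cF: "continuous_on (sphere 0 1) (\<lambda>u. cnj (F j u))"
    by (intro continuous_intros continuous_F[OF j] sphere_ball)
  have uw: "u - w \<noteq> 0" if "u \<in> sphere 0 1" for u using that w by auto
  have "continuous_on (sphere 0 1) (\<lambda>u. (\<lambda>(u, w). q j u w) (u, w))"
    by (rule continuous_on_compose2[OF continuous_quot[OF j]]) (use w2 in \<open>auto intro!: continuous_intros\<close>)
  then have cq: "continuous_on (sphere 0 1) (\<lambda>u. q j u w)" by simp
  have "?J j = cint 1 (\<lambda>u. 1 / A j * (cnj (F j u) * ((e j u * e j w * q j u w - 1) / (u - w)) + cnj (F j u) / (u - w)))"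
  proof (rule cint_cong)
    fix u :: complex assume u: "norm u = 1"
    have d: "(Z j u - Z j w) * q j u w = A j * (u - w)"
      by (rule branch_diff[OF j]) (use u w in auto)
    have "u - w \<noteq> 0" using u w by auto
    moreover have "q j u w \<noteq> 0" by (rule quot_ge(2)[OF j]) (use u w in auto)
    moreover have "Z j u - Z j w \<noteq> 0" using d \<open>u - w \<noteq> 0\<close> A_nz[OF j] by auto
    ultimately have "1 / (Z j u - Z j w) = q j u w / (A j * (u - w))"
      using d A_nz[OF j] by (simp add: frac_eq_eq mult.commute)
    then have "cnj (F j u) * (e j u * e j w / (Z j u - Z j w))
        = cnj (F j u) * (e j u * e j w * q j u w / (A j * (u - w)))"
      by (metis (no_types, lifting) mult.right_neutral times_divide_eq_right)
    also have "\<dots> = 1 / A j * (cnj (F j u) * ((e j u * e j w * q j u w - 1) / (u - w)) + cnj (F j u) / (u - w))"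
      using \<open>u - w \<noteq> 0\<close> A_nz[OF j] by (simp add: divide_simps) (simp add: algebra_simps)
    finally show "cnj (F j u) * (e j u * e j w / (Z j u - Z j w))
      = 1 / A j * (cnj (F j u) * ((e j u * e j w * q j u w - 1) / (u - w)) + cnj (F j u) / (u - w))" .
  qed simp
  also have "\<dots> = 1 / A j * (?K + cint 1 (\<lambda>u. cnj (F j u) / (u - w)))"
    unfolding cint_cmult
    by (subst cint_add) (use uw in \<open>auto intro!: continuous_intros cF cq continuous_root[OF j] sphere_ball\<close>)
  also have "cint 1 (\<lambda>u. cnj (F j u) / (u - w)) = cnj (F j 0) - cnj (F j (1 / cnj w))"
    by (rule cint_cnj_Cauchy_outside[OF F_hol[OF j]]) (use w in auto)
  finally have Jj: "?J j = 1 / A j * (?K + (cnj (F j 0) - cnj (F j (1 / cnj w))))" .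
  have "e j w * S (Z j w) = e j w - (\<Sum>i=1..n. norm (A i) * ?J i)"
  proof -
    have "e j w * (norm (A i) * cint 1 (\<lambda>u. cnj (F i u) * (e i u / (Z i u - Z j w)))) = norm (A i) * ?J i" for i
    proof -
      have "?J i = cint 1 (\<lambda>u. e j w * (cnj (F i u) * (e i u / (Z i u - Z j w))))"
        by (rule cint_cong) simp_all
      then show ?thesis unfolding cint_cmult by simp
    qed
    then show ?thesis by (simp only: S_def right_diff_distrib mult_1_right sum_distrib_left)
  qed
  also have "(\<Sum>i=1..n. norm (A i) * ?J i) = norm (A j) * ?J j + (\<Sum>i\<in>{1..n} - {j}. norm (A i) * ?J i)"
    using j by (simp add: sum.remove)
  also have "e j w - (norm (A j) * ?J j + (\<Sum>i\<in>{1..n} - {j}. norm (A i) * ?J i))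
      = F j w + norm (A j) / A j * ?K - norm (A j) * ?J j"
    unfolding F_eq[OF j w] by simp
  also have "\<dots> = \<tau> j w"
    unfolding Jj \<tau>_def by (simp add: algebra_simps)
  finally show ?thesis .
qed

text \<open>Since \<open>S\<close> tends to 1, the coefficient of \<open>1 / z\<close> at infinity
  of \<open>g\<close> times \<open>S^2\<close> is the derivative of \<open>g\<close>. On the curves
  the derivative of the branch is \<open>A j * (e j u)^2\<close>, and its two factors
  \<open>e j u\<close> combine with \<open>S\<close> to \<open>\<tau> j u\<close>.\<close>

lemma deriv_infinity_formula:
  assumes g: "sphere_holomorphic_on g (R -` unit_disk)" "g None = 0" and r: "1 < r" "r < 3 / 2"
  shows "deriv_infinity g = (\<Sum>j=1..n. cint r (\<lambda>u. A j * (\<tau> j u)\<^sup>2 * g (Some (Z j u))))"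
proof -
  have inX: "None \<in> R -` unit_disk" by (simp add: R_vimage)
  have vim: "Some -` (R -` unit_disk) = - holes" by (auto simp: R_vimage)
  have hg: "(\<lambda>z. g (Some z)) holomorphic_on - holes"
    using g(1) by (simp add: sphere_holomorphic_on_def vim)
  have "((\<lambda>z. z * (g (Some z) - g None) * (S z)\<^sup>2) \<longlongrightarrow> deriv (\<lambda>w. g (chart_infinity w)) 0 * 1\<^sup>2) at_infinity"
    by (intro tendsto_mult tendsto_power S_at_infinity tendsto_deriv_infinity[OF openin_R_vimage inX g(1)])
  then have lim: "((\<lambda>z. z * (g (Some z) * (S z)\<^sup>2)) \<longlongrightarrow> deriv_infinity g) at_infinity"
    using deriv_infinity_eq[OF openin_R_vimage inX g(1)] by (simp add: g(2) mult.assoc)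
  have "deriv_infinity g = (\<Sum>j=1..n. cint r (\<lambda>u. A j / q j u u * (g (Some (Z j u)) * (S (Z j u))\<^sup>2)))"
    by (rule residue_at_infinity[OF _ lim])
       (use r in \<open>auto intro!: holomorphic_intros hg S_holomorphic\<close>)
  also have "\<dots> = (\<Sum>j=1..n. cint r (\<lambda>u. A j * (\<tau> j u)\<^sup>2 * g (Some (Z j u))))"
  proof (intro sum.cong cint_cong)
    fix j u assume j: "j \<in> {1..n}" and u: "norm (u::complex) = r"
    have "1 / q j u u = (e j u)\<^sup>2"
      using root_square[OF j, of u] u r by (simp add: field_simps quot_ge(2)[OF j])
    then have "A j / q j u u = A j * (e j u)\<^sup>2" by (metis mult.right_neutral times_divide_eq_right)
    moreover have "(\<tau> j u)\<^sup>2 = (e j u)\<^sup>2 * (S (Z j u))\<^sup>2"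
      using S_branch[OF j, of u] u r by (metis power_mult_distrib)
    ultimately show "A j / q j u u * (g (Some (Z j u)) * (S (Z j u))\<^sup>2) = A j * (\<tau> j u)\<^sup>2 * g (Some (Z j u))"
      by simp
  qed (use r in auto)
  finally show ?thesis .
qed

lemma continuous_\<tau>:
  assumes j: "j \<in> {1..n}"
  shows "continuous_on {w. 1 \<le> norm w \<and> norm w \<le> 5 / 4} (\<tau> j)"
proof -
  let ?X = "{w::complex. 1 \<le> norm w \<and> norm w \<le> 5 / 4}"
  have "continuous_on ?X (\<lambda>w. F j (1 / cnj w))"
  proof (rule continuous_on_compose2[OF continuous_F[OF j order_refl]])
    show "continuous_on ?X (\<lambda>w. 1 / cnj w)" by (intro continuous_intros) auto
    show "(\<lambda>w. 1 / cnj w) ` ?X \<subseteq> ball 0 (3 / 2)"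
    proof clarify
      fix w :: complex assume "1 \<le> norm w"
      then have "1 / norm w \<le> 1" by (simp add: divide_le_eq)
      then show "1 / cnj w \<in> ball 0 (3 / 2)" by (simp add: norm_divide)
    qed
  qed
  then show ?thesis
    unfolding \<tau>_def by (intro continuous_intros continuous_F[OF j]) auto
qed

lemma \<tau>_unit:
  assumes j: "j \<in> {1..n}" and w: "norm w = 1"
  shows "A j * (\<tau> j w)\<^sup>2 = of_real (norm (A j) * (norm (\<tau> j w))\<^sup>2)"
proof -
  define b where "b = csqrt (A j)"
  have b2: "b\<^sup>2 = A j" by (simp add: b_def)
  then have b0: "b \<noteq> 0" using A_nz[OF j] by auto
  have nb: "complex_of_real (norm (A j)) = b * cnj b"
    by (simp add: b2[symmetric] norm_power complex_norm_square[symmetric])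
  have wc: "1 / cnj w = w"
  proof -
    have "w * cnj w = 1" using w by (simp add: complex_norm_square[symmetric])
    then show ?thesis using w by (metis divide_eq_eq mult_zero_left zero_neq_one mult_zero_right)
  qed
  have "Im (b * F j 0) = 0"
    by (rule square_pos_imp_real) (use F_real[OF j] in \<open>simp_all add: power_mult_distrib b2\<close>)
  moreover have "b * \<tau> j w = b * F j w + cnj (b * F j w) - cnj (b * F j 0)"
  proof -
    have "norm (A j) / A j = cnj b / b"
    proof -
      have "A j = b * b" by (simp add: b2[symmetric] power2_eq_square)
      then show ?thesis unfolding nb using b0 by simp
    qed
    then have "b * (norm (A j) / A j) = cnj b" using b0 by simp
    moreover have "b * \<tau> j w = b * F j w + (b * (norm (A j) / A j)) * (cnj (F j w) - cnj (F j 0))"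
      unfolding \<tau>_def wc by (simp only: distrib_left mult.assoc)
    ultimately show ?thesis by (simp add: right_diff_distrib)
  qed
  ultimately have "Im (b * \<tau> j w) = 0" by simp
  then obtain x where x: "b * \<tau> j w = of_real x" by (metis complex_is_Real_iff Reals_cases)
  have "A j * (\<tau> j w)\<^sup>2 = (b * \<tau> j w)\<^sup>2" by (simp add: power_mult_distrib b2)
  moreover have "norm (A j) * (norm (\<tau> j w))\<^sup>2 = (norm (b * \<tau> j w))\<^sup>2"
    by (simp add: norm_mult power_mult_distrib b2[symmetric] norm_power)
  ultimately show ?thesis by (simp add: x)
qed

text \<open>At \<open>r = 1\<close> this is the total mass of the positive boundary measure. The
  radius is a variable because \<open>deriv_infinity_formula\<close> lives on curves outside the
  holes, so that \<open>r = 1\<close> is reached as a limit.\<close>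

definition \<Lambda> :: "real \<Rightarrow> real" where
  "\<Lambda> r = (\<Sum>j=1..n. integral {0..1} (\<lambda>t. norm (A j) * (norm (\<tau> j (r * cis (2 * pi * t))))\<^sup>2))"

lemma continuous_\<tau>_polar:
  assumes j: "j \<in> {1..n}"
  shows "continuous_on ({1..5/4} \<times> {0..1}) (\<lambda>x::real \<times> real. \<tau> j (of_real (fst x) * cis (2 * pi * snd x)))"
  by (rule continuous_on_compose2[OF continuous_\<tau>[OF j]])
     (auto intro!: continuous_intros simp: norm_mult)

lemma continuous_\<Lambda>: "continuous_on {1..5/4} \<Lambda>"
  unfolding \<Lambda>_def
proof (intro continuous_on_sum)
  fix j assume j: "j \<in> {1..n}"
  have "continuous_on ({1..5/4} \<times> cbox 0 1)
      (\<lambda>(r, t). norm (A j) * (norm (\<tau> j (of_real r * cis (2 * pi * t))))\<^sup>2)"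
    using continuous_\<tau>_polar[OF j] by (auto simp: case_prod_unfold cbox_interval intro!: continuous_intros)
  from integral_continuous_on_param[OF this]
  show "continuous_on {1..5/4} (\<lambda>r. integral {0..1} (\<lambda>t. norm (A j) * (norm (\<tau> j (of_real r * cis (2 * pi * t))))\<^sup>2))"
    by (simp only: cbox_interval)
qed

text \<open>A competitor \<open>g\<close> may have no boundary values. The estimate by
  \<open>r * \<Lambda> r\<close> uses \<open>norm g \<le> 1\<close> on curves inside the domain, and
  continuity of \<open>\<Lambda>\<close> gives \<open>r = 1\<close>.\<close>

lemma ahlfors_bound:
  assumes g: "ahlfors_admissible (R -` unit_disk) g"
  shows "norm (deriv_infinity g) \<le> \<Lambda> 1"
proof -
  have le: "norm (deriv_infinity g) \<le> r * \<Lambda> r" if r: "1 < r" "r < 5 / 4" for r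
  proof -
    have "norm (cint r (\<lambda>u. A j * (\<tau> j u)\<^sup>2 * g (Some (Z j u))))
        \<le> r * integral {0..1} (\<lambda>t. norm (A j) * (norm (\<tau> j (r * cis (2 * pi * t))))\<^sup>2)"
      if j: "j \<in> {1..n}" for j
    proof -
      let ?k = "\<lambda>t. norm (A j) * (norm (\<tau> j (r * cis (2 * pi * t))))\<^sup>2"
      have hg: "(\<lambda>z. g (Some z)) holomorphic_on - holes"
      proof -
        have "Some -` (R -` unit_disk) = - holes" by (auto simp: R_vimage)
        then show ?thesis using g by (simp add: ahlfors_admissible_def sphere_holomorphic_on_def)
      qed
      have c\<tau>: "continuous_on (sphere 0 r) (\<tau> j)"
        by (rule continuous_on_subset[OF continuous_\<tau>[OF j]]) (use r in auto)
      have cg: "continuous_on (sphere 0 r) (\<lambda>u. g (Some (Z j u)))"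
        by (rule continuous_on_compose2[OF holomorphic_on_imp_continuous_on[OF hg]
              continuous_on_subset[OF continuous_branch[OF j]]])
           (use r branch_in_holes_iff[OF j] in auto)
      have cont: "continuous_on (sphere 0 r) (\<lambda>u. A j * (\<tau> j u)\<^sup>2 * g (Some (Z j u)))"
        by (intro continuous_intros c\<tau> cg)
      have "norm (cint r (\<lambda>u. A j * (\<tau> j u)\<^sup>2 * g (Some (Z j u)))) \<le> integral {0..1} (\<lambda>t. r * ?k t)"
        unfolding cint_def
      proof (rule integral_norm_bound_integral)
        show "(\<lambda>t. A j * (\<tau> j (r * cis (2 * pi * t)))\<^sup>2 * g (Some (Z j (r * cis (2 * pi * t)))) * (r * cis (2 * pi * t)))
            integrable_on {0..1}"
          by (rule cint_integrable[OF cont]) (use r in simp)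
        have "continuous_on {0..1} (\<lambda>t::real. \<tau> j (r * cis (2 * pi * t)))"
          by (rule continuous_on_compose2[OF c\<tau>]) (use r in \<open>auto intro!: continuous_intros simp: norm_mult\<close>)
        then show "(\<lambda>t. r * ?k t) integrable_on {0..1}"
          by (intro integrable_continuous_interval continuous_intros)
      next
        fix t :: real
        let ?u = "r * cis (2 * pi * t)"
        have nu: "norm ?u = r" using r by (simp add: norm_mult)
        have "Z j ?u \<notin> holes" using branch_in_holes_iff[OF j, of ?u] nu r by simp
        then have "Some (Z j ?u) \<in> R -` unit_disk" by (simp add: R_vimage)
        then have "norm (g (Some (Z j ?u))) \<le> 1" using g by (force simp: ahlfors_admissible_def)
        then have "norm (A j) * (norm (\<tau> j ?u))\<^sup>2 * norm (g (Some (Z j ?u))) * r \<le> norm (A j) * (norm (\<tau> j ?u))\<^sup>2 * 1 * r"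
          by (intro mult_right_mono mult_left_mono) (use r in auto)
        then show "norm (A j * (\<tau> j ?u)\<^sup>2 * g (Some (Z j ?u)) * ?u) \<le> r * ?k t"
          unfolding norm_mult[of _ ?u] nu by (simp add: norm_mult norm_power mult_ac)
      qed
      also have "\<dots> = r * integral {0..1} ?k" by simp
      finally show ?thesis .
    qed
    then have "norm (\<Sum>j=1..n. cint r (\<lambda>u. A j * (\<tau> j u)\<^sup>2 * g (Some (Z j u)))) \<le> r * \<Lambda> r"
      unfolding \<Lambda>_def sum_distrib_left by (rule sum_norm_le)
    then show ?thesis
      using deriv_infinity_formula[of g r] g r by (simp add: ahlfors_admissible_def)
  qed
  have "continuous_on {1..5/4} (\<lambda>r. r * \<Lambda> r)" by (intro continuous_intros continuous_\<Lambda>)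
  from continuous_on_Icc_at_rightD[OF this]
  have "((\<lambda>r. r * \<Lambda> r) \<longlongrightarrow> 1 * \<Lambda> 1) (at_right 1)" by simp
  moreover have "\<forall>\<^sub>F r in at_right 1. norm (deriv_infinity g) \<le> r * \<Lambda> r"
    using eventually_at_right_real[of 1 "5/4::real"] by (auto elim!: eventually_mono intro: le)
  ultimately have "norm (deriv_infinity g) \<le> 1 * \<Lambda> 1"
    by (rule tendsto_lowerbound) simp
  then show ?thesis by simp
qed

lemma the_R_admissible: "ahlfors_admissible (R -` unit_disk) (\<lambda>x. the (R x))"
proof -
  let ?f = "\<lambda>x. the (R x)"
  have None0: "R None = Some 0" by (rule pf_map_None[OF n_pos])
  have ph: "z \<notin> p ` {1..n}" if "z \<notin> holes" for z
    using that pf_map_pole[of z p n A] R_vimage_Some[of z] by (auto simp: unit_disk_def)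
  have Rz: "?f (Some z) = (\<Sum>k=1..n. A k / (z - p k))" if "z \<notin> holes" for z
    using pf_map_Some[OF ph[OF that]] by simp
  have vim: "Some -` (R -` unit_disk) = - holes" by (auto simp: R_vimage)
  have "(\<lambda>z. \<Sum>k=1..n. A k / (z - p k)) holomorphic_on - holes"
    by (intro holomorphic_intros) (use ph in fastforce)
  then have 1: "(\<lambda>z. ?f (Some z)) holomorphic_on - holes"
    by (rule holomorphic_transform) (simp add: Rz)
  have ne: "1 - p k * w \<noteq> 0" if w: "chart_infinity w \<in> R -` unit_disk" and k: "k \<in> {1..n}" for w k
  proof (cases "w = 0")
    case False
    then have "1 / w \<notin> holes" using w by (auto simp: chart_infinity_def R_vimage)
    then have "1 / w \<noteq> p k" using ph[of "1 / w"] k by auto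
    then show ?thesis using False by (auto simp: field_simps)
  qed simp
  have "(\<lambda>w. \<Sum>k=1..n. A k * w / (1 - p k * w)) holomorphic_on (chart_infinity -` (R -` unit_disk))"
    by (intro holomorphic_intros) (use ne in auto)
  then have 2: "(\<lambda>w. ?f (chart_infinity w)) holomorphic_on (chart_infinity -` (R -` unit_disk))"
  proof (rule holomorphic_transform)
    fix w assume w: "w \<in> chart_infinity -` (R -` unit_disk)"
    show "(\<Sum>k=1..n. A k * w / (1 - p k * w)) = ?f (chart_infinity w)"
    proof (cases "w = 0")
      case True
      then show ?thesis by (simp add: chart_infinity_def None0)
    next
      case False
      then have "1 / w \<notin> holes" using w by (auto simp: chart_infinity_def R_vimage)
      from Rz[OF this] have "?f (chart_infinity w) = (\<Sum>k=1..n. A k / (1 / w - p k))"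
        using False by (simp add: chart_infinity_def)
      also have "\<dots> = (\<Sum>k=1..n. A k * w / (1 - p k * w))"
        by (rule sum.cong) (use False in \<open>auto simp: divide_simps\<close>)
      finally show ?thesis by simp
    qed
  qed
  have 3: "?f ` (R -` unit_disk) \<subseteq> ball 0 1" by (auto simp: unit_disk_def)
  show ?thesis
    unfolding ahlfors_admissible_def sphere_holomorphic_on_def vim
    using 1 2 3 None0 by auto
qed

text \<open>On the curves \<open>R\<close> is \<open>1 / u\<close>, which cancels the factor
  \<open>u\<close> in \<open>cint\<close>; at radius 1 the remaining integrand is nonnegative by
  \<open>\<tau>_unit\<close>. Thus \<open>R\<close> attains the bound of
  \<open>ahlfors_bound\<close>.\<close>

lemma deriv_infinity_R: "deriv_infinity (\<lambda>x. the (R x)) = \<Lambda> 1"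
proof -
  let ?f = "\<lambda>x. the (R x)"
  let ?L = "\<lambda>r::real. \<Sum>j=1..n. integral {0..1} (\<lambda>t. A j * (\<tau> j (r * cis (2 * pi * t)))\<^sup>2)"
  have eq: "deriv_infinity ?f = ?L r" if r: "1 < r" "r < 5 / 4" for r
  proof -
    have "deriv_infinity ?f = (\<Sum>j=1..n. cint r (\<lambda>u. A j * (\<tau> j u)\<^sup>2 * ?f (Some (Z j u))))"
      by (rule deriv_infinity_formula)
         (use the_R_admissible r in \<open>auto simp: ahlfors_admissible_def\<close>)
    also have "\<dots> = ?L r"
      unfolding cint_def
    proof (intro sum.cong integral_cong)
      fix j and t :: real assume j: "j \<in> {1..n}"
      let ?u = "r * cis (2 * pi * t)"
      have "norm ?u \<le> 2" "?u \<noteq> 0" using r by (auto simp: norm_mult)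
      then show "A j * (\<tau> j ?u)\<^sup>2 * ?f (Some (Z j ?u)) * ?u = A j * (\<tau> j ?u)\<^sup>2"
        using R_branch[OF j, of ?u] by simp
    qed auto
    finally show ?thesis .
  qed
  have "continuous_on {1..5/4} ?L"
  proof (intro continuous_on_sum)
    fix j assume j: "j \<in> {1..n}"
    have "continuous_on ({1..5/4} \<times> cbox 0 1) (\<lambda>(r, t). A j * (\<tau> j (of_real r * cis (2 * pi * t)))\<^sup>2)"
      using continuous_\<tau>_polar[OF j] by (auto simp: case_prod_unfold cbox_interval intro!: continuous_intros)
    from integral_continuous_on_param[OF this]
    show "continuous_on {1..5/4} (\<lambda>r. integral {0..1} (\<lambda>t. A j * (\<tau> j (of_real r * cis (2 * pi * t)))\<^sup>2))"
      by (simp only: cbox_interval)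
  qed
  then have "(?L \<longlongrightarrow> ?L 1) (at_right 1)"
    by (rule continuous_on_Icc_at_rightD) simp
  moreover have "(?L \<longlongrightarrow> deriv_infinity ?f) (at_right 1)"
  proof (rule Lim_transform_eventually[OF tendsto_const])
    show "\<forall>\<^sub>F r in at_right 1. deriv_infinity ?f = ?L r"
    proof (rule eventually_mono)
      show "\<forall>\<^sub>F r in at_right 1. r \<in> {1<..<5/4::real}" by (rule eventually_at_right_real) simp
      show "deriv_infinity ?f = ?L r" if "r \<in> {1<..<5/4}" for r by (rule eq) (use that in auto)
    qed
  qed
  ultimately have "deriv_infinity ?f = ?L 1"
    using tendsto_unique trivial_limit_at_right_real by blast
  also have "\<dots> = (\<Sum>j=1..n. of_real (integral {0..1} (\<lambda>t. norm (A j) * (norm (\<tau> j (1 * cis (2 * pi * t))))\<^sup>2)))"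
  proof (rule sum.cong)
    fix j assume j: "j \<in> {1..n}"
    let ?k = "\<lambda>t. norm (A j) * (norm (\<tau> j (1 * cis (2 * pi * t))))\<^sup>2"
    have "continuous_on {0..1} (\<lambda>t::real. \<tau> j (1 * cis (2 * pi * t)))"
      by (rule continuous_on_compose2[OF continuous_\<tau>[OF j]]) (auto intro!: continuous_intros)
    then have "?k integrable_on {0..1}"
      by (intro integrable_continuous_interval continuous_intros)
    from integral_linear[OF this, of complex_of_real, OF bounded_linear_of_real]
    have *: "complex_of_real (integral {0..1} ?k) = integral {0..1} (\<lambda>t. of_real (?k t))"
      by (simp only: o_def)
    show "integral {0..1} (\<lambda>t. A j * (\<tau> j (of_real 1 * cis (2 * pi * t)))\<^sup>2) = of_real (integral {0..1} ?k)"
      unfolding * by (rule integral_cong) (simp add: \<tau>_unit[OF j])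
  qed simp
  also have "\<dots> = \<Lambda> 1" by (simp add: \<Lambda>_def)
  finally show ?thesis .
qed

theorem ahlfors_R: "rational_ahlfors_function n R"
proof -
  let ?f = "\<lambda>x. the (R x)"
  have max: "Re (deriv_infinity g) \<le> Re (deriv_infinity ?f)"
    if "ahlfors_admissible (R -` unit_disk) g" for g
    using ahlfors_bound[OF that] complex_Re_le_cmod[of "deriv_infinity g"] deriv_infinity_R by simp
  have inX: "None \<in> R -` unit_disk" by (simp add: R_vimage)
  have vim: "Some -` (R -` unit_disk) = - holes" by (auto simp: R_vimage)
  have uni: "g x = ?f x"
    if "ahlfors_admissible (R -` unit_disk) g" "Re (deriv_infinity g) = Re (deriv_infinity ?f)"
      "x \<in> R -` unit_disk" for g x
    by (rule maximizer_unique[OF openin_R_vimage inX _ the_R_admissible max that])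
       (simp add: vim connected_compl_holes)
  show ?thesis
    unfolding rational_ahlfors_function_def is_ahlfors_function_def sphere_domain_def
    using good_R openin_R_vimage connectedin_R_vimage inX the_R_admissible max uni by blast
qed

end

section \<open>Antilinear integral equations\<close>

text \<open>Lets an indexed family be treated as one function with a discrete index variable, hence
  as an element of the complete space of bounded continuous functions.\<close>

lemma continuous_on_discrete_prod:
  fixes f :: "'i discrete \<times> 'a::topological_space \<Rightarrow> 'b::topological_space"
  assumes "\<And>j. continuous_on UNIV (\<lambda>x. f (j, x))"
  shows "continuous_on UNIV f"
proof -
  have "continuous_on ({j} \<times> UNIV) f" for j
  proof (rule continuous_on_eq)
    show "continuous_on ({j} \<times> UNIV) (\<lambda>x. f (j, snd x))"
      by (rule continuous_on_compose2[OF assms[of j]]) (auto intro!: continuous_intros)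
  qed auto
  then have "continuous_on (\<Union>j\<in>UNIV. {j} \<times> UNIV) f"
    by (intro continuous_on_open_UN) (auto intro!: open_Times open_discrete)
  moreover have "(\<Union>j\<in>UNIV. {j} \<times> UNIV) = (UNIV :: ('i discrete \<times> 'a) set)" by auto
  ultimately show ?thesis by simp
qed

lemma norm_sum_cint_le:
  assumes I: "finite I" and c: "\<And>i. i \<in> I \<Longrightarrow> continuous_on (sphere 0 1) (h i)"
    and b: "\<And>i u. i \<in> I \<Longrightarrow> norm u = 1 \<Longrightarrow> norm (h i u) \<le> D * \<kappa> i"
    and s: "(\<Sum>i\<in>I. \<kappa> i) \<le> 1 / 2" and D: "D \<ge> 0"
  shows "norm (\<Sum>i\<in>I. cint 1 (h i)) \<le> D / 2"
proof -
  have "norm (\<Sum>i\<in>I. cint 1 (h i)) \<le> (\<Sum>i\<in>I. D * \<kappa> i)"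
    using norm_cint_le[OF c, of _ "D * \<kappa> _"] b by (intro sum_norm_le) auto
  also have "\<dots> = D * (\<Sum>i\<in>I. \<kappa> i)" by (simp add: sum_distrib_left)
  also have "\<dots> \<le> D * (1 / 2)" using s D by (rule mult_left_mono)
  finally show ?thesis by simp
qed

text \<open>The equation halves any bound for the distance of two solutions, so the distance is at
  most \<open>D / 2 ^ m\<close> for every \<open>m\<close>. This serves to transfer symmetries of
  the data to the solution.\<close>

lemma antilinear_fixed_point_unique:
  fixes k :: "nat \<Rightarrow> nat \<Rightarrow> complex \<Rightarrow> complex \<Rightarrow> complex"
  assumes I: "finite I"
    and kc: "\<And>i j w. i \<in> I \<Longrightarrow> j \<in> I \<Longrightarrow> norm w = 1 \<Longrightarrow> continuous_on (sphere 0 1) (\<lambda>u. k i j u w)"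
    and kb: "\<And>i j u w. i \<in> I \<Longrightarrow> j \<in> I \<Longrightarrow> norm u = 1 \<Longrightarrow> norm w = 1 \<Longrightarrow> norm (k i j u w) \<le> \<kappa> i j"
    and \<kappa>: "\<And>j. j \<in> I \<Longrightarrow> (\<Sum>i\<in>I. \<kappa> i j) \<le> 1 / 2"
    and G: "\<And>j. j \<in> I \<Longrightarrow> continuous_on (sphere 0 1) (G j)"
      "\<And>j w. j \<in> I \<Longrightarrow> norm w = 1 \<Longrightarrow> G j w = b j w - (\<Sum>i\<in>I. cint 1 (\<lambda>u. cnj (G i u) * k i j u w))"
    and H: "\<And>j. j \<in> I \<Longrightarrow> continuous_on (sphere 0 1) (H j)"
      "\<And>j w. j \<in> I \<Longrightarrow> norm w = 1 \<Longrightarrow> H j w = b j w - (\<Sum>i\<in>I. cint 1 (\<lambda>u. cnj (H i u) * k i j u w))"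
    and j: "j \<in> I" and w: "norm w = 1"
  shows "G j w = H j w"
proof -
  have "\<exists>B. \<forall>u. norm u = 1 \<longrightarrow> norm (G j u - H j u) \<le> B" if "j \<in> I" for j
  proof -
    have "compact ((\<lambda>u. G j u - H j u) ` sphere 0 1)"
      by (intro compact_continuous_image continuous_intros G(1) H(1) that) simp
    then show ?thesis using compact_imp_bounded by (force simp: bounded_iff)
  qed
  then obtain B where B: "\<And>j u. j \<in> I \<Longrightarrow> norm u = 1 \<Longrightarrow> norm (G j u - H j u) \<le> B j" by metis
  define D where "D = (\<Sum>j\<in>I. B j)"
  have Bnn: "B j \<ge> 0" if "j \<in> I" for j
    using B[OF that, of 1] norm_ge_zero by (metis norm_one order_trans)
  have D0: "D \<ge> 0" unfolding D_def by (rule sum_nonneg) (rule Bnn)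
  have step: "norm (G j w - H j w) \<le> D / 2 ^ m" if "j \<in> I" "norm w = 1" for j w m
    using that
  proof (induction m arbitrary: j w)
    case 0
    have "B j \<le> D" unfolding D_def by (rule member_le_sum) (use 0 Bnn I in auto)
    then show ?case using B[OF 0] by simp
  next
    case (Suc m)
    have c: "continuous_on (sphere 0 1) (\<lambda>u. cnj (K u) * k i j u w)"
      if "i \<in> I" "continuous_on (sphere 0 1) K" for i and K :: "complex \<Rightarrow> complex"
      using that kc[OF that(1) Suc.prems] by (intro continuous_intros)
    have "G j w - H j w = (\<Sum>i\<in>I. cint 1 (\<lambda>u. cnj (H i u - G i u) * k i j u w))"
    proof -
      have "cint 1 (\<lambda>u. cnj (H i u - G i u) * k i j u w)
          = cint 1 (\<lambda>u. cnj (H i u) * k i j u w) - cint 1 (\<lambda>u. cnj (G i u) * k i j u w)" if "i \<in> I" for i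
        using cint_diff[OF c[OF that H(1)[OF that]] c[OF that G(1)[OF that]]]
        by (simp add: left_diff_distrib)
      then show ?thesis
        using G(2)[OF Suc.prems] H(2)[OF Suc.prems] by (simp add: sum_subtractf)
    qed
    also have "norm \<dots> \<le> (D / 2 ^ m) / 2"
    proof (rule norm_sum_cint_le[OF I _ _ \<kappa>[OF Suc.prems(1)]])
      show "continuous_on (sphere 0 1) (\<lambda>u. cnj (H i u - G i u) * k i j u w)" if "i \<in> I" for i
        using kc[OF that Suc.prems] by (intro continuous_intros G(1) H(1) that)
      show "norm (cnj (H i u - G i u) * k i j u w) \<le> D / 2 ^ m * \<kappa> i j" if i: "i \<in> I" and u: "norm u = 1" for i u
        using mult_mono[OF Suc.IH[OF i u] kb[OF i Suc.prems(1) u Suc.prems(2)]] D0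
        by (simp add: norm_mult norm_minus_commute flip: complex_cnj_diff)
    qed (use D0 in simp)
    finally show ?case by simp
  qed
  have "(\<lambda>m. D / 2 ^ m) \<longlonglongrightarrow> 0"
    using tendsto_mult[OF tendsto_const[of D] LIMSEQ_power_zero[of "1/2::real"]]
    by (simp add: power_divide)
  then have "norm (G j w - H j w) \<le> 0"
    by (rule tendsto_lowerbound) (use step[OF j w] in auto)
  then show ?thesis by simp
qed

text \<open>Banach's theorem for one unknown function of the index, the parameter \<phi> and the
  angle. The contraction constant is uniform in \<phi>, so treating \<phi> as a variable makes the
  solution continuous in it. The circle is parametrized by all real angles because bounded
  continuous functions live on whole types; indices outside \<open>I\<close> get the value
  0.\<close>

lemma antilinear_fixed_point:
  fixes k :: "nat \<Rightarrow> nat \<Rightarrow> real \<Rightarrow> complex \<Rightarrow> complex \<Rightarrow> complex" and b :: "nat \<Rightarrow> real \<Rightarrow> complex \<Rightarrow> complex"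
  assumes I: "finite I"
    and kc: "\<And>i j. i \<in> I \<Longrightarrow> j \<in> I \<Longrightarrow>
      continuous_on (UNIV \<times> sphere 0 1 \<times> sphere 0 1) (\<lambda>x. k i j (fst x) (fst (snd x)) (snd (snd x)))"
    and bc: "\<And>j. j \<in> I \<Longrightarrow> continuous_on (UNIV \<times> sphere 0 1) (\<lambda>x. b j (fst x) (snd x))"
    and bb: "\<And>j \<phi> w. j \<in> I \<Longrightarrow> norm w = 1 \<Longrightarrow> norm (b j \<phi> w) \<le> B"
    and kb: "\<And>i j \<phi> u w. i \<in> I \<Longrightarrow> j \<in> I \<Longrightarrow> norm u = 1 \<Longrightarrow> norm w = 1 \<Longrightarrow> norm (k i j \<phi> u w) \<le> \<kappa> i j"
    and \<kappa>: "\<And>j. j \<in> I \<Longrightarrow> (\<Sum>i\<in>I. \<kappa> i j) \<le> 1 / 2" and B: "B \<ge> 0"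
  obtains F where
    "\<And>j. j \<in> I \<Longrightarrow> continuous_on (UNIV \<times> sphere 0 1) (\<lambda>x. F j (fst x) (snd x))"
    "\<And>j \<phi> w. j \<in> I \<Longrightarrow> norm w = 1 \<Longrightarrow> norm (F j \<phi> w) \<le> 2 * B"
    "\<And>j \<phi> w. j \<in> I \<Longrightarrow> norm w = 1 \<Longrightarrow>
       F j \<phi> w = b j \<phi> w - (\<Sum>i\<in>I. cint 1 (\<lambda>u. cnj (F i \<phi> u) * k i j \<phi> u w))"
proof -
  define c where "c t = cis (2 * pi * t)" for t :: real
  have nc: "norm (c t) = 1" for t by (simp add: c_def)
  have cc: "continuous_on X c" for X unfolding c_def by (intro continuous_intros)
  define J where "J g i j \<phi> w = integral {0..1} (\<lambda>s. cnj (g (discrete i, \<phi>, s)) * k i j \<phi> (c s) w * c s)"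
    for g :: "nat discrete \<times> real \<times> real \<Rightarrow> complex" and i j \<phi> w
  define T where "T g = (\<lambda>(d, \<phi>, t). let j = of_discrete d in
      if j \<in> I then b j \<phi> (c t) - (\<Sum>i\<in>I. J g i j \<phi> (c t)) else 0)"
    for g :: "nat discrete \<times> real \<times> real \<Rightarrow> complex"
  have cg: "continuous_on X (\<lambda>x. g (discrete i, f x, h x))"
    if "continuous_on UNIV g" "continuous_on X f" "continuous_on X h"
    for g :: "nat discrete \<times> real \<times> real \<Rightarrow> complex" and i and X :: "'z::topological_space set" and f h
    by (rule continuous_on_compose2[OF that(1)]) (use that in \<open>auto intro!: continuous_intros\<close>)
  have ck: "continuous_on X (\<lambda>x. k i j (f x) (g x) (h x))"
    if "i \<in> I" "j \<in> I" "continuous_on X f" "continuous_on X g" "continuous_on X h"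
      "\<And>x. x \<in> X \<Longrightarrow> norm (g x) = 1" "\<And>x. x \<in> X \<Longrightarrow> norm (h x) = 1"
    for i j and X :: "'z::topological_space set" and f g h
  proof -
    have "continuous_on X (\<lambda>x. (f x, g x, h x))" by (intro continuous_on_Pair that)
    moreover have "(\<lambda>x. (f x, g x, h x)) ` X \<subseteq> UNIV \<times> sphere 0 1 \<times> sphere 0 1"
      using that(6,7) by auto
    ultimately show ?thesis using continuous_on_compose2[OF kc[OF that(1,2)]] by fastforce
  qed
  have Jc: "continuous_on (UNIV \<times> sphere 0 1) (\<lambda>x. J g i j (fst x) (snd x))"
    if "continuous_on UNIV g" "i \<in> I" "j \<in> I" for g i j
    unfolding J_def
  proof (rule continuous_on_integral_param)
    show "continuous_on ((UNIV \<times> sphere 0 1) \<times> {0..1})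
      (\<lambda>(x, s). cnj (g (discrete i, fst x, s)) * k i j (fst x) (c s) (snd x) * c s)"
      unfolding case_prod_unfold
      by (intro continuous_intros cg[OF that(1)] ck[OF that(2,3)] continuous_on_compose2[OF cc[of UNIV]])
         (auto simp: nc)
  qed
  have Jdiff: "norm (J g i j \<phi> w - J h i j \<phi> w) \<le> D * \<kappa> i j"
    if g: "continuous_on UNIV g" and h: "continuous_on UNIV h" and ij: "i \<in> I" "j \<in> I" and w: "norm w = 1"
      and D: "\<And>x. norm (g x - h x) \<le> D" for g h i j \<phi> w D
  proof -
    have int: "(\<lambda>s. cnj (g (discrete i, \<phi>, s)) * k i j \<phi> (c s) w * c s) integrable_on {0..1}"
      if "continuous_on UNIV g" for g
      by (intro integrable_continuous_interval continuous_intros cg[OF that] ck[OF ij] cc) (auto simp: nc w)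
    have "J g i j \<phi> w - J h i j \<phi> w
        = integral {0..1} (\<lambda>s. cnj (g (discrete i, \<phi>, s) - h (discrete i, \<phi>, s)) * k i j \<phi> (c s) w * c s)"
      unfolding J_def by (subst integral_diff[symmetric, OF int[OF g] int[OF h]]) (simp add: algebra_simps)
    also have "norm \<dots> \<le> D * \<kappa> i j * (1 - 0)"
    proof (rule integral_bound)
      show "continuous_on {0..1} (\<lambda>s. cnj (g (discrete i, \<phi>, s) - h (discrete i, \<phi>, s)) * k i j \<phi> (c s) w * c s)"
        by (intro continuous_intros cg[OF g] cg[OF h] ck[OF ij] cc) (auto simp: nc w)
      show "norm (cnj (g (discrete i, \<phi>, s) - h (discrete i, \<phi>, s)) * k i j \<phi> (c s) w * c s) \<le> D * \<kappa> i j" for s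
        unfolding norm_mult complex_mod_cnj nc mult_1_right
        by (rule mult_mono[OF D kb[OF ij nc w]]) (use D norm_ge_zero order_trans in blast)+
    qed simp
    finally show ?thesis by simp
  qed
  have J0: "J (\<lambda>_. 0) i j \<phi> w = 0" for i j \<phi> w by (simp add: J_def)
  have Jb: "norm (\<Sum>i\<in>I. J g i j \<phi> w - J h i j \<phi> w) \<le> 1 / 2 * D"
    if "continuous_on UNIV g" "continuous_on UNIV h" "j \<in> I" "norm w = 1" "\<And>x. norm (g x - h x) \<le> D"
    for g h j \<phi> w D
  proof -
    have "norm (\<Sum>i\<in>I. J g i j \<phi> w - J h i j \<phi> w) \<le> (\<Sum>i\<in>I. D * \<kappa> i j)"
      by (rule sum_norm_le) (use Jdiff that in auto)
    also have "\<dots> = D * (\<Sum>i\<in>I. \<kappa> i j)" by (simp add: sum_distrib_left)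
    also have "\<dots> \<le> D * (1 / 2)"
      by (rule mult_left_mono[OF \<kappa>[OF that(3)]]) (use that(5) norm_ge_zero order_trans in blast)
    finally show ?thesis by simp
  qed
  have Tc: "continuous_on UNIV (T g)" if "continuous_on UNIV g" for g
  proof (rule continuous_on_discrete_prod)
    fix d :: "nat discrete"
    define j where "j = of_discrete d"
    show "continuous_on UNIV (\<lambda>x. T g (d, x))"
    proof (cases "j \<in> I")
      case True
      have cm: "continuous_on UNIV (\<lambda>x::real \<times> real. (fst x, c (snd x)))"
        unfolding c_def by (intro continuous_intros)
      have im: "range (\<lambda>x::real \<times> real. (fst x, c (snd x))) \<subseteq> UNIV \<times> sphere 0 1"
        using nc by auto
      have 1: "continuous_on UNIV (\<lambda>x::real \<times> real. b j (fst x) (c (snd x)))"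
        using continuous_on_compose2[OF bc[OF True] cm im] by simp
      have 2: "continuous_on UNIV (\<lambda>x::real \<times> real. J g i j (fst x) (c (snd x)))" if "i \<in> I" for i
        using continuous_on_compose2[OF Jc[OF \<open>continuous_on UNIV g\<close> that True] cm im] by simp
      show ?thesis
        unfolding T_def case_prod_unfold using True 1 2
        by (simp add: continuous_on_diff continuous_on_sum j_def Let_def)
    qed (simp add: T_def case_prod_unfold j_def)
  qed
  have Tdiff: "norm (T g x - T h x) \<le> 1 / 2 * D"
    if "continuous_on UNIV g" "continuous_on UNIV h" "\<And>x. norm (g x - h x) \<le> D" for g h D x
  proof -
    obtain j \<phi> t where x: "x = (discrete j, \<phi>, t)"
      by (metis of_discrete_inverse prod_cases3)
    have "D \<ge> 0" using that(3) norm_ge_zero order_trans by blast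
    moreover have "T g x - T h x = (\<Sum>i\<in>I. J h i j \<phi> (c t) - J g i j \<phi> (c t))" if "j \<in> I"
      using that by (simp add: T_def x sum_subtractf discrete_inverse)
    ultimately show ?thesis
      using Jb[OF that(2,1) _ nc, of j D \<phi> t] that(3)
      by (cases "j \<in> I") (auto simp: norm_minus_commute T_def x discrete_inverse)
  qed
  have T0: "norm (T (\<lambda>_. 0) x) \<le> B" for x
    using bb[OF _ nc] B by (auto simp: T_def J0 case_prod_unfold Let_def)
  have Tb: "norm (T g x) \<le> B + 1 / 2 * D" if "continuous_on UNIV g" "\<And>x. norm (g x) \<le> D" for g D x
    using Tdiff[OF that(1) continuous_on_const[of UNIV 0], of D x] T0[of x] that(2)
      norm_triangle_ineq2[of "T g x" "T (\<lambda>_. 0) x"] by force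
  have Tbc: "T (apply_bcontfun g) \<in> bcontfun" for g
    by (rule bcontfun_normI[OF Tc]) (auto intro: Tb[OF _ norm_bounded])
  define TT where "TT g = Bcontfun (T (apply_bcontfun g))" for g
  have TT: "apply_bcontfun (TT g) = T (apply_bcontfun g)" for g
    by (simp add: TT_def Bcontfun_inverse Tbc)
  have "\<exists>!g. TT g = g"
  proof (rule banach_fix_type[of "1 / 2" TT])
    show "\<forall>x y. dist (TT x) (TT y) \<le> 1 / 2 * dist x y"
    proof (intro allI dist_bound)
      fix g h and x :: "nat discrete \<times> real \<times> real"
      show "dist (apply_bcontfun (TT g) x) (apply_bcontfun (TT h) x) \<le> 1 / 2 * dist g h"
        unfolding TT dist_norm[of "T _ x"]
        by (rule Tdiff) (auto simp flip: dist_norm intro: dist_bounded)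
    qed
  qed auto
  then obtain g where g: "TT g = g" by blast
  define G where "G = apply_bcontfun g"
  have TG: "T G = G" using TT[of g] g by (simp add: G_def)
  have Gc: "continuous_on UNIV G" by (simp add: G_def)
  have Gb: "norm (G x) \<le> 2 * B" for x
  proof -
    have "norm (G x) \<le> B + 1 / 2 * norm g" for x
      using Tb[OF Gc, of "norm g" x] norm_bounded[of g] by (simp add: TG) (simp add: G_def)
    then have "norm g \<le> B + 1 / 2 * norm g" unfolding G_def by (rule norm_bound)
    then show ?thesis using norm_bounded[of g x] by (simp add: G_def)
  qed
  \<comment> \<open>The right side of the equation is meaningful for every \<open>w\<close>; on the
    circle it reproduces the fixed point, whichever angle represents \<open>w\<close>.\<close>
  define F where "F j \<phi> w = b j \<phi> w - (\<Sum>i\<in>I. J G i j \<phi> w)" for j \<phi> w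
  have FG: "F j \<phi> (c t) = G (discrete j, \<phi>, t)" if "j \<in> I" for j \<phi> t
    using that fun_cong[OF TG, of "(discrete j, \<phi>, t)"] by (simp add: F_def T_def discrete_inverse)
  have J_eq: "J G i j \<phi> w = cint 1 (\<lambda>u. cnj (F i \<phi> u) * k i j \<phi> u w)" if "i \<in> I" for i j \<phi> w
    unfolding J_def cint_def by (rule integral_cong) (simp add: FG[OF that, symmetric] c_def)
  have onc: "\<exists>t. w = c t" if "norm w = 1" for w
  proof -
    have "w = cis (Arg w)" using that rcis_cmod_Arg[of w] by (simp add: rcis_def)
    then have "w = c (Arg w / (2 * pi))" by (simp add: c_def)
    then show ?thesis ..
  qed
  show thesis
  proof
    show "continuous_on (UNIV \<times> sphere 0 1) (\<lambda>x. F j (fst x) (snd x))" if "j \<in> I" for j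
      unfolding F_def by (intro continuous_intros bc that Jc[OF Gc])
    show "norm (F j \<phi> w) \<le> 2 * B" if "j \<in> I" "norm w = 1" for j \<phi> w
      using onc[OF that(2)] FG[OF that(1)] Gb by metis
    show "F j \<phi> w = b j \<phi> w - (\<Sum>i\<in>I. cint 1 (\<lambda>u. cnj (F i \<phi> u) * k i j \<phi> u w))"
      if "j \<in> I" "norm w = 1" for j \<phi> w
      using J_eq by (simp add: F_def)
  qed
qed

section \<open>Families of separated poles\<close>

text \<open>
  The kernel \<open>(e u * e v * q u v - 1) / (u - v)\<close> continued across the diagonal by
  Cauchy's formula.
\<close>
definition self_kernel ::
    "nat \<Rightarrow> (nat \<Rightarrow> complex) \<Rightarrow> (nat \<Rightarrow> complex) \<Rightarrow> (nat \<Rightarrow> real) \<Rightarrow> nat \<Rightarrow> complex \<Rightarrow> complex \<Rightarrow> complex" where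
  "self_kernel n A p \<delta> j u w =
     cint (3 / 2) (\<lambda>v. (branch_root n A p \<delta> j u * branch_root n A p \<delta> j v * branch_quot n A p \<delta> j u v - 1)
       / (u - v) / (v - w))"

context separated_poles
begin

abbreviation "K \<equiv> self_kernel n A p \<delta>"

lemma holomorphic_quot:
  assumes j: "j \<in> {1..n}" and u: "norm u \<le> 2"
  shows "(\<lambda>v. q j u v) holomorphic_on ball 0 2"
proof -
  have "(\<lambda>v. dd j (Z j u) (Z j v)) holomorphic_on ball 0 2"
    unfolding other_slope_def
    by (intro holomorphic_intros holomorphic_branch[OF j]; use pole_notin[OF j] branch_in[OF j] u in fastforce)
  then show ?thesis
    unfolding branch_quot_def by (intro holomorphic_intros holomorphic_denom[OF j])
qed

text \<open>By \<open>root_square\<close> the numerator vanishes at \<open>w = u\<close>, so the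
  singularity is removable and Cauchy's formula on radius 3 / 2 returns the holomorphic
  extension.\<close>

lemma self_kernel_props:
  assumes j: "j \<in> {1..n}" and u: "norm u = 1"
  shows "K j u holomorphic_on ball 0 (3 / 2)"
    and "norm w < 3 / 2 \<Longrightarrow> w \<noteq> u \<Longrightarrow> K j u w = (e j u * e j w * q j u w - 1) / (u - w)"
proof -
  define h where "h v = e j u * e j v * q j u v - 1" for v
  define g where "g v = (if v = u then deriv h u else (h v - h u) / (v - u))" for v
  have u2: "norm u \<le> 2" using u by simp
  have h0: "h u = 0" using root_square[OF j u2] by (simp add: h_def power2_eq_square)
  have "h holomorphic_on ball 0 2"
    unfolding h_def by (intro holomorphic_intros holomorphic_root[OF j] holomorphic_quot[OF j u2])
  then have holg: "g holomorphic_on ball 0 2"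
    unfolding g_def by (rule pole_lemma_open) simp
  have Kg: "K j u w = - g w" if w: "norm w < 3 / 2" for w
  proof -
    have "K j u w = cint (3 / 2) (\<lambda>v. (- 1) * (g v / (v - w)))"
      unfolding self_kernel_def
    proof (rule cint_cong)
      fix v :: complex assume "norm v = 3 / 2"
      then have "v \<noteq> u" using u by auto
      then have "(e j u * e j v * q j u v - 1) / (u - v) = - g v"
        by (simp add: g_def h0) (simp add: h_def divide_simps, simp add: algebra_simps)
      then show "(e j u * e j v * q j u v - 1) / (u - v) / (v - w) = (- 1) * (g v / (v - w))" by simp
    qed simp
    also have "\<dots> = - cint (3 / 2) (\<lambda>v. g v / (v - w))" by (subst cint_cmult) simp
    also have "cint (3 / 2) (\<lambda>v. g v / (v - w)) = g w"
      by (rule cint_Cauchy[OF holg]) (use w in auto)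
    finally show ?thesis .
  qed
  have "(\<lambda>w. - g w) holomorphic_on ball 0 (3 / 2)"
    by (intro holomorphic_intros holomorphic_on_subset[OF holg]) auto
  then show "K j u holomorphic_on ball 0 (3 / 2)"
    by (rule holomorphic_transform) (simp add: Kg)
  show "K j u w = (e j u * e j w * q j u w - 1) / (u - w)" if "norm w < 3 / 2" "w \<noteq> u"
    using that by (simp add: Kg g_def h0) (simp add: h_def divide_simps, simp add: algebra_simps)
qed

text \<open>On \<open>norm v = 3 / 2\<close> both denominators are at least 1 / 2, so the integrand
  is at most \<open>4 * 64 * t j\<close>; the radius contributes the factor 3 / 2.\<close>

lemma self_kernel_bound:
  assumes j: "j \<in> {1..n}" and u: "norm u = 1" and w: "norm w \<le> 1"
  shows "norm (K j u w) \<le> 384 * t j"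
proof -
  have "continuous_on (sphere 0 (3/2)) (\<lambda>v. (e j u * e j v * q j u v - 1) / (u - v) / (v - w))"
    by (intro continuous_intros continuous_on_subset[OF holomorphic_on_imp_continuous_on[OF holomorphic_root[OF j]]]
          continuous_on_subset[OF holomorphic_on_imp_continuous_on[OF holomorphic_quot[OF j]]])
       (use u w in auto)
  then have "norm (K j u w) \<le> 3 / 2 * (256 * t j)"
    unfolding self_kernel_def
  proof (rule norm_cint_le)
    fix v :: complex assume v: "norm v = 3 / 2"
    have N: "norm (e j u * e j v * q j u v - 1) \<le> 64 * t j"
      by (rule root_quot_close[OF j]) (use u v in auto)
    have 1: "1 / 2 \<le> norm (u - v)" using norm_triangle_ineq2[of v u] u v by (simp add: norm_minus_commute)
    have 2: "1 / 2 \<le> norm (v - w)" using norm_triangle_ineq2[of v w] v w by simp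
    have "norm (e j u * e j v * q j u v - 1) / norm (u - v) / norm (v - w) \<le> 64 * t j / (1 / 2) / (1 / 2)"
      by (intro frac_le N 1 2) (use t_nonneg[OF j] in auto)
    then have "norm (e j u * e j v * q j u v - 1) / norm (u - v) / norm (v - w) \<le> 256 * t j"
      by (rule order_trans) simp
    then show "norm ((e j u * e j v * q j u v - 1) / (u - v) / (v - w)) \<le> 256 * t j"
      by (simp only: norm_divide)
  qed simp
  then show ?thesis by simp
qed

end

lemma continuous_on_rel_compose3:
  assumes "continuous_on (UNIV \<times> P \<times> Q) (\<lambda>x. f (fst x) (fst (snd x)) (snd (snd x)))"
    and "continuous_on X a" "continuous_on X b" "continuous_on X c"
    and "\<And>x. x \<in> X \<Longrightarrow> b x \<in> P" "\<And>x. x \<in> X \<Longrightarrow> c x \<in> Q"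
  shows "continuous_on X (\<lambda>x. f (a x) (b x) (c x))"
proof -
  have c: "continuous_on X (\<lambda>x. (a x, b x, c x))" by (intro continuous_on_Pair assms(2-4))
  have "(\<lambda>x. (a x, b x, c x)) ` X \<subseteq> UNIV \<times> P \<times> Q" using assms(5,6) by auto
  from continuous_on_compose2[OF assms(1) c this] show ?thesis by simp
qed

lemma continuous_on_rel_compose2:
  assumes "continuous_on (UNIV \<times> P) (\<lambda>x. f (fst x) (snd x))"
    and "continuous_on X a" "continuous_on X b" "\<And>x. x \<in> X \<Longrightarrow> b x \<in> P"
  shows "continuous_on X (\<lambda>x. f (a x) (b x))"
proof -
  have c: "continuous_on X (\<lambda>x. (a x, b x))" by (intro continuous_on_Pair assms(2,3))
  have "(\<lambda>x. (a x, b x)) ` X \<subseteq> UNIV \<times> P" using assms(4) by auto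
  from continuous_on_compose2[OF assms(1) c this] show ?thesis by simp
qed

text \<open>Only the arguments of the residues move with \<phi>, so all estimates are uniform in it.
  In \<open>coupling\<close>, 81 / 25 is the square of the root bound 9 / 5 and 384 comes from
  \<open>self_kernel_bound\<close>. The sum 1 / 4 is sharper than the 1 / 2 of the fixed point lemma
  in order to keep the densities at the centres near 1.\<close>

locale pole_family =
  fixes n :: nat and A :: "real \<Rightarrow> nat \<Rightarrow> complex" and p :: "nat \<Rightarrow> complex"
    and \<delta> t \<alpha> :: "nat \<Rightarrow> real" and gap :: "nat \<Rightarrow> nat \<Rightarrow> real"
  assumes sep: "\<And>\<phi>. separated_poles n (A \<phi>) p \<delta> t"
    and norm_A: "\<And>\<phi> j. j \<in> {1..n} \<Longrightarrow> norm (A \<phi> j) = \<alpha> j"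
    and continuous_A: "\<And>j. j \<in> {1..n} \<Longrightarrow> continuous_on UNIV (\<lambda>\<phi>. A \<phi> j)"
    and gap: "\<And>i j z w. i \<in> {1..n} \<Longrightarrow> j \<in> {1..n} \<Longrightarrow> i \<noteq> j \<Longrightarrow> z \<in> cball (p i) (\<delta> i) \<Longrightarrow> w \<in> cball (p j) (\<delta> j) \<Longrightarrow>
        gap i j \<le> norm (z - w)"
    and gap_pos: "\<And>i j. i \<in> {1..n} \<Longrightarrow> j \<in> {1..n} \<Longrightarrow> i \<noteq> j \<Longrightarrow> gap i j > 0"
    and coupling: "\<And>j. j \<in> {1..n} \<Longrightarrow> (\<Sum>i\<in>{1..n} - {j}. \<alpha> i * (81 / 25) / gap i j) + 384 * t j \<le> 1 / 4"
begin

sublocale sp: separated_poles n "A \<phi>" p \<delta> t for \<phi> by (rule sep)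

abbreviation "Zf \<phi> \<equiv> branch n (A \<phi>) p \<delta>"
abbreviation "ef \<phi> \<equiv> branch_root n (A \<phi>) p \<delta>"
abbreviation "yf \<phi> \<equiv> branch_denom n (A \<phi>) p \<delta>"
abbreviation "qf \<phi> \<equiv> branch_quot n (A \<phi>) p \<delta>"

text \<open>The influence of hole \<open>i\<close>, which carries the integrated density, on hole
  \<open>j\<close>, where the result is evaluated. The factor \<open>\<alpha> j / A \<phi> j\<close>
  is a mere phase.\<close>

definition coupling_kernel :: "nat \<Rightarrow> nat \<Rightarrow> real \<Rightarrow> complex \<Rightarrow> complex \<Rightarrow> complex" where
  "coupling_kernel i j \<phi> u w =
     (if i = j then \<alpha> j / A \<phi> j * self_kernel n (A \<phi>) p \<delta> j u w
      else \<alpha> i * (ef \<phi> i u * ef \<phi> j w / (Zf \<phi> i u - Zf \<phi> j w)))"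

lemma continuous_A': "j \<in> {1..n} \<Longrightarrow> continuous_on X f \<Longrightarrow> continuous_on X (\<lambda>x. A (f x) j)"
  by (rule continuous_on_compose2[OF continuous_A]) auto

lemma continuous_Z2:
  assumes j: "j \<in> {1..n}"
  shows "continuous_on (UNIV \<times> cball 0 2) (\<lambda>x. Zf (fst x) j (snd x))"
  unfolding continuous_on_def
proof
  fix x0 :: "real \<times> complex" assume x0: "x0 \<in> UNIV \<times> cball 0 2"
  let ?z0 = "Zf (fst x0) j (snd x0)"
  let ?\<Phi> = "\<lambda>x. p j + A (fst x) j * snd x / (1 - snd x * other_poles n (A (fst x)) p j ?z0)"
  have u0: "norm (snd x0) \<le> 2" using x0 by auto
  have z0: "?z0 \<in> cball (p j) (\<delta> j)" by (rule sp.branch_in[OF j u0])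
  have "continuous_on (UNIV \<times> cball 0 2) ?\<Phi>"
    unfolding other_poles_def
  proof (intro continuous_intros continuous_A'[OF j])
    show "\<forall>x\<in>UNIV \<times> cball 0 2. 1 - snd x * (\<Sum>k\<in>{1..n} - {j}. A (fst x) k / (?z0 - p k)) \<noteq> 0"
    proof
      fix x :: "real \<times> complex" assume "x \<in> UNIV \<times> cball 0 2"
      then have "norm (snd x) \<le> 2" by auto
      from sp.denom_lower(2)[OF j this z0, of "fst x"]
      show "1 - snd x * (\<Sum>k\<in>{1..n} - {j}. A (fst x) k / (?z0 - p k)) \<noteq> 0"
        unfolding other_poles_def by (metis norm_zero not_less zero_less_divide_iff zero_less_numeral)
    qed
    fix k assume "k \<in> {1..n} - {j}"
    then show "continuous_on (UNIV \<times> cball 0 2) (\<lambda>x::real \<times> complex. A (fst x) k)"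
      by (intro continuous_A' continuous_intros) auto
    show "\<forall>x\<in>UNIV \<times> cball 0 2. ?z0 - p k \<noteq> 0"
      using sp.pole_notin[OF j \<open>k \<in> {1..n} - {j}\<close> z0] by simp
  qed
  then have "(?\<Phi> \<longlongrightarrow> ?\<Phi> x0) (at x0 within UNIV \<times> cball 0 2)"
    using x0 unfolding continuous_on_def by blast
  moreover have "?\<Phi> x0 = ?z0"
    using sp.branch_eq[OF j u0, of "fst x0"] by (simp add: branch_denom_def)
  ultimately have lim: "((\<lambda>x. 9 / 7 * norm (?\<Phi> x - ?z0)) \<longlongrightarrow> 9 / 7 * 0) (at x0 within UNIV \<times> cball 0 2)"
    by (intro tendsto_intros tendsto_norm_zero) (simp add: LIM_zero_iff)
  show "((\<lambda>x. Zf (fst x) j (snd x)) \<longlongrightarrow> ?z0) (at x0 within UNIV \<times> cball 0 2)"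
  proof (rule LIM_zero_cancel, rule Lim_null_comparison)
    show "((\<lambda>x. 9 / 7 * norm (?\<Phi> x - ?z0)) \<longlongrightarrow> 0) (at x0 within UNIV \<times> cball 0 2)" using lim by simp
    show "\<forall>\<^sub>F x in at x0 within UNIV \<times> cball 0 2. norm (Zf (fst x) j (snd x) - ?z0) \<le> 9 / 7 * norm (?\<Phi> x - ?z0)"
      unfolding eventually_at_filter
    proof (rule always_eventually, intro allI impI)
      fix x :: "real \<times> complex" assume "x \<in> UNIV \<times> cball 0 2"
      then have "norm (snd x) \<le> 2" by auto
      from sp.branch_dist[OF j this z0]
      show "norm (Zf (fst x) j (snd x) - ?z0) \<le> 9 / 7 * norm (?\<Phi> x - ?z0)" .
    qed
  qed
qed

section \<open>Joint continuity of the branch functions in the parameter and the point\<close>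

context
  fixes X :: "'x::topological_space set" and f :: "'x \<Rightarrow> real"
  assumes f: "continuous_on X f"
begin

lemma continuous_Z:
  assumes j: "j \<in> {1..n}" and g: "continuous_on X g" "\<And>x. x \<in> X \<Longrightarrow> norm (g x) \<le> 2"
  shows "continuous_on X (\<lambda>x. Zf (f x) j (g x))"
  by (rule continuous_on_rel_compose2[OF continuous_Z2[OF j] f g(1)]) (use g(2) in auto)

lemma Z_ne_pole:
  assumes j: "j \<in> {1..n}" and k: "k \<in> {1..n} - {j}" and u: "norm u \<le> 2"
  shows "Zf \<phi> j u - p k \<noteq> 0"
  using sp.pole_notin[OF j k sp.branch_in[OF j u]] by simp

lemma continuous_y:
  assumes j: "j \<in> {1..n}" and g: "continuous_on X g" "\<And>x. x \<in> X \<Longrightarrow> norm (g x) \<le> 2"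
  shows "continuous_on X (\<lambda>x. yf (f x) j (g x))"
  unfolding branch_denom_def other_poles_def
  by (intro continuous_intros g continuous_A' f continuous_Z[OF j] ballI Z_ne_pole[OF j]) auto

lemma continuous_dd:
  assumes j: "j \<in> {1..n}" and g: "continuous_on X g" "\<And>x. x \<in> X \<Longrightarrow> norm (g x) \<le> 2"
    and h: "continuous_on X h" "\<And>x. x \<in> X \<Longrightarrow> norm (h x) \<le> 2"
  shows "continuous_on X (\<lambda>x. other_slope n (A (f x)) p j (Zf (f x) j (g x)) (Zf (f x) j (h x)))"
  unfolding other_slope_def
proof (intro continuous_intros continuous_A' f continuous_Z[OF j] g h ballI)
  fix k x assume "k \<in> {1..n} - {j}" "x \<in> X"
  then show "(Zf (f x) j (g x) - p k) * (Zf (f x) j (h x) - p k) \<noteq> 0"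
    using Z_ne_pole[OF j _ g(2)] Z_ne_pole[OF j _ h(2)] by simp
qed auto

lemma continuous_q:
  assumes j: "j \<in> {1..n}" and g: "continuous_on X g" "\<And>x. x \<in> X \<Longrightarrow> norm (g x) \<le> 2"
    and h: "continuous_on X h" "\<And>x. x \<in> X \<Longrightarrow> norm (h x) \<le> 2"
  shows "continuous_on X (\<lambda>x. qf (f x) j (g x) (h x))"
  unfolding branch_quot_def
  by (intro continuous_intros continuous_y[OF j] continuous_dd[OF j] continuous_A' f g h j)

lemma continuous_e:
  assumes j: "j \<in> {1..n}" and g: "continuous_on X g" "\<And>x. x \<in> X \<Longrightarrow> norm (g x) \<le> 2"
  shows "continuous_on X (\<lambda>x. ef (f x) j (g x))"
proof -
  let ?a = "\<lambda>x. 1 + A (f x) j * (g x)\<^sup>2 * other_slope n (A (f x)) p j (Zf (f x) j (g x)) (Zf (f x) j (g x))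
      / (yf (f x) j (g x))\<^sup>2"
  have pos: "Re (?a x) > 0" if "x \<in> X" for x by (rule sp.root_arg_pos[OF j g(2)[OF that]])
  have "continuous_on X ?a"
    by (intro continuous_intros continuous_A' f g j continuous_dd[OF j] continuous_y[OF j] ballI)
       (use sp.denom_nz[OF j g(2)] in auto)
  moreover have "?a x \<notin> \<real>\<^sub>\<le>\<^sub>0" if "x \<in> X" for x
    using pos[OF that] by (auto simp: complex_nonpos_Reals_iff)
  ultimately have "continuous_on X (\<lambda>x. csqrt (?a x))"
    by (intro continuous_on_compose2[OF holomorphic_on_imp_continuous_on[OF holomorphic_on_csqrt]]) auto
  moreover have "csqrt (?a x) \<noteq> 0" if "x \<in> X" for x
    using pos[OF that] by (metis csqrt_eq_0 less_irrefl zero_complex.sel(1))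
  ultimately show ?thesis
    unfolding branch_root_def
    by (intro continuous_intros continuous_y[OF j] g ballI) (use sp.denom_nz[OF j g(2)] in auto)
qed

end

lemma A_nonzero: "j \<in> {1..n} \<Longrightarrow> A \<phi> j \<noteq> 0" by (rule sp.A_nz)

lemma \<alpha>_pos: "j \<in> {1..n} \<Longrightarrow> \<alpha> j > 0"
  using norm_A[of j 0] A_nonzero[of j 0] by (metis zero_less_norm_iff)

lemma Z_distinct:
  "i \<in> {1..n} \<Longrightarrow> j \<in> {1..n} \<Longrightarrow> i \<noteq> j \<Longrightarrow> norm u \<le> 2 \<Longrightarrow> norm w \<le> 2 \<Longrightarrow> Zf \<phi> i u - Zf \<phi> j w \<noteq> 0"
  using sp.branch_distinct by simp

lemma continuous_coupling_kernel:
  assumes i: "i \<in> {1..n}" and j: "j \<in> {1..n}"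
  shows "continuous_on (UNIV \<times> sphere 0 1 \<times> ball 0 (3/2))
    (\<lambda>x. coupling_kernel i j (fst x) (fst (snd x)) (snd (snd x)))"
proof (cases "i = j")
  case True
  have "continuous_on (UNIV \<times> sphere 0 1 \<times> ball 0 (3/2))
    (\<lambda>x. self_kernel n (A (fst x)) p \<delta> j (fst (snd x)) (snd (snd x)))"
    unfolding self_kernel_def
  proof (rule continuous_on_cint_param)
    show "continuous_on ((UNIV \<times> sphere 0 1 \<times> ball 0 (3/2)) \<times> sphere 0 (3/2))
      (\<lambda>(x, v). (ef (fst x) j (fst (snd x)) * ef (fst x) j v * qf (fst x) j (fst (snd x)) v - 1)
         / (fst (snd x) - v) / (v - snd (snd x)))"
      unfolding case_prod_unfold
      by (intro continuous_intros continuous_e[OF _ j] continuous_q[OF _ j] ballI) auto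
  qed simp
  then show ?thesis
    unfolding coupling_kernel_def using True A_nonzero[OF j]
    by (auto intro!: continuous_intros continuous_A'[OF j])
next
  case False
  then show ?thesis
    unfolding coupling_kernel_def
    by (simp, intro continuous_intros continuous_e[OF _ j] continuous_e[OF _ i] continuous_Z[OF _ i]
        continuous_Z[OF _ j] ballI Z_distinct[OF i j]) auto
qed

lemma holomorphic_coupling_kernel:
  assumes i: "i \<in> {1..n}" and j: "j \<in> {1..n}" and u: "norm u = 1"
  shows "(\<lambda>w. coupling_kernel i j \<phi> u w) holomorphic_on ball 0 (3/2)"
proof (cases "i = j")
  case True
  then show ?thesis
    unfolding coupling_kernel_def using sp.self_kernel_props(1)[OF j u]
    by (auto intro!: holomorphic_intros)
next
  case False
  then show ?thesis
    unfolding coupling_kernel_def using Z_distinct[OF i j False, of u] u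
    by (simp, intro holomorphic_intros holomorphic_on_subset[OF sp.holomorphic_root[OF j]]
        holomorphic_on_subset[OF sp.holomorphic_branch[OF j]]) auto
qed

definition kernel_bound :: "nat \<Rightarrow> nat \<Rightarrow> real" where
  "kernel_bound i j = (if i = j then 384 * t j else \<alpha> i * (81 / 25) / gap i j)"

lemma coupling_kernel_bound:
  assumes i: "i \<in> {1..n}" and j: "j \<in> {1..n}" and u: "norm u = 1" and w: "norm w \<le> 1"
  shows "norm (coupling_kernel i j \<phi> u w) \<le> kernel_bound i j"
proof (cases "i = j")
  case True
  have "norm (\<alpha> j / A \<phi> j) = 1"
    using norm_A[OF j, of \<phi>] \<alpha>_pos[OF j] by (simp add: norm_divide)
  then have "norm (coupling_kernel j j \<phi> u w) = norm (self_kernel n (A \<phi>) p \<delta> j u w)"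
    by (simp only: coupling_kernel_def if_True norm_mult mult_1_left simp_thms)
  then show ?thesis
    using sp.self_kernel_bound[OF j u w, of \<phi>] True by (simp add: kernel_bound_def)
next
  case False
  have u2: "norm u \<le> 2" and w2: "norm w \<le> 2" using u w by auto
  have "norm (ef \<phi> i u) * norm (ef \<phi> j w) / norm (Zf \<phi> i u - Zf \<phi> j w) \<le> 9 / 5 * (9 / 5) / gap i j"
    by (intro frac_le mult_mono sp.root_le[OF i u2] sp.root_le[OF j w2] gap_pos[OF i j False]
          gap[OF i j False] sp.branch_in[OF i u2] sp.branch_in[OF j w2]) auto
  then have "\<alpha> i * (norm (ef \<phi> i u) * norm (ef \<phi> j w) / norm (Zf \<phi> i u - Zf \<phi> j w)) \<le> \<alpha> i * (81 / 25 / gap i j)"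
    by (intro mult_left_mono) (use \<alpha>_pos[OF i] in auto)
  then show ?thesis
    using False \<alpha>_pos[OF i] by (simp add: coupling_kernel_def kernel_bound_def norm_mult norm_divide)
qed

lemma kernel_bound_sum: "j \<in> {1..n} \<Longrightarrow> (\<Sum>i\<in>{1..n}. kernel_bound i j) \<le> 1 / 4"
proof -
  assume j: "j \<in> {1..n}"
  have "(\<Sum>i\<in>{1..n}. kernel_bound i j) = 384 * t j + (\<Sum>i\<in>{1..n} - {j}. kernel_bound i j)"
    using j by (simp add: sum.remove kernel_bound_def)
  also have "(\<Sum>i\<in>{1..n} - {j}. kernel_bound i j) = (\<Sum>i\<in>{1..n} - {j}. \<alpha> i * (81 / 25) / gap i j)"
    by (rule sum.cong) (auto simp: kernel_bound_def)
  finally show ?thesis using coupling[OF j] by linarith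
qed

lemma exists_solution:
  obtains F :: "nat \<Rightarrow> real \<Rightarrow> complex \<Rightarrow> complex" where
    "\<And>j \<phi>. j \<in> {1..n} \<Longrightarrow> F j \<phi> holomorphic_on ball 0 (3 / 2)"
    "\<And>j \<phi> w. j \<in> {1..n} \<Longrightarrow> norm w = 1 \<Longrightarrow> norm (F j \<phi> w) \<le> 18 / 5"
    "\<And>j \<phi> w. j \<in> {1..n} \<Longrightarrow> norm w < 3 / 2 \<Longrightarrow>
       F j \<phi> w = ef \<phi> j w - (\<Sum>i=1..n. cint 1 (\<lambda>u. cnj (F i \<phi> u) * coupling_kernel i j \<phi> u w))"
    "\<And>j. j \<in> {1..n} \<Longrightarrow> continuous_on UNIV (\<lambda>\<phi>. F j \<phi> 0)"
proof -
  have sb: "UNIV \<times> sphere 0 1 \<times> sphere 0 1 \<subseteq> (UNIV :: real set) \<times> sphere (0::complex) 1 \<times> ball (0::complex) (3/2)"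
    by auto
  obtain F where F: "\<And>j. j \<in> {1..n} \<Longrightarrow> continuous_on (UNIV \<times> sphere 0 1) (\<lambda>x. F j (fst x) (snd x))"
    "\<And>j \<phi> w. j \<in> {1..n} \<Longrightarrow> norm w = 1 \<Longrightarrow> norm (F j \<phi> w) \<le> 2 * (9 / 5)"
    "\<And>j \<phi> w. j \<in> {1..n} \<Longrightarrow> norm w = 1 \<Longrightarrow>
       F j \<phi> w = ef \<phi> j w - (\<Sum>i=1..n. cint 1 (\<lambda>u. cnj (F i \<phi> u) * coupling_kernel i j \<phi> u w))"
  proof (rule antilinear_fixed_point[where I = "{1..n}" and k = coupling_kernel and b = "\<lambda>j \<phi> w. ef \<phi> j w"
        and \<kappa> = kernel_bound and B = "9 / 5"])
    show "continuous_on (UNIV \<times> sphere 0 1 \<times> sphere 0 1) (\<lambda>x. coupling_kernel i j (fst x) (fst (snd x)) (snd (snd x)))"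
      if "i \<in> {1..n}" "j \<in> {1..n}" for i j
      by (rule continuous_on_subset[OF continuous_coupling_kernel[OF that] sb])
    show "continuous_on (UNIV \<times> sphere 0 1) (\<lambda>x. ef (fst x) j (snd x))" if "j \<in> {1..n}" for j
      by (rule continuous_e[OF _ that]) (auto intro!: continuous_intros)
    show "norm (ef \<phi> j w) \<le> 9 / 5" if "j \<in> {1..n}" "norm w = 1" for j \<phi> w
      using sp.root_le[OF that(1), of w] that(2) by simp
    show "norm (coupling_kernel i j \<phi> u w) \<le> kernel_bound i j"
      if "i \<in> {1..n}" "j \<in> {1..n}" "norm u = 1" "norm w = 1" for i j \<phi> u w
      using coupling_kernel_bound[OF that(1-3)] that(4) by simp
    show "(\<Sum>i\<in>{1..n}. kernel_bound i j) \<le> 1 / 2" if "j \<in> {1..n}" for j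
      using kernel_bound_sum[OF that] by simp
  qed auto
  \<comment> \<open>\<open>F\<close> is controlled only on the circle. The right side of its
    equation is holomorphic in \<open>w\<close> on the larger disc and agrees with \<open>F\<close>
    on the circle; as the integrals see only the circle, it satisfies the same equation on the whole
    disc.\<close>
  define G where "G j \<phi> w = ef \<phi> j w - (\<Sum>i=1..n. cint 1 (\<lambda>u. cnj (F i \<phi> u) * coupling_kernel i j \<phi> u w))"
    for j \<phi> w
  have GF: "G j \<phi> w = F j \<phi> w" if "j \<in> {1..n}" "norm w = 1" for j \<phi> w
    using F(3)[OF that] by (simp add: G_def)
  have Fu: "continuous_on Y (\<lambda>x. F i (a x) (b x))"
    if "i \<in> {1..n}" "continuous_on Y a" "continuous_on Y b" "\<And>x. x \<in> Y \<Longrightarrow> norm (b x) = 1"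
    for i and Y :: "'y::topological_space set" and a b
    by (rule continuous_on_rel_compose2[OF F(1)[OF that(1)] that(2,3)]) (use that(4) in auto)
  have ku: "continuous_on Y (\<lambda>x. coupling_kernel i j (a x) (b x) (c x))"
    if "i \<in> {1..n}" "j \<in> {1..n}" "continuous_on Y a" "continuous_on Y b" "continuous_on Y c"
      "\<And>x. x \<in> Y \<Longrightarrow> norm (b x) = 1" "\<And>x. x \<in> Y \<Longrightarrow> norm (c x) < 3 / 2"
    for i j and Y :: "'y::topological_space set" and a b c
    by (rule continuous_on_rel_compose3[OF continuous_coupling_kernel[OF that(1,2)] that(3-5)])
       (use that(6,7) in auto)
  show thesis
  proof
    show "G j \<phi> holomorphic_on ball 0 (3 / 2)" if j: "j \<in> {1..n}" for j \<phi>
    proof -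
      have "(\<lambda>w. cint 1 (\<lambda>u. cnj (F i \<phi> u) * coupling_kernel i j \<phi> u w)) holomorphic_on ball 0 (3 / 2)"
        if i: "i \<in> {1..n}" for i
      proof (rule holomorphic_cint_param)
        show "continuous_on (ball 0 (3/2) \<times> sphere 0 1) (\<lambda>(w, u). cnj (F i \<phi> u) * coupling_kernel i j \<phi> u w)"
          unfolding case_prod_unfold
          by (intro continuous_intros Fu[OF i] ku[OF i j]) auto
        show "(\<lambda>w. cnj (F i \<phi> u) * coupling_kernel i j \<phi> u w) holomorphic_on ball 0 (3/2)" if "norm u = 1" for u
          by (intro holomorphic_intros holomorphic_coupling_kernel[OF i j that])
      qed auto
      then show ?thesis
        unfolding G_def
        by (intro holomorphic_intros holomorphic_on_subset[OF sp.holomorphic_root[OF j]]) auto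
    qed
    show "norm (G j \<phi> w) \<le> 18 / 5" if "j \<in> {1..n}" "norm w = 1" for j \<phi> w
      using F(2)[OF that] GF[OF that] by simp
    show "G j \<phi> w = ef \<phi> j w - (\<Sum>i=1..n. cint 1 (\<lambda>u. cnj (G i \<phi> u) * coupling_kernel i j \<phi> u w))"
      if "j \<in> {1..n}" for j \<phi> w
    proof -
      have "cint 1 (\<lambda>u. cnj (G i \<phi> u) * coupling_kernel i j \<phi> u w)
          = cint 1 (\<lambda>u. cnj (F i \<phi> u) * coupling_kernel i j \<phi> u w)" if "i \<in> {1..n}" for i
        by (rule cint_cong) (simp_all add: GF[OF that])
      then show ?thesis by (simp add: G_def)
    qed
    show "continuous_on UNIV (\<lambda>\<phi>. G j \<phi> 0)" if j: "j \<in> {1..n}" for j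
      unfolding G_def
    proof (intro continuous_intros)
      show "continuous_on UNIV (\<lambda>\<phi>. ef \<phi> j 0)" by (rule continuous_e[OF _ j]) (auto intro!: continuous_intros)
      fix i assume i: "i \<in> {1..n}"
      show "continuous_on UNIV (\<lambda>\<phi>. cint 1 (\<lambda>u. cnj (F i \<phi> u) * coupling_kernel i j \<phi> u 0))"
      proof (rule continuous_on_cint_param)
        show "continuous_on (UNIV \<times> sphere 0 1) (\<lambda>(\<phi>, u). cnj (F i \<phi> u) * coupling_kernel i j \<phi> u 0)"
          unfolding case_prod_unfold
          by (intro continuous_intros Fu[OF i] ku[OF i j]) auto
      qed simp
    qed
  qed
qed

end

section \<open>Mirror symmetry\<close>

context pole_family
begin

text \<open>One solution is chosen for all \<phi> at once, so that its continuity in \<phi> can be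
  used later.\<close>

definition szego :: "nat \<Rightarrow> real \<Rightarrow> complex \<Rightarrow> complex" where
  "szego = (SOME F. \<forall>j\<in>{1..n}.
     (\<forall>\<phi>. F j \<phi> holomorphic_on ball 0 (3 / 2)) \<and>
     (\<forall>\<phi> w. norm w = 1 \<longrightarrow> norm (F j \<phi> w) \<le> 18 / 5) \<and>
     (\<forall>\<phi> w. norm w < 3 / 2 \<longrightarrow>
       F j \<phi> w = ef \<phi> j w - (\<Sum>i=1..n. cint 1 (\<lambda>u. cnj (F i \<phi> u) * coupling_kernel i j \<phi> u w))) \<and>
     continuous_on UNIV (\<lambda>\<phi>. F j \<phi> 0))"

lemma szego_props:
  assumes j: "j \<in> {1..n}"
  shows szego_holomorphic: "szego j \<phi> holomorphic_on ball 0 (3 / 2)"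
    and szego_bound: "norm w = 1 \<Longrightarrow> norm (szego j \<phi> w) \<le> 18 / 5"
    and szego_eq: "norm w < 3 / 2 \<Longrightarrow> szego j \<phi> w =
       ef \<phi> j w - (\<Sum>i=1..n. cint 1 (\<lambda>u. cnj (szego i \<phi> u) * coupling_kernel i j \<phi> u w))"
    and szego_continuous: "continuous_on UNIV (\<lambda>\<phi>. szego j \<phi> 0)"
proof -
  obtain F :: "nat \<Rightarrow> real \<Rightarrow> complex \<Rightarrow> complex" where
    F: "\<And>j \<phi>. j \<in> {1..n} \<Longrightarrow> F j \<phi> holomorphic_on ball 0 (3 / 2)"
    "\<And>j \<phi> w. j \<in> {1..n} \<Longrightarrow> norm w = 1 \<Longrightarrow> norm (F j \<phi> w) \<le> 18 / 5"
    "\<And>j \<phi> w. j \<in> {1..n} \<Longrightarrow> norm w < 3 / 2 \<Longrightarrow>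
       F j \<phi> w = ef \<phi> j w - (\<Sum>i=1..n. cint 1 (\<lambda>u. cnj (F i \<phi> u) * coupling_kernel i j \<phi> u w))"
    "\<And>j. j \<in> {1..n} \<Longrightarrow> continuous_on UNIV (\<lambda>\<phi>. F j \<phi> 0)"
    using exists_solution by blast
  have "\<forall>j\<in>{1..n}.
     (\<forall>\<phi>. szego j \<phi> holomorphic_on ball 0 (3 / 2)) \<and>
     (\<forall>\<phi> w. norm w = 1 \<longrightarrow> norm (szego j \<phi> w) \<le> 18 / 5) \<and>
     (\<forall>\<phi> w. norm w < 3 / 2 \<longrightarrow>
       szego j \<phi> w = ef \<phi> j w - (\<Sum>i=1..n. cint 1 (\<lambda>u. cnj (szego i \<phi> u) * coupling_kernel i j \<phi> u w))) \<and>
     continuous_on UNIV (\<lambda>\<phi>. szego j \<phi> 0)"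
    unfolding szego_def by (rule someI[of _ F]) (use F in blast)
  then show "szego j \<phi> holomorphic_on ball 0 (3 / 2)"
    "norm w = 1 \<Longrightarrow> norm (szego j \<phi> w) \<le> 18 / 5"
    "norm w < 3 / 2 \<Longrightarrow> szego j \<phi> w =
       ef \<phi> j w - (\<Sum>i=1..n. cint 1 (\<lambda>u. cnj (szego i \<phi> u) * coupling_kernel i j \<phi> u w))"
    "continuous_on UNIV (\<lambda>\<phi>. szego j \<phi> 0)"
    using j by blast+
qed

section \<open>Size of the interactions between the holes\<close>

definition interaction :: "nat \<Rightarrow> nat \<Rightarrow> real \<Rightarrow> complex \<Rightarrow> complex" where
  "interaction i j \<phi> w = cint 1 (\<lambda>u. cnj (szego i \<phi> u) * coupling_kernel i j \<phi> u w)"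

lemma continuous_szego: "j \<in> {1..n} \<Longrightarrow> continuous_on (sphere 0 1) (szego j \<phi>)"
  by (rule continuous_on_subset[OF holomorphic_on_imp_continuous_on[OF szego_holomorphic]]) auto

lemma continuous_coupling_kernel_u:
  assumes "i \<in> {1..n}" "j \<in> {1..n}" "norm w \<le> 1"
  shows "continuous_on (sphere 0 1) (\<lambda>u. coupling_kernel i j \<phi> u w)"
  by (rule continuous_on_rel_compose3[OF continuous_coupling_kernel[OF assms(1,2)]])
     (use assms(3) in \<open>auto intro!: continuous_intros\<close>)

lemma cint_coupling_bound:
  assumes i: "i \<in> {1..n}" and j: "j \<in> {1..n}" and w: "norm w \<le> 1"
    and h: "continuous_on (sphere 0 1) h" "\<And>u. norm u = 1 \<Longrightarrow> norm (h u) \<le> B"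
  shows "norm (cint 1 (\<lambda>u. cnj (h u) * coupling_kernel i j \<phi> u w)) \<le> B * kernel_bound i j"
proof -
  have B: "B \<ge> 0" using h(2)[of 1] norm_ge_zero order_trans by (metis norm_one)
  have "norm (cint 1 (\<lambda>u. cnj (h u) * coupling_kernel i j \<phi> u w)) \<le> 1 * (B * kernel_bound i j)"
  proof (rule norm_cint_le)
    show "continuous_on (sphere 0 1) (\<lambda>u. cnj (h u) * coupling_kernel i j \<phi> u w)"
      by (intro continuous_intros h continuous_coupling_kernel_u[OF i j w])
    show "norm (cnj (h u) * coupling_kernel i j \<phi> u w) \<le> B * kernel_bound i j" if "norm u = 1" for u
      unfolding norm_mult complex_mod_cnj
      by (rule mult_mono[OF h(2)[OF that] coupling_kernel_bound[OF i j that w] B]) simp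
  qed simp
  then show ?thesis by simp
qed

lemma interaction_bound:
  assumes "i \<in> {1..n}" "j \<in> {1..n}" "norm w \<le> 1"
  shows "norm (interaction i j \<phi> w) \<le> 18 / 5 * kernel_bound i j"
  unfolding interaction_def
  by (rule cint_coupling_bound[OF assms continuous_szego[OF assms(1)] szego_bound[OF assms(1)]])

text \<open>The bound is below 1, so the centre value has positive real part; at a self-conjugate
  pole, where it is real, its square is then positive.\<close>

lemma szego_0_near_1:
  assumes j: "j \<in> {1..n}" shows "norm (szego j \<phi> 0 - 1) \<le> 9 / 10"
proof -
  have "szego j \<phi> 0 - 1 = - (\<Sum>i=1..n. interaction i j \<phi> 0)"
    using szego_eq[OF j, of 0] by (simp add: sp.root_0 interaction_def)
  then have "norm (szego j \<phi> 0 - 1) = norm (\<Sum>i=1..n. interaction i j \<phi> 0)" by simp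
  also have "\<dots> \<le> (\<Sum>i=1..n. 18 / 5 * kernel_bound i j)"
    by (rule sum_norm_le) (use interaction_bound j in auto)
  also have "\<dots> = 18 / 5 * (\<Sum>i=1..n. kernel_bound i j)" by (simp add: sum_distrib_left)
  also have "\<dots> \<le> 18 / 5 * (1 / 4)" by (rule mult_left_mono[OF kernel_bound_sum[OF j]]) simp
  finally show ?thesis by simp
qed

text \<open>A constant density does not interact with the other holes.\<close>
lemma cint_coupling_kernel_0:
  assumes i: "i \<in> {1..n}" and j: "j \<in> {1..n}" and ne: "i \<noteq> j" and w: "norm w \<le> 1"
  shows "cint 1 (\<lambda>u. coupling_kernel i j \<phi> u w) = 0"
proof (rule cint_holomorphic)
  show "(\<lambda>u. coupling_kernel i j \<phi> u w) holomorphic_on ball 0 2"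
    unfolding coupling_kernel_def using ne Z_distinct[OF i j ne, of _ w] w
    by (simp, intro holomorphic_intros sp.holomorphic_root[OF i] sp.holomorphic_branch[OF i]) auto
qed auto

text \<open>By \<open>cint_coupling_kernel_0\<close> the constant 1 may be subtracted from the
  density, so only its deviation acts. This tames the hole of residue 1, whose kernel is not
  small.\<close>

lemma interaction_bound_near_1:
  assumes ij: "i \<in> {1..n}" "j \<in> {1..n}" "i \<noteq> j" and w: "norm w \<le> 1"
    and B: "\<And>u. norm u = 1 \<Longrightarrow> norm (szego i \<phi> u - 1) \<le> B"
  shows "norm (interaction i j \<phi> w) \<le> B * kernel_bound i j"
proof -
  let ?k = "\<lambda>u. coupling_kernel i j \<phi> u w"
  have k: "continuous_on (sphere 0 1) ?k" by (rule continuous_coupling_kernel_u[OF ij(1,2) w])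
  have "interaction i j \<phi> w = cint 1 (\<lambda>u. cnj (szego i \<phi> u - 1) * ?k u + ?k u)"
    unfolding interaction_def by (rule cint_cong) (simp_all add: algebra_simps)
  also have "\<dots> = cint 1 (\<lambda>u. cnj (szego i \<phi> u - 1) * ?k u)"
    using cint_coupling_kernel_0[OF ij w, of \<phi>]
    by (subst cint_add) (auto intro!: continuous_intros continuous_szego[OF ij(1)] k)
  finally show ?thesis
    using cint_coupling_bound[where h = "\<lambda>u. szego i \<phi> u - 1" and \<phi> = \<phi>, OF ij(1,2) w _ B]
    by (simp add: continuous_on_diff continuous_szego[OF ij(1)])
qed

text \<open>On the annulus the self kernel is the explicit quotient, so \<open>szego_eq\<close>
  becomes \<open>F_eq\<close>.\<close>

lemma ahlfors_if_real:
  assumes "\<And>j. j \<in> {1..n} \<Longrightarrow> Im (A \<phi> j * (szego j \<phi> 0)\<^sup>2) = 0"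
    and "\<And>j. j \<in> {1..n} \<Longrightarrow> Re (A \<phi> j * (szego j \<phi> 0)\<^sup>2) > 0"
  shows "rational_ahlfors_function n (pf_map n (A \<phi>) p)"
proof -
  interpret szego_solution n "A \<phi>" p \<delta> t "\<lambda>j. szego j \<phi>"
  proof
    fix j and w :: complex assume j: "j \<in> {1..n}" and w: "1 < norm w" "norm w < 3 / 2"
    have self: "interaction j j \<phi> w = norm (A \<phi> j) / A \<phi> j *
        cint 1 (\<lambda>u. cnj (szego j \<phi> u) * ((ef \<phi> j u * ef \<phi> j w * qf \<phi> j u w - 1) / (u - w)))"
    proof -
      have "interaction j j \<phi> w = cint 1 (\<lambda>u. norm (A \<phi> j) / A \<phi> j *
          (cnj (szego j \<phi> u) * ((ef \<phi> j u * ef \<phi> j w * qf \<phi> j u w - 1) / (u - w))))"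
        unfolding interaction_def
      proof (rule cint_cong)
        fix u :: complex assume u: "norm u = 1"
        have "self_kernel n (A \<phi>) p \<delta> j u w = (ef \<phi> j u * ef \<phi> j w * qf \<phi> j u w - 1) / (u - w)"
          by (rule sp.self_kernel_props(2)[OF j u w(2)]) (use u w in auto)
        then show "cnj (szego j \<phi> u) * coupling_kernel j j \<phi> u w = norm (A \<phi> j) / A \<phi> j *
          (cnj (szego j \<phi> u) * ((ef \<phi> j u * ef \<phi> j w * qf \<phi> j u w - 1) / (u - w)))"
          by (simp add: coupling_kernel_def norm_A[OF j])
      qed simp
      then show ?thesis by (simp only: cint_cmult)
    qed
    have other: "interaction i j \<phi> w = norm (A \<phi> i) *
        cint 1 (\<lambda>u. cnj (szego i \<phi> u) * (ef \<phi> i u * ef \<phi> j w / (Zf \<phi> i u - Zf \<phi> j w)))"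
      if i: "i \<in> {1..n} - {j}" for i
    proof -
      have "interaction i j \<phi> w = cint 1 (\<lambda>u. norm (A \<phi> i) *
          (cnj (szego i \<phi> u) * (ef \<phi> i u * ef \<phi> j w / (Zf \<phi> i u - Zf \<phi> j w))))"
        unfolding interaction_def
        by (rule cint_cong) (use i norm_A[of i \<phi>] in \<open>auto simp: coupling_kernel_def\<close>)
      then show ?thesis by (simp only: cint_cmult)
    qed
    have "szego j \<phi> w = ef \<phi> j w - (\<Sum>i=1..n. interaction i j \<phi> w)"
      using szego_eq[OF j w(2)] by (simp add: interaction_def)
    also have "(\<Sum>i=1..n. interaction i j \<phi> w)
        = interaction j j \<phi> w + (\<Sum>i\<in>{1..n} - {j}. interaction i j \<phi> w)"
      using j by (simp add: sum.remove)
    also have "(\<Sum>i\<in>{1..n} - {j}. interaction i j \<phi> w) = (\<Sum>i\<in>{1..n} - {j}. norm (A \<phi> i) *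
        cint 1 (\<lambda>u. cnj (szego i \<phi> u) * (ef \<phi> i u * ef \<phi> j w / (Zf \<phi> i u - Zf \<phi> j w))))"
      by (rule sum.cong) (use other in auto)
    finally show "szego j \<phi> w = ef \<phi> j w
        - (\<Sum>i\<in>{1..n} - {j}. norm (A \<phi> i) * cint 1 (\<lambda>u. cnj (szego i \<phi> u) * (ef \<phi> i u * ef \<phi> j w / (Zf \<phi> i u - Zf \<phi> j w))))
        - norm (A \<phi> j) / A \<phi> j * cint 1 (\<lambda>u. cnj (szego j \<phi> u) * ((ef \<phi> j u * ef \<phi> j w * qf \<phi> j u w - 1) / (u - w)))"
      unfolding self by (simp add: of_real_sum)
  qed (use szego_holomorphic assms in auto)
  show ?thesis by (rule ahlfors_R)
qed

end

section \<open>Reflection in the real axis\<close>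

locale mirrored_pole_family = pole_family +
  fixes \<sigma> :: "nat \<Rightarrow> nat"
  assumes \<sigma>_in: "\<And>j. j \<in> {1..n} \<Longrightarrow> \<sigma> j \<in> {1..n}" and \<sigma>_\<sigma>: "\<And>j. \<sigma> (\<sigma> j) = j"
    and p_\<sigma>: "\<And>j. j \<in> {1..n} \<Longrightarrow> p (\<sigma> j) = cnj (p j)"
    and \<delta>_\<sigma>: "\<And>j. j \<in> {1..n} \<Longrightarrow> \<delta> (\<sigma> j) = \<delta> j"
    and A_\<sigma>: "\<And>j \<phi>. j \<in> {1..n} \<Longrightarrow> A \<phi> (\<sigma> j) = cnj (A \<phi> j)"
begin

lemma \<sigma>_eq_iff: "\<sigma> i = \<sigma> j \<longleftrightarrow> i = j" by (metis \<sigma>_\<sigma>)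

lemma sum_\<sigma>: "(\<Sum>k\<in>{1..n}. g (\<sigma> k)) = (\<Sum>k\<in>{1..n}. (g k :: complex))"
  by (rule sum.reindex_bij_witness[of _ \<sigma> \<sigma>]) (use \<sigma>_in \<sigma>_\<sigma> in auto)

lemma sum_\<sigma>_remove:
  "j \<in> {1..n} \<Longrightarrow> (\<Sum>k\<in>{1..n} - {\<sigma> j}. g k) = (\<Sum>k\<in>{1..n} - {j}. (g (\<sigma> k) :: complex))"
  by (rule sum.reindex_bij_witness[of _ \<sigma> \<sigma>]) (use \<sigma>_in \<sigma>_\<sigma> in \<open>auto simp del: atLeastAtMost_iff, metis+\<close>)

lemma other_poles_mirror:
  assumes "j \<in> {1..n}"
  shows "other_poles n (A \<phi>) p (\<sigma> j) (cnj z) = cnj (other_poles n (A \<phi>) p j z)"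
  unfolding other_poles_def sum_\<sigma>_remove[OF assms] cnj_sum
  by (rule sum.cong) (auto simp: A_\<sigma> p_\<sigma>)

lemma other_slope_mirror:
  assumes "j \<in> {1..n}"
  shows "other_slope n (A \<phi>) p (\<sigma> j) (cnj z) (cnj w) = cnj (other_slope n (A \<phi>) p j z w)"
  unfolding other_slope_def sum_\<sigma>_remove[OF assms] cnj_sum
  by (rule sum.cong) (auto simp: A_\<sigma> p_\<sigma>)

lemma branch_mirror:
  assumes j: "j \<in> {1..n}" and u: "norm u \<le> 2"
  shows "Zf \<phi> (\<sigma> j) (cnj u) = cnj (Zf \<phi> j u)"
proof (rule sp.branch_unique[OF \<sigma>_in[OF j]])
  have "dist (cnj (p j)) (cnj (Zf \<phi> j u)) = dist (p j) (Zf \<phi> j u)"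
    by (simp add: dist_norm flip: complex_cnj_diff)
  then show "cnj (Zf \<phi> j u) \<in> cball (p (\<sigma> j)) (\<delta> (\<sigma> j))"
    using sp.branch_in[OF j u, of \<phi>] by (simp add: p_\<sigma>[OF j] \<delta>_\<sigma>[OF j])
  have "cnj (Zf \<phi> j u) = cnj (p j + A \<phi> j * u / (1 - u * other_poles n (A \<phi>) p j (Zf \<phi> j u)))"
    unfolding branch_denom_def[symmetric] by (rule arg_cong[OF sp.branch_eq[OF j u]])
  then show "cnj (Zf \<phi> j u) = p (\<sigma> j) + A \<phi> (\<sigma> j) * cnj u /
      (1 - cnj u * other_poles n (A \<phi>) p (\<sigma> j) (cnj (Zf \<phi> j u)))"
    unfolding p_\<sigma>[OF j] A_\<sigma>[OF j] other_poles_mirror[OF j] by simp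
qed (use u in simp)

lemma denom_mirror:
  "j \<in> {1..n} \<Longrightarrow> norm u \<le> 2 \<Longrightarrow> yf \<phi> (\<sigma> j) (cnj u) = cnj (yf \<phi> j u)"
  by (simp add: branch_denom_def branch_mirror other_poles_mirror)

lemma quot_mirror:
  "j \<in> {1..n} \<Longrightarrow> norm u \<le> 2 \<Longrightarrow> norm w \<le> 2 \<Longrightarrow> qf \<phi> (\<sigma> j) (cnj u) (cnj w) = cnj (qf \<phi> j u w)"
  by (simp add: branch_quot_def denom_mirror branch_mirror other_slope_mirror A_\<sigma>)

lemma root_mirror:
  assumes j: "j \<in> {1..n}" and u: "norm u \<le> 2"
  shows "ef \<phi> (\<sigma> j) (cnj u) = cnj (ef \<phi> j u)"
proof -
  let ?a = "1 + A \<phi> j * u\<^sup>2 * other_slope n (A \<phi>) p j (Zf \<phi> j u) (Zf \<phi> j u) / (yf \<phi> j u)\<^sup>2"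
  have "?a \<notin> \<real>\<^sub>\<le>\<^sub>0" using sp.root_arg_pos[OF assms, of \<phi>] by (auto simp: complex_nonpos_Reals_iff)
  then have "csqrt (cnj ?a) = cnj (csqrt ?a)" by (simp add: cnj_csqrt)
  then show ?thesis
    using assms by (simp add: branch_root_def denom_mirror branch_mirror other_slope_mirror A_\<sigma>)
qed

lemma self_kernel_mirror:
  assumes j: "j \<in> {1..n}" and u: "norm u = 1"
  shows "self_kernel n (A \<phi>) p \<delta> (\<sigma> j) (cnj u) (cnj w) = cnj (self_kernel n (A \<phi>) p \<delta> j u w)"
proof -
  let ?h = "\<lambda>v. (ef \<phi> j u * ef \<phi> j v * qf \<phi> j u v - 1) / (u - v) / (v - w)"
  have "self_kernel n (A \<phi>) p \<delta> (\<sigma> j) (cnj u) (cnj w) = cint (3 / 2) (\<lambda>v. cnj (?h (cnj v)))"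
    unfolding self_kernel_def
  proof (rule cint_cong)
    fix v :: complex assume v: "norm v = 3 / 2"
    have "ef \<phi> (\<sigma> j) v = cnj (ef \<phi> j (cnj v))" "qf \<phi> (\<sigma> j) (cnj u) v = cnj (qf \<phi> j u (cnj v))"
      using root_mirror[OF j, of "cnj v"] quot_mirror[OF j, of u "cnj v"] u v by auto
    then show "(ef \<phi> (\<sigma> j) (cnj u) * ef \<phi> (\<sigma> j) v * qf \<phi> (\<sigma> j) (cnj u) v - 1) / (cnj u - v) / (v - cnj w)
        = cnj (?h (cnj v))"
      using root_mirror[OF j, of u] u by simp
  qed simp
  also have "\<dots> = cnj (self_kernel n (A \<phi>) p \<delta> j u w)"
    unfolding self_kernel_def by (rule cint_cnj_symmetric)
  finally show ?thesis .
qed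

lemma coupling_kernel_mirror:
  assumes i: "i \<in> {1..n}" and j: "j \<in> {1..n}" and u: "norm u = 1" and w: "norm w \<le> 1"
  shows "coupling_kernel (\<sigma> i) (\<sigma> j) \<phi> (cnj u) (cnj w) = cnj (coupling_kernel i j \<phi> u w)"
proof -
  have \<alpha>: "\<alpha> (\<sigma> k) = \<alpha> k" if "k \<in> {1..n}" for k
    using norm_A[OF that, of \<phi>] norm_A[OF \<sigma>_in[OF that], of \<phi>] A_\<sigma>[OF that, of \<phi>] by simp
  show ?thesis
    using self_kernel_mirror[OF j u, of \<phi> w] root_mirror[OF i, of u] root_mirror[OF j, of w]
      branch_mirror[OF i, of u] branch_mirror[OF j, of w] u w
    by (simp add: coupling_kernel_def \<sigma>_eq_iff \<alpha>[OF i] \<alpha>[OF j] A_\<sigma>[OF j])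
qed

text \<open>The reflected and conjugated densities satisfy the same equation, because roots and
  kernels are mirror symmetric; on the circle the solution is unique.\<close>

lemma szego_mirror:
  assumes j: "j \<in> {1..n}" and w: "norm w = 1"
  shows "cnj (szego (\<sigma> j) \<phi> (cnj w)) = szego j \<phi> w"
proof (rule antilinear_fixed_point_unique[where I = "{1..n}" and k = "\<lambda>i j u w. coupling_kernel i j \<phi> u w"
      and \<kappa> = kernel_bound and G = "\<lambda>j w. cnj (szego (\<sigma> j) \<phi> (cnj w))" and H = "\<lambda>j w. szego j \<phi> w"
      and b = "\<lambda>j w. ef \<phi> j w"])
  fix j assume j: "j \<in> {1..n}"
  show "continuous_on (sphere 0 1) (\<lambda>w. cnj (szego (\<sigma> j) \<phi> (cnj w)))"
    by (intro continuous_intros continuous_on_compose2[OF continuous_szego[OF \<sigma>_in[OF j]]]) auto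
  show "(\<Sum>i\<in>{1..n}. kernel_bound i j) \<le> 1 / 2" using kernel_bound_sum[OF j] by simp
  fix w :: complex assume w: "norm w = 1"
  show "szego j \<phi> w = ef \<phi> j w - (\<Sum>i=1..n. cint 1 (\<lambda>u. cnj (szego i \<phi> u) * coupling_kernel i j \<phi> u w))"
    by (rule szego_eq[OF j]) (use w in simp)
  have cw: "norm (cnj w) < 3 / 2" using w by simp
  have "cnj (szego (\<sigma> j) \<phi> (cnj w)) = cnj (ef \<phi> (\<sigma> j) (cnj w))
      - (\<Sum>i=1..n. cnj (cint 1 (\<lambda>u. cnj (szego i \<phi> u) * coupling_kernel i (\<sigma> j) \<phi> u (cnj w))))"
    using szego_eq[OF \<sigma>_in[OF j] cw, of \<phi>] by simp
  also have "cnj (ef \<phi> (\<sigma> j) (cnj w)) = ef \<phi> j w" using root_mirror[OF j, of w] w by simp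
  also have "(\<Sum>i=1..n. cnj (cint 1 (\<lambda>u. cnj (szego i \<phi> u) * coupling_kernel i (\<sigma> j) \<phi> u (cnj w))))
      = (\<Sum>i=1..n. cnj (cint 1 (\<lambda>u. cnj (szego (\<sigma> i) \<phi> u) * coupling_kernel (\<sigma> i) (\<sigma> j) \<phi> u (cnj w))))"
    by (rule sum_\<sigma>[symmetric])
  also have "\<dots> = (\<Sum>i=1..n. cint 1 (\<lambda>u. cnj (cnj (szego (\<sigma> i) \<phi> (cnj u))) * coupling_kernel i j \<phi> u w))"
  proof (rule sum.cong)
    fix i assume i: "i \<in> {1..n}"
    have "cnj (cint 1 (\<lambda>u. cnj (szego (\<sigma> i) \<phi> u) * coupling_kernel (\<sigma> i) (\<sigma> j) \<phi> u (cnj w)))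
      = cint 1 (\<lambda>u. cnj (cnj (szego (\<sigma> i) \<phi> (cnj u)) * coupling_kernel (\<sigma> i) (\<sigma> j) \<phi> (cnj u) (cnj w)))"
      by (rule cint_cnj_symmetric[symmetric])
    also have "\<dots> = cint 1 (\<lambda>u. cnj (cnj (szego (\<sigma> i) \<phi> (cnj u))) * coupling_kernel i j \<phi> u w)"
      by (rule cint_cong) (use coupling_kernel_mirror[OF i j] w in auto)
    finally show "cnj (cint 1 (\<lambda>u. cnj (szego (\<sigma> i) \<phi> u) * coupling_kernel (\<sigma> i) (\<sigma> j) \<phi> u (cnj w)))
      = cint 1 (\<lambda>u. cnj (cnj (szego (\<sigma> i) \<phi> (cnj u))) * coupling_kernel i j \<phi> u w)" .
  qed simp
  finally show "cnj (szego (\<sigma> j) \<phi> (cnj w)) = ef \<phi> j w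
      - (\<Sum>i=1..n. cint 1 (\<lambda>u. cnj (cnj (szego (\<sigma> i) \<phi> (cnj u))) * coupling_kernel i j \<phi> u w))" .
next
  fix i j w assume "i \<in> {1..n}" "j \<in> {1..n}" "norm (w::complex) = 1"
  then show "continuous_on (sphere 0 1) (\<lambda>u. coupling_kernel i j \<phi> u w)"
    by (intro continuous_coupling_kernel_u) auto
next
  fix i j u w assume "i \<in> {1..n}" "j \<in> {1..n}" "norm (u::complex) = 1" "norm (w::complex) = 1"
  then show "norm (coupling_kernel i j \<phi> u w) \<le> kernel_bound i j"
    by (intro coupling_kernel_bound) auto
qed (use j w continuous_szego in auto)

text \<open>The mean value formula carries the symmetry from the circle to the centre.\<close>

lemma szego_0_mirror:
  assumes j: "j \<in> {1..n}" shows "szego (\<sigma> j) \<phi> 0 = cnj (szego j \<phi> 0)"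
proof -
  have mean: "szego i \<phi> 0 = cint 1 (\<lambda>u. szego i \<phi> u / u)" if "i \<in> {1..n}" for i
    using cint_Cauchy[OF szego_holomorphic[OF that], of 1 0] by simp
  have "szego (\<sigma> j) \<phi> 0 = cint 1 (\<lambda>u. cnj (szego j \<phi> (cnj u) / cnj u))"
    unfolding mean[OF \<sigma>_in[OF j]]
  proof (rule cint_cong)
    fix u :: complex assume u: "norm u = 1"
    then have "szego (\<sigma> j) \<phi> u = cnj (szego j \<phi> (cnj u))"
      using szego_mirror[OF j, of "cnj u" \<phi>] by (metis complex_cnj_cnj complex_mod_cnj)
    then show "szego (\<sigma> j) \<phi> u / u = cnj (szego j \<phi> (cnj u) / cnj u)" by simp
  qed simp
  also have "\<dots> = cnj (cint 1 (\<lambda>u. szego j \<phi> u / u))" by (rule cint_cnj_symmetric)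
  finally show ?thesis using mean[OF j] by simp
qed

text \<open>The conditions at \<open>j0\<close> and at its mirror image are conjugate to each other.
  At a self-conjugate pole the residue and the centre value are real and the latter is nonzero, so
  positivity of the residue is enough.\<close>

lemma ahlfors_if_real_at:
  assumes j0: "j0 \<in> {1..n}" "Im (A \<phi> j0 * (szego j0 \<phi> 0)\<^sup>2) = 0" "Re (A \<phi> j0 * (szego j0 \<phi> 0)\<^sup>2) > 0"
    and pos: "\<And>j. j \<in> {1..n} \<Longrightarrow> j \<noteq> j0 \<Longrightarrow> j \<noteq> \<sigma> j0 \<Longrightarrow> \<sigma> j = j \<and> Re (A \<phi> j) > 0"
  shows "rational_ahlfors_function n (pf_map n (A \<phi>) p)"
proof -
  have "Im (A \<phi> j * (szego j \<phi> 0)\<^sup>2) = 0 \<and> Re (A \<phi> j * (szego j \<phi> 0)\<^sup>2) > 0" if j: "j \<in> {1..n}" for j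
  proof -
    consider "j = j0" | "j = \<sigma> j0" | "j \<noteq> j0" "j \<noteq> \<sigma> j0" by blast
    then show ?thesis
    proof cases
      case 1
      then show ?thesis using j0 by simp
    next
      case 2
      have "A \<phi> j * (szego j \<phi> 0)\<^sup>2 = cnj (A \<phi> j0 * (szego j0 \<phi> 0)\<^sup>2)"
        using 2 A_\<sigma>[OF j0(1)] szego_0_mirror[OF j0(1)] by simp
      then have "Im (A \<phi> j * (szego j \<phi> 0)\<^sup>2) = - Im (A \<phi> j0 * (szego j0 \<phi> 0)\<^sup>2)"
        "Re (A \<phi> j * (szego j \<phi> 0)\<^sup>2) = Re (A \<phi> j0 * (szego j0 \<phi> 0)\<^sup>2)"
        by (simp_all only: cnj.simps)
      then show ?thesis using j0(2,3) by linarith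
    next
      case 3
      have inv: "\<sigma> j = j" and A: "Re (A \<phi> j) > 0" using pos[OF j 3] by auto
      have "Im (szego j \<phi> 0) = 0" "Im (A \<phi> j) = 0"
        using szego_0_mirror[OF j, of \<phi>] A_\<sigma>[OF j, of \<phi>] inv by (auto simp: complex_eq_iff)
      moreover have "Re (szego j \<phi> 0) \<noteq> 0"
        using szego_0_near_1[OF j, of \<phi>] abs_Re_le_cmod[of "szego j \<phi> 0 - 1"] by auto
      then have "Re (szego j \<phi> 0) * Re (szego j \<phi> 0) > 0"
        using not_real_square_gt_zero by blast
      ultimately show ?thesis using A by (simp add: power2_eq_square mult_pos_pos)
    qed
  qed
  then show ?thesis by (intro ahlfors_if_real) auto
qed

end

section \<open>An example with nonreal residues\<close>

text \<open>
  The poles \<open>20 \<plusminus> \<i> * ex_eta\<close> interact to order \<open>ex_eps / ex_eta\<close>, while all error terms are of order \<open>ex_eps\<close>.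
\<close>
definition ex_eps :: real where "ex_eps = 1 / 10 ^ 18"
definition ex_eta :: real where "ex_eta = 1 / 10 ^ 6"

definition ex_pole :: "nat \<Rightarrow> complex" where
  "ex_pole k = (if k = 1 then 0 else if k = 2 then Complex 20 ex_eta
     else if k = 3 then Complex 20 (- ex_eta) else Complex (20 * (real k - 2)) 0)"

text \<open>The residues \<open>ex_eps / n\<close> of the further poles add up to less than
  \<open>ex_eps\<close>, which makes the estimates uniform in \<open>n\<close>.\<close>

definition ex_res :: "nat \<Rightarrow> real \<Rightarrow> nat \<Rightarrow> complex" where
  "ex_res n \<phi> k = (if k = 1 then 1 else if k = 2 then ex_eps * cis \<phi>
     else if k = 3 then ex_eps * cis (- \<phi>) else of_real (ex_eps / n))"

definition ex_weight :: "nat \<Rightarrow> nat \<Rightarrow> real" where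
  "ex_weight n k = (if k = 1 then 1 else if k = 2 \<or> k = 3 then ex_eps else ex_eps / n)"

text \<open>Radius 3 exceeds the 8 / 3 demanded by residue 1; half of \<open>ex_eta\<close> leaves a
  gap of \<open>ex_eta\<close> between the discs of the pair, whose centres are
  \<open>2 * ex_eta\<close> apart.\<close>

definition ex_rad :: "nat \<Rightarrow> real" where
  "ex_rad k = (if k = 1 then 3 else if k = 2 \<or> k = 3 then ex_eta / 2 else 1)"

text \<open>Lower bounds for the distances of the discs. Outside the pair, centres are at least 20
  apart and two radii add up to at most 4.\<close>

definition ex_gap :: "nat \<Rightarrow> nat \<Rightarrow> real" where
  "ex_gap i j = (if i = 2 \<and> j = 3 \<or> i = 3 \<and> j = 2 then ex_eta else 16)"

definition ex_swap :: "nat \<Rightarrow> nat" where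
  "ex_swap k = (if k = 2 then 3 else if k = 3 then 2 else k)"

lemma ex_eps_pos: "ex_eps > 0" and ex_eta_pos: "ex_eta > 0"
  by (simp_all add: ex_eps_def ex_eta_def)

lemma ex_gap_pos: "ex_gap i j > 0"
  using ex_eta_pos by (simp add: ex_gap_def)

lemma ex_weight_nonneg: "ex_weight n k \<ge> 0"
  using ex_eps_pos by (simp add: ex_weight_def)

lemma ex_pole_dist:
  assumes "i \<ge> 1" "j \<ge> 1" "i \<noteq> j"
  shows "ex_gap i j + ex_rad i + ex_rad j \<le> norm (ex_pole i - ex_pole j)"
proof (cases "i = 2 \<and> j = 3 \<or> i = 3 \<and> j = 2")
  case True
  then have "\<bar>Im (ex_pole i - ex_pole j)\<bar> = 2 * ex_eta"
    using ex_eta_pos by (elim disjE conjE) (simp_all add: ex_pole_def)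
  then have "2 * ex_eta \<le> norm (ex_pole i - ex_pole j)" by (metis abs_Im_le_cmod)
  moreover have "ex_gap i j = ex_eta" "ex_rad i = ex_eta / 2" "ex_rad j = ex_eta / 2"
    using True by (elim disjE conjE; simp add: ex_gap_def ex_rad_def)+
  ultimately show ?thesis by linarith
next
  case False
  \<comment> \<open>The column of a pole: real parts are multiples of 20, and only the pair shares
    one.\<close>
  define m where "m k = (if k = 1 then 0 else if k = 2 \<or> k = 3 then 1 else int k - 2)" for k :: nat
  have re: "Re (ex_pole k) = 20 * of_int (m k)" for k
    by (auto simp: ex_pole_def m_def)
  have "m i \<noteq> m j" using False assms by (auto simp: m_def split: if_splits)
  then have "\<bar>m i - m j\<bar> \<ge> 1" by linarith
  then have "\<bar>of_int (m i) - of_int (m j) :: real\<bar> \<ge> 1" by linarith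
  then have "20 \<le> \<bar>Re (ex_pole i - ex_pole j)\<bar>" by (simp add: re)
  also have "\<dots> \<le> norm (ex_pole i - ex_pole j)" by (rule abs_Re_le_cmod)
  finally have "20 \<le> norm (ex_pole i - ex_pole j)" .
  moreover have "ex_gap i j = 16" using False by (auto simp: ex_gap_def)
  moreover have "ex_rad i + ex_rad j \<le> 4"
    using assms by (auto simp: ex_rad_def ex_eta_def)
  ultimately show ?thesis by linarith
qed

lemma ex_gap_le:
  assumes "i \<ge> 1" "j \<ge> 1" "i \<noteq> j" "z \<in> cball (ex_pole i) (ex_rad i)" "w \<in> cball (ex_pole j) (ex_rad j)"
  shows "ex_gap i j \<le> norm (z - w)"
proof -
  have "dist (ex_pole i) (ex_pole j) \<le> dist (ex_pole i) z + dist z w + dist w (ex_pole j)"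
    using dist_triangle[of "ex_pole i" "ex_pole j" z] dist_triangle[of z "ex_pole j" w] by linarith
  moreover have "dist (ex_pole i) z \<le> ex_rad i" "dist w (ex_pole j) \<le> ex_rad j"
    using assms(4,5) by (auto simp: dist_commute)
  ultimately show ?thesis
    using ex_pole_dist[OF assms(1-3)] unfolding dist_norm[symmetric] by linarith
qed

lemma sum_split_3:
  fixes f :: "nat \<Rightarrow> 'a::comm_monoid_add"
  assumes "n \<ge> 3"
  shows "(\<Sum>k=1..n. f k) = f 1 + f 2 + f 3 + (\<Sum>k=4..n. f k)"
proof -
  have "{1..n} = insert 1 (insert 2 (insert 3 {4..n}))" using assms by auto
  then show ?thesis by (simp add: add.assoc)
qed

text \<open>The first three values enter individually; the remaining ones, at most
  \<open>n - 3\<close> with weight \<open>ex_eps / n\<close> each, contribute at most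
  \<open>ex_eps * X\<close>.\<close>

lemma ex_weighted_sum:
  assumes n: "n \<ge> 3" and x: "\<And>k. x k \<ge> 0" "\<And>k. k \<ge> 4 \<Longrightarrow> x k \<le> X" and X: "X \<ge> 0"
  shows "(\<Sum>k\<in>{1..n} - {j}. ex_weight n k * x k)
    \<le> (if j = 1 then 0 else x 1) + ex_eps * (if j = 2 then 0 else x 2)
       + ex_eps * (if j = 3 then 0 else x 3) + ex_eps * X"
proof -
  define z where "z k = (if k = j then 0 else ex_weight n k * x k)" for k
  have "(\<Sum>k\<in>{1..n} - {j}. ex_weight n k * x k) = (\<Sum>k=1..n. z k)"
    by (rule sum.mono_neutral_cong_left) (auto simp: z_def)
  also have "\<dots> = z 1 + z 2 + z 3 + (\<Sum>k=4..n. z k)" by (rule sum_split_3[OF n])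
  finally have "(\<Sum>k\<in>{1..n} - {j}. ex_weight n k * x k) = z 1 + z 2 + z 3 + (\<Sum>k=4..n. z k)" .
  moreover have "(\<Sum>k=4..n. z k) \<le> (\<Sum>k=4..n. ex_eps / n * X)"
  proof (rule sum_mono)
    fix k assume k: "k \<in> {4..n}"
    have "ex_eps / n * x k \<le> ex_eps / n * X"
      by (rule mult_left_mono) (use x(2)[of k] k ex_eps_pos in auto)
    moreover have "0 \<le> ex_eps / n * X" using X ex_eps_pos by simp
    ultimately show "z k \<le> ex_eps / n * X" using k by (auto simp: z_def ex_weight_def)
  qed
  moreover have "(\<Sum>k=4..n. ex_eps / n * X) = (real (n - 3) / n) * (ex_eps * X)" by simp
  moreover have "(real (n - 3) / n) * (ex_eps * X) \<le> 1 * (ex_eps * X)"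
    by (rule mult_right_mono) (use n X ex_eps_pos in \<open>auto simp: divide_le_eq\<close>)
  moreover have "z 1 = (if j = 1 then 0 else x 1)" "z 2 = ex_eps * (if j = 2 then 0 else x 2)"
    "z 3 = ex_eps * (if j = 3 then 0 else x 3)"
    by (auto simp: z_def ex_weight_def)
  ultimately show ?thesis by simp
qed

lemma ex_weight_over_gap:
  assumes "n \<ge> 3" "j \<ge> 1"
  shows "(\<Sum>k\<in>{1..n} - {j}. ex_weight n k / ex_gap j k) \<le> (if j = 1 then ex_eps else 1 / 15)"
proof -
  have "(\<Sum>k\<in>{1..n} - {j}. ex_weight n k / ex_gap j k) = (\<Sum>k\<in>{1..n} - {j}. ex_weight n k * (1 / ex_gap j k))"
    by simp
  also have "\<dots> \<le> (if j = 1 then 0 else 1 / ex_gap j 1) + ex_eps * (if j = 2 then 0 else 1 / ex_gap j 2)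
       + ex_eps * (if j = 3 then 0 else 1 / ex_gap j 3) + ex_eps * (1 / 16)"
    by (rule ex_weighted_sum[OF assms(1)]) (use ex_gap_pos in \<open>auto simp: less_imp_le, simp add: ex_gap_def\<close>)
  \<comment> \<open>The main term is 1 / 16 from the pole at 0; the partner in the pair adds only
    \<open>ex_eps / ex_eta = 1 / 10 ^ 12\<close>. For \<open>j = 1\<close> all gaps are 16 and all
    weights tiny.\<close>
  also have "\<dots> \<le> (if j = 1 then ex_eps else 1 / 15)"
    by (auto simp: ex_gap_def ex_eps_def ex_eta_def)
  finally show ?thesis .
qed

lemma ex_weight_over_gap2:
  assumes "n \<ge> 3" "j \<ge> 1"
  shows "ex_weight n j * (\<Sum>k\<in>{1..n} - {j}. ex_weight n k / (ex_gap j k)\<^sup>2) \<le> ex_eps"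
proof -
  have "(\<Sum>k\<in>{1..n} - {j}. ex_weight n k / (ex_gap j k)\<^sup>2)
      = (\<Sum>k\<in>{1..n} - {j}. ex_weight n k * (1 / (ex_gap j k)\<^sup>2))"
    by simp
  also have "\<dots> \<le> (if j = 1 then 0 else 1 / (ex_gap j 1)\<^sup>2) + ex_eps * (if j = 2 then 0 else 1 / (ex_gap j 2)\<^sup>2)
       + ex_eps * (if j = 3 then 0 else 1 / (ex_gap j 3)\<^sup>2) + ex_eps * (1 / 256)"
    by (rule ex_weighted_sum[OF assms(1)]) (auto, simp add: ex_gap_def power2_eq_square)
  \<comment> \<open>Within the pair the partner contributes
    \<open>ex_eps / ex_eta^2 = 1 / 10 ^ 6\<close>; this is one reason to take \<open>ex_eps\<close>
    small against \<open>ex_eta^2\<close>.\<close>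
  also have "\<dots> \<le> (if j = 1 then ex_eps else 1)"
    by (auto simp: ex_gap_def ex_eps_def ex_eta_def power2_eq_square)
  finally have s: "(\<Sum>k\<in>{1..n} - {j}. ex_weight n k / (ex_gap j k)\<^sup>2) \<le> (if j = 1 then ex_eps else 1)" .
  have w: "ex_weight n j \<le> (if j = 1 then 1 else ex_eps)"
    using ex_eps_pos assms(1) by (auto simp: ex_weight_def divide_le_eq mult_le_cancel_left1)
  have "ex_weight n j * (\<Sum>k\<in>{1..n} - {j}. ex_weight n k / (ex_gap j k)\<^sup>2)
      \<le> (if j = 1 then 1 else ex_eps) * (if j = 1 then ex_eps else 1)"
    by (rule mult_mono[OF w s]) (use ex_eps_pos in \<open>auto intro!: sum_nonneg divide_nonneg_nonneg ex_weight_nonneg\<close>)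
  then show ?thesis by (auto split: if_splits)
qed

locale example_family =
  fixes n :: nat assumes n3: "n \<ge> 3"
begin

lemma norm_ex_res: "norm (ex_res n \<phi> k) = ex_weight n k"
  using ex_eps_pos by (simp add: ex_res_def ex_weight_def norm_mult norm_divide)

lemma ex_rad_pos: "ex_rad k > 0"
  using ex_eta_pos by (simp add: ex_rad_def)

lemma pole_gap:
  "j \<in> {1..n} \<Longrightarrow> k \<in> {1..n} - {j} \<Longrightarrow> z \<in> cball (ex_pole j) (ex_rad j) \<Longrightarrow> ex_gap j k \<le> norm (z - ex_pole k)"
  using ex_gap_le[of j k z "ex_pole k"] ex_rad_pos[of k] by simp

lemma pole_term:
  assumes "j \<in> {1..n}" "k \<in> {1..n} - {j}" "z \<in> cball (ex_pole j) (ex_rad j)"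
  shows "norm (ex_res n \<phi> k / (z - ex_pole k)) \<le> ex_weight n k / ex_gap j k"
  unfolding norm_divide norm_ex_res
  by (rule frac_le[OF ex_weight_nonneg order_refl ex_gap_pos pole_gap[OF assms]])

lemma separated: "separated_poles n (ex_res n \<phi>) ex_pole ex_rad (\<lambda>_. ex_eps)"
proof
  show "n > 0" using n3 by simp
  show "ex_res n \<phi> j \<noteq> 0" if "j \<in> {1..n}" for j
    using norm_ex_res[of \<phi> j] ex_eps_pos that by (auto simp: ex_weight_def split: if_splits)
  show "cball (ex_pole i) (ex_rad i) \<inter> cball (ex_pole j) (ex_rad j) = {}"
    if "i \<in> {1..n}" "j \<in> {1..n}" "i \<noteq> j" for i j
    using ex_gap_le[of i j] ex_gap_pos[of i j] that by fastforce
  show "norm (ex_res n \<phi> j) * (8 / 3) \<le> ex_rad j" if "j \<in> {1..n}" for j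
  proof -
    have "ex_eps / n \<le> ex_eps" using n3 ex_eps_pos by (simp add: divide_le_eq mult_le_cancel_left1)
    then show ?thesis
      unfolding norm_ex_res by (auto simp: ex_weight_def ex_rad_def ex_eps_def ex_eta_def)
  qed
  show "ex_eps \<le> 1 / 32" by (simp add: ex_eps_def)
next
  fix j z assume j: "j \<in> {1..n}" and z: "z \<in> cball (ex_pole j) (ex_rad j)"
  have "norm (other_poles n (ex_res n \<phi>) ex_pole j z) \<le> (\<Sum>k\<in>{1..n} - {j}. ex_weight n k / ex_gap j k)"
    unfolding other_poles_def
    by (rule sum_norm_le) (rule pole_term[OF j _ z])
  also have "\<dots> \<le> 1 / 8"
    using ex_weight_over_gap[OF n3, of j] j by (auto simp: ex_eps_def split: if_splits)
  finally show "norm (other_poles n (ex_res n \<phi>) ex_pole j z) \<le> 1 / 8" .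
next
  fix j z w assume j: "j \<in> {1..n}" and z: "z \<in> cball (ex_pole j) (ex_rad j)" "w \<in> cball (ex_pole j) (ex_rad j)"
  have "norm (other_slope n (ex_res n \<phi>) ex_pole j z w) \<le> (\<Sum>k\<in>{1..n} - {j}. ex_weight n k / (ex_gap j k)\<^sup>2)"
    unfolding other_slope_def
  proof (rule sum_norm_le)
    fix k assume k: "k \<in> {1..n} - {j}"
    have "(ex_gap j k)\<^sup>2 \<le> norm (z - ex_pole k) * norm (w - ex_pole k)"
      unfolding power2_eq_square
      by (rule mult_mono[OF pole_gap[OF j k z(1)] pole_gap[OF j k z(2)]]) (use ex_gap_pos in \<open>auto simp: less_imp_le\<close>)
    then show "norm (ex_res n \<phi> k / ((z - ex_pole k) * (w - ex_pole k))) \<le> ex_weight n k / (ex_gap j k)\<^sup>2"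
      unfolding norm_divide norm_mult norm_ex_res
      by (rule frac_le[OF ex_weight_nonneg order_refl, rotated]) (use ex_gap_pos[of j k] in simp)
  qed
  then have "norm (ex_res n \<phi> j * other_slope n (ex_res n \<phi>) ex_pole j z w)
      \<le> ex_weight n j * (\<Sum>k\<in>{1..n} - {j}. ex_weight n k / (ex_gap j k)\<^sup>2)"
    unfolding norm_mult norm_ex_res by (rule mult_left_mono) (rule ex_weight_nonneg)
  also have "\<dots> \<le> ex_eps" by (rule ex_weight_over_gap2[OF n3]) (use j in simp)
  finally show "norm (ex_res n \<phi> j * other_slope n (ex_res n \<phi>) ex_pole j z w) \<le> ex_eps" .
qed

lemma coupling_sum:
  assumes "j \<ge> 1"
  shows "(\<Sum>i\<in>{1..n} - {j}. ex_weight n i * (81 / 25) / ex_gap i j)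
    \<le> (81 / 25) * (if j = 1 then ex_eps else 1 / 15)"
proof -
  have "(\<Sum>i\<in>{1..n} - {j}. ex_weight n i * (81 / 25) / ex_gap i j)
      = (81 / 25) * (\<Sum>i\<in>{1..n} - {j}. ex_weight n i / ex_gap j i)"
    unfolding sum_distrib_left by (rule sum.cong) (auto simp: ex_gap_def)
  then show ?thesis using ex_weight_over_gap[OF n3 assms] by simp
qed

sublocale mirrored_pole_family n "ex_res n" ex_pole ex_rad "\<lambda>_. ex_eps" "ex_weight n" ex_gap ex_swap
proof (intro mirrored_pole_family.intro pole_family.intro mirrored_pole_family_axioms.intro)
  show "separated_poles n (ex_res n \<phi>) ex_pole ex_rad (\<lambda>_. ex_eps)" for \<phi> by (rule separated)
  show "norm (ex_res n \<phi> j) = ex_weight n j" for \<phi> j by (rule norm_ex_res)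
  show "continuous_on UNIV (\<lambda>\<phi>. ex_res n \<phi> j)" for j
    unfolding ex_res_def
    by (cases "j = 1"; cases "j = 2"; cases "j = 3") (simp_all, (intro continuous_intros)+)
  show "ex_gap i j \<le> norm (z - w)"
    if "i \<in> {1..n}" "j \<in> {1..n}" "i \<noteq> j" "z \<in> cball (ex_pole i) (ex_rad i)" "w \<in> cball (ex_pole j) (ex_rad j)"
    for i j z w by (rule ex_gap_le) (use that in auto)
  show "0 < ex_gap i j" for i j by (rule ex_gap_pos)
  \<comment> \<open>The largest case is \<open>(81 / 25) / 15 = 27 / 125\<close>, which leaves room
    below 1 / 4 for the self-interaction.\<close>
  show "(\<Sum>i\<in>{1..n} - {j}. ex_weight n i * (81 / 25) / ex_gap i j) + 384 * ex_eps \<le> 1 / 4"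
    if "j \<in> {1..n}" for j
    using coupling_sum[of j] that by (auto simp: ex_eps_def split: if_splits)
  show "ex_swap j \<in> {1..n}" if "j \<in> {1..n}" for j using that n3 by (auto simp: ex_swap_def)
  show "ex_swap (ex_swap j) = j" for j by (auto simp: ex_swap_def)
  show "ex_pole (ex_swap j) = cnj (ex_pole j)" for j
    by (auto simp: ex_swap_def ex_pole_def complex_eq_iff)
  show "ex_rad (ex_swap j) = ex_rad j" for j by (auto simp: ex_swap_def ex_rad_def)
  show "ex_res n \<phi> (ex_swap j) = cnj (ex_res n \<phi> j)" for \<phi> j
    by (auto simp: ex_swap_def ex_res_def cis_cnj)
qed

section \<open>Perturbation estimates for the close pair\<close>

lemma idx: "1 \<in> {1..n}" "2 \<in> {1..n}" "3 \<in> {1..n}"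
  using n3 by auto

text \<open>Seen from the pole at 0 all other residues are of order \<open>ex_eps\<close>: the root
  is off by at most \<open>13 * ex_eps\<close>, and the interactions add less than
  \<open>1395 * ex_eps\<close>.\<close>

lemma szego_1_near_1:
  assumes w: "norm w = 1"
  shows "norm (szego 1 \<phi> w - 1) \<le> 1500 * ex_eps"
proof -
  have w2: "norm w \<le> 2" using w by simp
  have "norm (yf \<phi> 1 w - 1) = norm (other_poles n (ex_res n \<phi>) ex_pole 1 (Zf \<phi> 1 w))"
    using w by (simp add: branch_denom_def norm_mult)
  also have "\<dots> \<le> (\<Sum>k\<in>{1..n} - {1}. ex_weight n k / ex_gap 1 k)"
    unfolding other_poles_def
    by (rule sum_norm_le) (rule pole_term[OF idx(1) _ sp.branch_in[OF idx(1) w2]])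
  also have "\<dots> \<le> ex_eps" using ex_weight_over_gap[OF n3, of 1] by simp
  finally have y: "norm (yf \<phi> 1 w - 1) \<le> ex_eps" .
  have "norm (ef \<phi> 1 w * (yf \<phi> 1 w - 1)) \<le> 9 / 5 * ex_eps"
    unfolding norm_mult by (rule mult_mono[OF sp.root_le[OF idx(1) w2] y]) auto
  moreover have "ef \<phi> 1 w - 1 = (ef \<phi> 1 w * yf \<phi> 1 w - 1) - ef \<phi> 1 w * (yf \<phi> 1 w - 1)"
    by (simp add: algebra_simps)
  then have "norm (ef \<phi> 1 w - 1) \<le> norm (ef \<phi> 1 w * yf \<phi> 1 w - 1) + norm (ef \<phi> 1 w * (yf \<phi> 1 w - 1))"
    using norm_triangle_ineq4 by metis
  ultimately have e: "norm (ef \<phi> 1 w - 1) \<le> 13 * ex_eps"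
    using sp.root_close[OF idx(1) w2, of \<phi>] ex_eps_pos by linarith
  have "norm (\<Sum>i=1..n. interaction i 1 \<phi> w) \<le> (\<Sum>i=1..n. 18 / 5 * kernel_bound i 1)"
    by (rule sum_norm_le) (use interaction_bound[OF _ idx(1)] w in auto)
  also have "\<dots> = 18 / 5 * (384 * ex_eps + (\<Sum>i\<in>{1..n} - {1}. ex_weight n i * (81 / 25) / ex_gap i 1))"
  proof -
    have "(\<Sum>i=1..n. kernel_bound i 1) = kernel_bound 1 1 + (\<Sum>i\<in>{1..n} - {1}. kernel_bound i 1)"
      using idx(1) by (intro sum.remove) auto
    also have "(\<Sum>i\<in>{1..n} - {1}. kernel_bound i 1) = (\<Sum>i\<in>{1..n} - {1}. ex_weight n i * (81 / 25) / ex_gap i 1)"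
      by (rule sum.cong) (auto simp: kernel_bound_def)
    also have "kernel_bound 1 1 = 384 * ex_eps" by (simp add: kernel_bound_def)
    finally show ?thesis by (simp only: sum_distrib_left[symmetric])
  qed
  also have "\<dots> \<le> 18 / 5 * (384 * ex_eps + 81 / 25 * ex_eps)"
    using coupling_sum[of 1] by simp
  finally have s: "norm (\<Sum>i=1..n. interaction i 1 \<phi> w) \<le> 18 / 5 * (384 * ex_eps + 81 / 25 * ex_eps)" .
  have "szego 1 \<phi> w - 1 = (ef \<phi> 1 w - 1) - (\<Sum>i=1..n. interaction i 1 \<phi> w)"
    using szego_eq[OF idx(1), of w \<phi>] w by (simp add: interaction_def)
  then have "norm (szego 1 \<phi> w - 1) \<le> norm (ef \<phi> 1 w - 1) + norm (\<Sum>i=1..n. interaction i 1 \<phi> w)"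
    using norm_triangle_ineq4 by metis
  moreover have "18 / 5 * (384 * ex_eps + 81 / 25 * ex_eps) = 174258 / 125 * ex_eps" by simp
  ultimately show ?thesis using e s ex_eps_pos by linarith
qed

text \<open>Everything but the partner is of order \<open>ex_eps\<close>. The residue 1 at 0 is no
  exception, as its density is almost constant. In units of \<open>ex_eps\<close>, it gives about
  304, the self-interaction 1382.4 and the further poles at most 1.\<close>

lemma szego_pair:
  assumes ij: "i = 2 \<and> j = 3 \<or> i = 3 \<and> j = 2" and w: "norm w \<le> 1"
  shows "norm (szego j \<phi> w - (ef \<phi> j w - interaction i j \<phi> w)) \<le> 1700 * ex_eps"
proof -
  have j: "j \<in> {1..n}" using ij idx by auto
  have 1: "norm (interaction 1 j \<phi> w) \<le> 1500 * ex_eps * kernel_bound 1 j"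
    by (rule interaction_bound_near_1[OF idx(1) j _ w szego_1_near_1]) (use ij in auto)
  have k1: "kernel_bound 1 j = 81 / 400" using ij by (auto simp: kernel_bound_def ex_weight_def ex_gap_def)
  have 2: "norm (interaction j j \<phi> w) \<le> 18 / 5 * (384 * ex_eps)"
    using interaction_bound[OF j j w, of \<phi>] by (simp add: kernel_bound_def)
  have "norm (\<Sum>k=4..n. interaction k j \<phi> w) \<le> (\<Sum>k=4..n. ex_eps / n)"
  proof (rule sum_norm_le)
    fix k assume k: "k \<in> {4..n}"
    then have "k \<in> {1..n}" by simp
    from interaction_bound[OF this j w, of \<phi>]
    have "norm (interaction k j \<phi> w) \<le> 18 / 5 * (ex_eps / n * (81 / 25) / 16)"
      using k ij by (auto simp: kernel_bound_def ex_weight_def ex_gap_def)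
    also have "\<dots> = (ex_eps / n) * (729 / 1000)" by simp
    also have "\<dots> \<le> (ex_eps / n) * 1" by (rule mult_left_mono) (use ex_eps_pos in auto)
    finally show "norm (interaction k j \<phi> w) \<le> ex_eps / n" by simp
  qed
  also have "\<dots> = (real (n - 3) / n) * ex_eps" by simp
  also have "\<dots> \<le> 1 * ex_eps"
    by (rule mult_right_mono) (use n3 ex_eps_pos in \<open>auto simp: divide_le_eq\<close>)
  finally have 4: "norm (\<Sum>k=4..n. interaction k j \<phi> w) \<le> ex_eps" by simp
  have "(\<Sum>k=1..n. interaction k j \<phi> w)
      = interaction 1 j \<phi> w + interaction i j \<phi> w + interaction j j \<phi> w + (\<Sum>k=4..n. interaction k j \<phi> w)"
    unfolding sum_split_3[OF n3] using ij by auto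
  moreover have "szego j \<phi> w = ef \<phi> j w - (\<Sum>k=1..n. interaction k j \<phi> w)"
    using szego_eq[OF j, of w \<phi>] w by (simp add: interaction_def)
  ultimately have "szego j \<phi> w - (ef \<phi> j w - interaction i j \<phi> w)
      = - (interaction 1 j \<phi> w + interaction j j \<phi> w + (\<Sum>k=4..n. interaction k j \<phi> w))"
    by simp
  then have "norm (szego j \<phi> w - (ef \<phi> j w - interaction i j \<phi> w))
      = norm (interaction 1 j \<phi> w + interaction j j \<phi> w + (\<Sum>k=4..n. interaction k j \<phi> w))"
    by (simp only: norm_minus_cancel)
  also have "\<dots> \<le> norm (interaction 1 j \<phi> w) + norm (interaction j j \<phi> w) + norm (\<Sum>k=4..n. interaction k j \<phi> w)"
    using norm_triangle_ineq[of "interaction 1 j \<phi> w + interaction j j \<phi> w"]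
      norm_triangle_ineq[of "interaction 1 j \<phi> w" "interaction j j \<phi> w"] by (meson add_right_mono order_trans)
  finally show ?thesis using 1 2 4 ex_eps_pos unfolding k1 by linarith
qed

text \<open>Near 20 the other poles act mainly through the term \<open>1 / z\<close>, about 1 / 20,
  of the pole at 0. So the denominator is about \<open>1 - u / 20\<close>, and
  \<open>root_close\<close> makes the root nearly its inverse. The dominant error, below 5 / 10 ^ 9,
  is the deviation of \<open>1 / z\<close> from 1 / 20.\<close>

lemma root_3_near:
  assumes u: "norm u = 1"
  shows "norm (ef \<phi> 3 u - 1 / (1 - u / 20)) \<le> 1 / 10 ^ 8"
proof -
  define z where "z = Zf \<phi> 3 u"
  define b where "b = 1 - u / 20"
  have u2: "norm u \<le> 2" using u by simp
  have z: "z \<in> cball (ex_pole 3) (ex_rad 3)" unfolding z_def by (rule sp.branch_in[OF idx(3) u2])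
  have z16: "16 \<le> norm z"
    using pole_gap[OF idx(3) _ z, of 1] idx by (simp add: ex_gap_def ex_pole_def)
  then have z0: "z \<noteq> 0" by auto
  have "norm (z - 20) \<le> norm (z - ex_pole 3) + norm (ex_pole 3 - 20)"
    using norm_triangle_ineq[of "z - ex_pole 3" "ex_pole 3 - 20"] by simp
  moreover have "norm (ex_pole 3 - 20) = ex_eta"
  proof -
    have "ex_pole 3 - 20 = - (of_real ex_eta * \<i>)" by (simp add: ex_pole_def complex_eq_iff)
    then show ?thesis using ex_eta_pos by (simp add: norm_mult)
  qed
  moreover have "norm (z - ex_pole 3) \<le> ex_eta / 2"
    using z by (simp add: dist_norm norm_minus_commute ex_rad_def)
  ultimately have z20: "norm (z - 20) \<le> 3 / 2 * ex_eta" by linarith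
  have "1 / z - 1 / 20 = (20 - z) / (20 * z)" using z0 by (simp add: field_simps)
  then have "norm (1 / z - 1 / 20) = norm (z - 20) / (20 * norm z)"
    by (simp add: norm_divide norm_mult norm_minus_commute)
  also have "\<dots> \<le> (3 / 2 * ex_eta) / (20 * 16)" by (rule frac_le) (use z20 z16 ex_eta_pos in auto)
  finally have d1: "norm (1 / z - 1 / 20) \<le> (3 / 2 * ex_eta) / (20 * 16)" .
  let ?x = "\<lambda>k. if k = 1 then 0 else 1 / ex_gap 3 k"
  have "other_poles n (ex_res n \<phi>) ex_pole 3 z - 1 / z = (\<Sum>k\<in>{1..n} - {3} - {1}. ex_res n \<phi> k / (z - ex_pole k))"
    unfolding other_poles_def using idx(1)
    by (subst sum.remove[of _ 1]) (auto simp: ex_res_def ex_pole_def)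
  also have "norm \<dots> \<le> (\<Sum>k\<in>{1..n} - {3} - {1}. ex_weight n k / ex_gap 3 k)"
    by (rule sum_norm_le) (rule pole_term[OF idx(3) _ z], auto)
  also have "\<dots> = (\<Sum>k\<in>{1..n} - {3}. ex_weight n k * ?x k)"
    by (rule sum.mono_neutral_cong_left) auto
  also have "\<dots> \<le> (if (3::nat) = 1 then 0 else ?x 1) + ex_eps * (if (3::nat) = 2 then 0 else ?x 2)
       + ex_eps * (if (3::nat) = 3 then 0 else ?x 3) + ex_eps * (1 / 16)"
    by (rule ex_weighted_sum[OF n3]) (use ex_gap_pos in \<open>auto simp: less_imp_le\<close>, simp add: ex_gap_def)
  also have "\<dots> = ex_eps / ex_eta + ex_eps / 16" by (simp add: ex_gap_def)
  finally have d2: "norm (other_poles n (ex_res n \<phi>) ex_pole 3 z - 1 / z) \<le> ex_eps / ex_eta + ex_eps / 16" .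
  have "norm (other_poles n (ex_res n \<phi>) ex_pole 3 z - 1 / 20) \<le> 5 / 10 ^ 9"
    using d1 d2 norm_triangle_ineq[of "other_poles n (ex_res n \<phi>) ex_pole 3 z - 1 / z" "1 / z - 1 / 20"]
    by (simp add: ex_eps_def ex_eta_def)
  moreover have "b - yf \<phi> 3 u = u * (other_poles n (ex_res n \<phi>) ex_pole 3 z - 1 / 20)"
    by (simp add: branch_denom_def b_def z_def algebra_simps)
  ultimately have yb: "norm (b - yf \<phi> 3 u) \<le> 5 / 10 ^ 9" using u by (simp add: norm_mult)
  have b19: "19 / 20 \<le> norm b"
    using norm_triangle_ineq2[of 1 "u / 20"] u by (simp add: b_def norm_divide)
  have y: "3 / 4 \<le> norm (yf \<phi> 3 u)" "yf \<phi> 3 u \<noteq> 0"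
    using sp.denom_ge[OF idx(3) u2] sp.denom_nz[OF idx(3) u2] by auto
  have b0: "b \<noteq> 0" using b19 by auto
  have "ef \<phi> 3 u - 1 / b = (ef \<phi> 3 u * yf \<phi> 3 u - 1) / yf \<phi> 3 u + (b - yf \<phi> 3 u) / (yf \<phi> 3 u * b)"
    using y(2) b0 by (simp add: field_simps)
  then have "norm (ef \<phi> 3 u - 1 / b)
      \<le> norm (ef \<phi> 3 u * yf \<phi> 3 u - 1) / norm (yf \<phi> 3 u) + norm (b - yf \<phi> 3 u) / (norm (yf \<phi> 3 u) * norm b)"
    by (metis norm_divide norm_mult norm_triangle_ineq)
  also have "norm (ef \<phi> 3 u * yf \<phi> 3 u - 1) / norm (yf \<phi> 3 u) \<le> (11 * ex_eps) / (3 / 4)"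
    by (rule frac_le) (use sp.root_close[OF idx(3) u2, of \<phi>] y ex_eps_pos in auto)
  also have "norm (b - yf \<phi> 3 u) / (norm (yf \<phi> 3 u) * norm b) \<le> (5 / 10 ^ 9) / (3 / 4 * (19 / 20))"
    by (rule frac_le[OF _ yb _ mult_mono[OF y(1) b19]]) auto
  finally show ?thesis by (simp add: b_def ex_eps_def)
qed

text \<open>
  The pole at \<open>0\<close> makes the integrand nonconstant; otherwise the integral would vanish and the pair would not
  interact to leading order.
\<close>
lemma cint_geometric_square: "cint 1 (\<lambda>u. cnj (1 / (1 - u / 20)) * (1 / (1 - u / 20))) = 20 / 399"
proof -
  have "cint 1 (\<lambda>u. cnj (1 / (1 - u / 20)) * (1 / (1 - u / 20))) = cint 1 (\<lambda>u. (u / (1 - u / 20)) / (u - 1 / 20))"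
  proof (rule cint_cong)
    fix u :: complex assume u: "norm u = 1"
    then have "u * cnj u = 1" by (simp add: complex_norm_square[symmetric])
    moreover have u0: "u \<noteq> 0" using u by auto
    ultimately have cu: "cnj u = 1 / u" by (simp add: field_simps)
    have "u \<noteq> 1 / 20"
    proof
      assume "u = 1 / 20"
      from arg_cong[where f=norm, OF this] show False unfolding u by (simp add: norm_divide)
    qed
    then have "1 - cnj u / 20 \<noteq> 0" "u - 1 / 20 \<noteq> 0" using u0 by (auto simp: cu field_simps)
    \<comment> \<open>On the circle the conjugate is a function with a single pole, at 1 / 20 inside
      the disc, where Cauchy's formula evaluates \<open>u / (1 - u / 20)\<close>.\<close>
    then have "cnj (1 / (1 - u / 20)) = u / (u - 1 / 20)"
      using u0 by (simp add: cu field_simps)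
    then show "cnj (1 / (1 - u / 20)) * (1 / (1 - u / 20)) = (u / (1 - u / 20)) / (u - 1 / 20)"
      by simp
  qed simp
  also have "\<dots> = (1 / 20) / (1 - (1 / 20) / 20)"
  proof (rule cint_Cauchy)
    show "(\<lambda>u. u / (1 - u / 20)) holomorphic_on ball 0 2"
    proof (intro holomorphic_intros)
      fix u :: complex assume "u \<in> ball 0 2"
      then show "1 - u / 20 \<noteq> 0" by auto
    qed auto
  qed (auto simp: norm_divide)
  finally show ?thesis by simp
qed

text \<open>To leading order, density and root on hole 3 are both \<open>1 / (1 - u / 20)\<close>
  and the distance \<open>D u\<close> is constant, which leads to
  \<open>cint_geometric_square\<close>. Errors of density and root are divided by distances of order
  \<open>ex_eta\<close>, hence the accuracy of order 1 / 10 ^ 8; the reciprocal distance is off by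
  at most \<open>ex_eps / ex_eta^2 = 1 / 10 ^ 6\<close>.\<close>

lemma interaction_32:
  "norm (interaction 3 2 \<phi> 0 - ex_eps * (20 / 399) / (ex_pole 3 - ex_pole 2)) \<le> ex_eps"
proof -
  define c where "c u = 1 / (1 - u / 20)" for u :: complex
  define D where "D u = Zf \<phi> 3 u - ex_pole 2" for u
  define D0 where "D0 = ex_pole 3 - ex_pole 2"
  have D0: "norm D0 = 2 * ex_eta"
  proof -
    have "D0 = - (of_real (2 * ex_eta) * \<i>)" by (simp add: D0_def ex_pole_def complex_eq_iff)
    then show ?thesis using ex_eta_pos by (simp add: norm_mult)
  qed
  then have D00: "D0 \<noteq> 0" using ex_eta_pos by auto
  have den: "19 / 20 \<le> norm (1 - u / 20)" if "norm u = 1" for u :: complex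
    using norm_triangle_ineq2[of 1 "u / 20"] that by (simp add: norm_divide)
  have den0: "1 - u / 20 \<noteq> 0" if "norm u = 1" for u :: complex using den[OF that] by auto
  have cc: "continuous_on (sphere 0 1) c"
    unfolding c_def by (intro continuous_intros) (use den0 in auto)
  have cb: "norm (c u) \<le> 20 / 19" if "norm u = 1" for u
  proof -
    have "1 / norm (1 - u / 20) \<le> 1 / (19 / 20)" by (rule frac_le) (use den[OF that] in auto)
    then show ?thesis by (simp add: c_def norm_divide)
  qed
  have ker: "coupling_kernel 3 2 \<phi> u 0 = ex_eps * (ef \<phi> 3 u / D u)" for u
    using sp.root_0[of \<phi> 2] sp.branch_0[OF idx(2), of \<phi>] by (simp add: coupling_kernel_def ex_weight_def D_def)
  have kc: "continuous_on (sphere 0 1) (\<lambda>u. coupling_kernel 3 2 \<phi> u 0)"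
    by (rule continuous_coupling_kernel_u[OF idx(3,2)]) simp
  have eq: "interaction 3 2 \<phi> 0 - ex_eps * (20 / 399) / D0
      = cint 1 (\<lambda>u. cnj (szego 3 \<phi> u) * coupling_kernel 3 2 \<phi> u 0 - ex_eps / D0 * (cnj (c u) * c u))"
  proof -
    have "cint 1 (\<lambda>u. cnj (c u) * c u) = 20 / 399"
      unfolding c_def by (rule cint_geometric_square)
    then have "cint 1 (\<lambda>u. ex_eps / D0 * (cnj (c u) * c u)) = ex_eps / D0 * (20 / 399)"
      by (simp only: cint_cmult)
    moreover have "cint 1 (\<lambda>u. cnj (szego 3 \<phi> u) * coupling_kernel 3 2 \<phi> u 0 - ex_eps / D0 * (cnj (c u) * c u))
        = cint 1 (\<lambda>u. cnj (szego 3 \<phi> u) * coupling_kernel 3 2 \<phi> u 0) - cint 1 (\<lambda>u. ex_eps / D0 * (cnj (c u) * c u))"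
      by (intro cint_diff continuous_intros continuous_szego[OF idx(3)] kc cc) (use D00 in auto)
    ultimately show ?thesis
      unfolding interaction_def by simp
  qed
  have "norm (cint 1 (\<lambda>u. cnj (szego 3 \<phi> u) * coupling_kernel 3 2 \<phi> u 0 - ex_eps / D0 * (cnj (c u) * c u)))
      \<le> 1 * ex_eps"
  proof (rule norm_cint_le)
    show "continuous_on (sphere 0 1) (\<lambda>u. cnj (szego 3 \<phi> u) * coupling_kernel 3 2 \<phi> u 0 - ex_eps / D0 * (cnj (c u) * c u))"
      by (intro continuous_intros continuous_szego[OF idx(3)] kc cc)
  next
    fix u :: complex assume u: "norm u = 1"
    have u2: "norm u \<le> 2" and u1: "norm u \<le> 1" using u by auto
    have ec: "norm (ef \<phi> 3 u - c u) \<le> 1 / 10 ^ 8" unfolding c_def by (rule root_3_near[OF u])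
    have "norm (interaction 2 3 \<phi> u) \<le> 18 / 5 * (ex_eps * (81 / 25) / ex_eta)"
      using interaction_bound[OF idx(2,3) u1, of \<phi>] by (simp add: kernel_bound_def ex_weight_def ex_gap_def)
    moreover have "norm (szego 3 \<phi> u - (ef \<phi> 3 u - interaction 2 3 \<phi> u)) \<le> 1700 * ex_eps"
      by (rule szego_pair[OF _ u1]) simp
    moreover have "szego 3 \<phi> u - c u = (szego 3 \<phi> u - (ef \<phi> 3 u - interaction 2 3 \<phi> u))
        + ((ef \<phi> 3 u - c u) - interaction 2 3 \<phi> u)" by simp
    then have "norm (szego 3 \<phi> u - c u) \<le> norm (szego 3 \<phi> u - (ef \<phi> 3 u - interaction 2 3 \<phi> u))
        + (norm (ef \<phi> 3 u - c u) + norm (interaction 2 3 \<phi> u))"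
      using norm_triangle_ineq[of "szego 3 \<phi> u - (ef \<phi> 3 u - interaction 2 3 \<phi> u)"
        "(ef \<phi> 3 u - c u) - interaction 2 3 \<phi> u"]
        norm_triangle_ineq4[of "ef \<phi> 3 u - c u" "interaction 2 3 \<phi> u"]
      by (simp only:)
    ultimately have Fc: "norm (szego 3 \<phi> u - c u) \<le> 2 / 10 ^ 8"
      using ec by (simp add: ex_eps_def ex_eta_def)
    have D: "ex_eta \<le> norm (D u)"
      using pole_gap[OF idx(3) _ sp.branch_in[OF idx(3) u2, of \<phi>], of 2] idx(2)
      by (simp add: D_def ex_gap_def)
    then have Dn: "D u \<noteq> 0" using ex_eta_pos by auto
    have "D u - D0 = ex_res n \<phi> 3 * u / yf \<phi> 3 u"
      using sp.branch_eq[OF idx(3) u2, of \<phi>] by (simp add: D_def D0_def)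
    then have "norm (D u - D0) = ex_eps / norm (yf \<phi> 3 u)"
      by (simp add: norm_divide norm_mult norm_ex_res u ex_weight_def)
    also have "\<dots> \<le> ex_eps / (3 / 4)"
      by (rule frac_le) (use sp.denom_ge[OF idx(3) u2] ex_eps_pos in auto)
    finally have DD: "norm (D u - D0) \<le> 2 * ex_eps" using ex_eps_pos by simp
    have "1 / D u - 1 / D0 = - ((D u - D0) / (D u * D0))" using Dn D00 by (simp add: field_simps)
    then have "norm (1 / D u - 1 / D0) = norm (D u - D0) / (norm (D u) * norm D0)"
      by (simp only: norm_minus_cancel norm_divide norm_mult)
    also have "\<dots> \<le> 2 * ex_eps / (ex_eta * (2 * ex_eta))"
      by (rule frac_le) (use DD D D0 ex_eta_pos ex_eps_pos in \<open>auto intro!: mult_mono\<close>)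
    also have "\<dots> = 1 / 10 ^ 6" by (simp add: ex_eps_def ex_eta_def)
    finally have iD: "norm (1 / D u - 1 / D0) \<le> 1 / 10 ^ 6" .
    have num: "norm (cnj (szego 3 \<phi> u) * ef \<phi> 3 u - cnj (c u) * c u) \<le> 5 / 10 ^ 8"
    proof -
      have "cnj (szego 3 \<phi> u) * ef \<phi> 3 u - cnj (c u) * c u
          = cnj (szego 3 \<phi> u - c u) * ef \<phi> 3 u + cnj (c u) * (ef \<phi> 3 u - c u)"
        by (simp add: algebra_simps)
      then have "norm (cnj (szego 3 \<phi> u) * ef \<phi> 3 u - cnj (c u) * c u)
          \<le> norm (szego 3 \<phi> u - c u) * norm (ef \<phi> 3 u) + norm (c u) * norm (ef \<phi> 3 u - c u)"
        by (metis complex_mod_cnj norm_mult norm_triangle_ineq)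
      also have "\<dots> \<le> 2 / 10 ^ 8 * (9 / 5) + 20 / 19 * (1 / 10 ^ 8)"
        by (intro add_mono mult_mono Fc cb[OF u] ec sp.root_le[OF idx(3) u2]) auto
      finally show ?thesis by simp
    qed
    have "cnj (szego 3 \<phi> u) * coupling_kernel 3 2 \<phi> u 0 - ex_eps / D0 * (cnj (c u) * c u)
        = ex_eps * ((cnj (szego 3 \<phi> u) * ef \<phi> 3 u - cnj (c u) * c u) / D u
           + (cnj (c u) * c u) * (1 / D u - 1 / D0))"
      unfolding ker by (simp add: algebra_simps diff_divide_distrib)
    then have "norm (cnj (szego 3 \<phi> u) * coupling_kernel 3 2 \<phi> u 0 - ex_eps / D0 * (cnj (c u) * c u))
        = ex_eps * norm ((cnj (szego 3 \<phi> u) * ef \<phi> 3 u - cnj (c u) * c u) / D u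
           + (cnj (c u) * c u) * (1 / D u - 1 / D0))"
      using ex_eps_pos by (simp add: norm_mult)
    also have "\<dots> \<le> ex_eps * 1"
    proof (rule mult_left_mono)
      have "norm ((cnj (szego 3 \<phi> u) * ef \<phi> 3 u - cnj (c u) * c u) / D u) \<le> (5 / 10 ^ 8) / ex_eta"
        unfolding norm_divide by (rule frac_le) (use num D ex_eta_pos in auto)
      moreover have "norm ((cnj (c u) * c u) * (1 / D u - 1 / D0)) \<le> (20 / 19 * (20 / 19)) * (1 / 10 ^ 6)"
        unfolding norm_mult complex_mod_cnj by (intro mult_mono cb[OF u] iD) auto
      ultimately show "norm ((cnj (szego 3 \<phi> u) * ef \<phi> 3 u - cnj (c u) * c u) / D u
           + (cnj (c u) * c u) * (1 / D u - 1 / D0)) \<le> 1"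
        using norm_triangle_ineq[of "(cnj (szego 3 \<phi> u) * ef \<phi> 3 u - cnj (c u) * c u) / D u"
          "(cnj (c u) * c u) * (1 / D u - 1 / D0)"] by (simp add: ex_eta_def)
    qed (use ex_eps_pos in simp)
    finally show "norm (cnj (szego 3 \<phi> u) * coupling_kernel 3 2 \<phi> u 0 - ex_eps / D0 * (cnj (c u) * c u)) \<le> ex_eps"
      by simp
  qed simp
  then show ?thesis unfolding eq[unfolded D0_def] D0_def by simp
qed

text \<open>The poles of the pair differ by a purely imaginary number, so the leading interaction is
  imaginary. Its size \<open>ex_eps * (10 / 399) / ex_eta\<close> is about
  \<open>25000 * ex_eps\<close>, well above the accumulated error
  \<open>1701 * ex_eps\<close>.\<close>

lemma szego_2_0:
  "Im (szego 2 \<phi> 0) < 0" "\<bar>Im (szego 2 \<phi> 0)\<bar> < Re (szego 2 \<phi> 0)"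
proof -
  let ?m = "ex_eps * (20 / 399) / (ex_pole 3 - ex_pole 2)"
  have m: "?m = Complex 0 (ex_eps * (10 / 399) / ex_eta)"
  proof -
    have "ex_pole 3 - ex_pole 2 = - 2 * \<i> * ex_eta" by (simp add: ex_pole_def complex_eq_iff)
    then show ?thesis using ex_eta_pos
      by (simp only:) (simp add: complex_eq_iff Re_divide Im_divide power2_eq_square)
  qed
  have "norm (szego 2 \<phi> 0 - (1 - interaction 3 2 \<phi> 0)) \<le> 1700 * ex_eps"
    using szego_pair[of 3 2 0 \<phi>] sp.root_0[of \<phi> 2] by simp
  moreover have "szego 2 \<phi> 0 - (1 - ?m)
      = (szego 2 \<phi> 0 - (1 - interaction 3 2 \<phi> 0)) - (interaction 3 2 \<phi> 0 - ?m)" by simp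
  then have "norm (szego 2 \<phi> 0 - (1 - ?m))
      \<le> norm (szego 2 \<phi> 0 - (1 - interaction 3 2 \<phi> 0)) + norm (interaction 3 2 \<phi> 0 - ?m)"
    using norm_triangle_ineq4 by metis
  ultimately have close: "norm (szego 2 \<phi> 0 - (1 - ?m)) \<le> 1701 * ex_eps"
    using interaction_32[of \<phi>] by linarith
  have "\<bar>Im (szego 2 \<phi> 0 - (1 - ?m))\<bar> \<le> 1701 * ex_eps" "\<bar>Re (szego 2 \<phi> 0 - (1 - ?m))\<bar> \<le> 1701 * ex_eps"
    using close abs_Im_le_cmod abs_Re_le_cmod order_trans by blast+
  then have im: "\<bar>Im (szego 2 \<phi> 0) + ex_eps * (10 / 399) / ex_eta\<bar> \<le> 1701 * ex_eps"
    and re: "\<bar>Re (szego 2 \<phi> 0) - 1\<bar> \<le> 1701 * ex_eps"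
    unfolding m by simp_all
  have "ex_eps * (10 / 399) / ex_eta = 1 / 39900000000000" "1701 * ex_eps = 1701 / 1000000000000000000"
    by (simp_all add: ex_eps_def ex_eta_def)
  then show "Im (szego 2 \<phi> 0) < 0" "\<bar>Im (szego 2 \<phi> 0)\<bar> < Re (szego 2 \<phi> 0)"
    using im re by linarith+
qed

lemma exists_ahlfors_nonreal_residue:
  "\<exists>a p. rational_ahlfors_function n (pf_map n a p) \<and> has_partial_fractions n (pf_map n a p) a p \<and> a 2 \<notin> \<real>"
proof -
  define H where "H \<phi> = ex_res n \<phi> 2 * (szego 2 \<phi> 0)\<^sup>2" for \<phi>
  \<comment> \<open>\<open>X\<close> and \<open>Y\<close> vary with \<phi>, but the signs of
    \<open>2 * X * Y\<close> and of \<open>X^2 - Y^2\<close> are the same for all \<phi>; they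
    decide the sign of \<open>Im (H \<phi>)\<close> at 0 and at \<open>pi/2\<close>.\<close>
  have H: "Im (H \<phi>) = ex_eps * (cos \<phi> * (2 * X * Y) + sin \<phi> * (X\<^sup>2 - Y\<^sup>2))"
    "Re (H \<phi>) = ex_eps * (cos \<phi> * (X\<^sup>2 - Y\<^sup>2) - sin \<phi> * (2 * X * Y))"
    if "X = Re (szego 2 \<phi> 0)" "Y = Im (szego 2 \<phi> 0)" for \<phi> X Y
    unfolding that H_def ex_res_def by (simp_all add: power2_eq_square algebra_simps)
  have XY: "2 * Re (szego 2 \<phi> 0) * Im (szego 2 \<phi> 0) < 0"
    "(Re (szego 2 \<phi> 0))\<^sup>2 - (Im (szego 2 \<phi> 0))\<^sup>2 > 0" for \<phi>
  proof -
    have "Re (szego 2 \<phi> 0) > 0" using szego_2_0(2)[of \<phi>] by linarith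
    then show "2 * Re (szego 2 \<phi> 0) * Im (szego 2 \<phi> 0) < 0"
      using szego_2_0(1)[of \<phi>] by (intro mult_pos_neg) auto
    have "\<bar>Im (szego 2 \<phi> 0)\<bar>\<^sup>2 < (Re (szego 2 \<phi> 0))\<^sup>2"
      by (rule power_strict_mono[OF szego_2_0(2)]) auto
    then show "(Re (szego 2 \<phi> 0))\<^sup>2 - (Im (szego 2 \<phi> 0))\<^sup>2 > 0" by simp
  qed
  have cont: "continuous_on {0..pi/2} (\<lambda>\<phi>. Im (H \<phi>))"
    unfolding H_def
    by (intro continuous_intros continuous_on_subset[OF szego_continuous[OF idx(2)]]
          continuous_on_subset[OF continuous_A[OF idx(2)]]) auto
  have lo: "Im (H 0) < 0"
    using H(1)[OF refl refl, of 0] XY(1)[of 0] ex_eps_pos by (simp add: mult_pos_neg)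
  have hi: "Im (H (pi/2)) > 0"
    using H(1)[OF refl refl, of "pi/2"] XY(2)[of "pi/2"] ex_eps_pos by simp
  obtain \<phi> where \<phi>: "0 \<le> \<phi>" "\<phi> \<le> pi/2" "Im (H \<phi>) = 0"
    using IVT'[of "\<lambda>\<phi>. Im (H \<phi>)" 0 0 "pi/2"] cont lo hi by auto
  \<comment> \<open>The strict signs exclude the endpoints; \<open>sin \<phi> > 0\<close> then makes
    the residue nonreal, and both signs together give \<open>Re (H \<phi>) > 0\<close>.\<close>
  have "\<phi> \<noteq> 0" "\<phi> \<noteq> pi/2" using \<phi>(3) lo hi by (metis order_less_irrefl)+
  then have \<phi>': "0 < \<phi>" "\<phi> < pi/2" using \<phi> by auto
  have cs: "cos \<phi> > 0" "sin \<phi> > 0" using \<phi>' by (auto intro!: cos_gt_zero sin_gt_zero)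
  have "Re (H \<phi>) > 0"
  proof -
    have "cos \<phi> * ((Re (szego 2 \<phi> 0))\<^sup>2 - (Im (szego 2 \<phi> 0))\<^sup>2) > 0"
      by (rule mult_pos_pos[OF cs(1) XY(2)])
    moreover have "sin \<phi> * (2 * Re (szego 2 \<phi> 0) * Im (szego 2 \<phi> 0)) < 0"
      by (rule mult_pos_neg[OF cs(2) XY(1)])
    ultimately have "cos \<phi> * ((Re (szego 2 \<phi> 0))\<^sup>2 - (Im (szego 2 \<phi> 0))\<^sup>2)
        - sin \<phi> * (2 * Re (szego 2 \<phi> 0) * Im (szego 2 \<phi> 0)) > 0" by linarith
    then show ?thesis unfolding H(2)[OF refl refl] by (rule mult_pos_pos[OF ex_eps_pos])
  qed
  then have ahl: "rational_ahlfors_function n (pf_map n (ex_res n \<phi>) ex_pole)"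
  proof (intro ahlfors_if_real_at[OF idx(2)])
    fix j assume "j \<in> {1..n}" "j \<noteq> 2" "j \<noteq> ex_swap 2"
    then show "ex_swap j = j \<and> Re (ex_res n \<phi> j) > 0"
      using ex_eps_pos n3 by (auto simp: ex_swap_def ex_res_def)
  qed (use \<phi>(3) in \<open>auto simp: H_def\<close>)
  have "has_partial_fractions n (pf_map n (ex_res n \<phi>) ex_pole) (ex_res n \<phi>) ex_pole"
    by (rule has_partial_fractions_pf_map[OF sp.inj_p A_nonzero])
  moreover have "ex_res n \<phi> 2 \<notin> \<real>"
    using cs ex_eps_pos by (simp add: ex_res_def complex_is_Real_iff)
  ultimately show ?thesis using ahl by blast
qed

end

theorem theorem1p5:
  fixes n :: nat
  assumes "n \<ge> 3"
  shows "(\<exists>R a p. rational_map n R \<and> has_partial_fractions n R a p \<and>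
            (\<forall>j\<in>{1..n}. a j \<in> \<real> \<and> Re (a j) > 0) \<and>
            \<not> rational_ahlfors_function n R) \<and>
         (\<exists>R a p. rational_ahlfors_function n R \<and> has_partial_fractions n R a p \<and>
            \<not> (\<forall>j\<in>{1..n}. a j \<in> \<real> \<and> Re (a j) > 0))"
proof
  show "\<exists>R a p. rational_map n R \<and> has_partial_fractions n R a p \<and>
      (\<forall>j\<in>{1..n}. a j \<in> \<real> \<and> Re (a j) > 0) \<and> \<not> rational_ahlfors_function n R"
    using exists_positive_residues_not_good[OF assms] unfolding rational_ahlfors_function_def by blast
  interpret example_family n by unfold_locales (rule assms)
  obtain a p where *: "rational_ahlfors_function n (pf_map n a p)"
      "has_partial_fractions n (pf_map n a p) a p" "a 2 \<notin> \<real>"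
    using exists_ahlfors_nonreal_residue by blast
  show "\<exists>R a p. rational_ahlfors_function n R \<and> has_partial_fractions n R a p \<and>
      \<not> (\<forall>j\<in>{1..n}. a j \<in> \<real> \<and> Re (a j) > 0)"
    using * idx(2) by blast
qed

end
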